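(* Let $X$ and $Y$ be anisotropic quasilinear $p$-hypersurfaces of the same dimension $d$ over $F$. Suppose that there exist rational morphisms $X \dashrightarrow Y$ and $Y \dashrightarrow X$, and let $n$ be the unique non-negative integer satisfying $p^n < d+2 \leq p^{n+1}$. If $d \leq p^n + n$, then $X$ and $Y$ are birational over $F$.
   Context: $p$ is a prime and $F$ is a non-perfect field of characteristic $p$. Rational morphisms are over the base field and need not be dominant. A quasilinear $p$-form over $F$ is a map $\varphi\colon V_\varphi \to F$ on a finite-dimensional $F$-vector space $V_\varphi$ with $\varphi(\lambda v)=\lambda^p\varphi(v)$ and $\varphi(v+w)=\varphi(v)+\varphi(w)$ for all $\lambda\in F$, $v,w\in V_\varphi$ (in coordinates, $a_1x_1^p+\dots+a_nx_n^p$). It is isotropic if $\varphi(v)=0$ for some $v\ne 0$, and anisotropic otherwise. For a quasilinear $p$-form $\varphi$ over $F$ with $\dim V_\varphi=d+2\ge 2$, $X_\varphi=\{\varphi=0\}\subset\mathbb{P}(V_\varphi)$ is the associated projective hypersurface, of dimension $d$; schemes of this type are called quasilinear $p$-hypersurfaces. $X_\varphi$ is called anisotropic if $\varphi$ is; in that case it is integral. *)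

theory Defs
  imports
    "HOL-Analysis.Abstract_Topology"
    "HOL-Algebra.QuotRing"
    "HOL-Library.Poly_Mapping"
    "HOL-Computational_Algebra.Primes"
begin

section \<open>Ringed spaces over a field and rational morphisms\<close>

text \<open>A space with a sheaf of algebras over a field: \<open>sec X U\<close> is the ring of sections over the
  open set \<open>U\<close>, \<open>res X U V\<close> the restriction map from \<open>U\<close> to \<open>V\<close> (for \<open>V \<subseteq> U\<close>), and \<open>scal X U\<close>
  the structure map from the base field to \<open>sec X U\<close>.\<close>

record ('a, 's, 'k) ringed_space =
  base :: "'a topology"
  sec :: "'a set \<Rightarrow> 's ring"
  res :: "'a set \<Rightarrow> 'a set \<Rightarrow> 's \<Rightarrow> 's"
  scal :: "'a set \<Rightarrow> 'k \<Rightarrow> 's"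

definition open_subspace ::
  "('a, 's, 'k) ringed_space \<Rightarrow> 'a set \<Rightarrow> ('a, 's, 'k) ringed_space" where
  "open_subspace X U = X\<lparr>base := subtopology (base X) U\<rparr>"

definition unit_at :: "('a, 's, 'k) ringed_space \<Rightarrow> 'a set \<Rightarrow> 's \<Rightarrow> 'a \<Rightarrow> bool" where
  "unit_at X U s x \<longleftrightarrow>
    (\<exists>V. openin (base X) V \<and> x \<in> V \<and> V \<subseteq> U \<and> res X U V s \<in> Units (sec X V))"

definition preim :: "('a, 's, 'k) ringed_space \<Rightarrow> ('a \<Rightarrow> 'b) \<Rightarrow> 'b set \<Rightarrow> 'a set" where
  "preim X h V = {x \<in> topspace (base X). h x \<in> V}"

text \<open>Morphisms of locally ringed spaces over the base field. The last clause says that the maps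
  induced on stalks are local, i.e. reflect units; the germ of \<open>s\<close> at \<open>x\<close> is a unit of the stalk iff
  \<open>s\<close> restricts to a unit on some open neighbourhood of \<open>x\<close>.\<close>

definition morphism ::
  "('a, 's, 'k) ringed_space \<Rightarrow> ('b, 't, 'k) ringed_space \<Rightarrow> ('a \<Rightarrow> 'b) \<Rightarrow> ('b set \<Rightarrow> 't \<Rightarrow> 's) \<Rightarrow> bool"
where
  "morphism X Y h \<theta> \<longleftrightarrow>
     continuous_map (base X) (base Y) h \<and>
     (\<forall>V. openin (base Y) V \<longrightarrow>
        \<theta> V \<in> ring_hom (sec Y V) (sec X (preim X h V)) \<and>
        (\<forall>c. \<theta> V (scal Y V c) = scal X (preim X h V) c)) \<and>
     (\<forall>V W. openin (base Y) V \<and> openin (base Y) W \<and> W \<subseteq> V \<longrightarrow>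
        (\<forall>s\<in>carrier (sec Y V).
           \<theta> W (res Y V W s) = res X (preim X h V) (preim X h W) (\<theta> V s))) \<and>
     (\<forall>V. openin (base Y) V \<longrightarrow>
        (\<forall>s\<in>carrier (sec Y V). \<forall>x\<in>preim X h V.
           unit_at X (preim X h V) (\<theta> V s) x \<longrightarrow> unit_at Y V s (h x)))"

definition isomorphic :: "('a, 's, 'k) ringed_space \<Rightarrow> ('b, 't, 'k) ringed_space \<Rightarrow> bool" where
  "isomorphic X Y \<longleftrightarrow>
     (\<exists>h \<theta> k \<eta>. morphism X Y h \<theta> \<and> morphism Y X k \<eta> \<and>
        (\<forall>x\<in>topspace (base X). k (h x) = x) \<and>
        (\<forall>y\<in>topspace (base Y). h (k y) = y) \<and>
        (\<forall>V. openin (base Y) V \<longrightarrow> (\<forall>s\<in>carrier (sec Y V). \<eta> (preim X h V) (\<theta> V s) = s)) \<and>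
        (\<forall>U. openin (base X) U \<longrightarrow> (\<forall>s\<in>carrier (sec X U). \<theta> (preim Y k U) (\<eta> U s) = s)))"

definition dense_open :: "('a, 's, 'k) ringed_space \<Rightarrow> 'a set \<Rightarrow> bool" where
  "dense_open X U \<longleftrightarrow> openin (base X) U \<and> base X closure_of U = topspace (base X)"

text \<open>A rational morphism is an equivalence class of morphisms defined on dense open subsets, so
  one exists iff there is a morphism on some dense open subset.\<close>

definition exists_rational_morphism ::
  "('a, 's, 'k) ringed_space \<Rightarrow> ('b, 't, 'k) ringed_space \<Rightarrow> bool" where
  "exists_rational_morphism X Y \<longleftrightarrow> (\<exists>U h \<theta>. dense_open X U \<and> morphism (open_subspace X U) Y h \<theta>)"

definition birational :: "('a, 's, 'k) ringed_space \<Rightarrow> ('b, 't, 'k) ringed_space \<Rightarrow> bool" where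
  "birational X Y \<longleftrightarrow>
     (\<exists>U V. dense_open X U \<and> dense_open Y V \<and>
        isomorphic (open_subspace X U) (open_subspace Y V))"


section \<open>The projective spectrum of a graded algebra\<close>

text \<open>\<open>S\<close> is a commutative ring, \<open>D n\<close> its homogeneous component of degree \<open>n\<close> (including zero) and
  \<open>\<kappa>\<close> the structure map from the base field to \<open>D 0\<close>.\<close>

definition proj_points :: "'s ring \<Rightarrow> (nat \<Rightarrow> 's set) \<Rightarrow> 's set set" where
  "proj_points S D =
     {P. primeideal P S \<and> P = genideal S (P \<inter> (\<Union>n. D n)) \<and> \<not> (\<Union>n\<in>{0<..}. D n) \<subseteq> P}"

definition zariski :: "'s ring \<Rightarrow> (nat \<Rightarrow> 's set) \<Rightarrow> 's set topology" where
  "zariski S D =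
     topology_generated_by {{P \<in> proj_points S D. f \<notin> P} | f. f \<in> (\<Union>n. D n)}"

text \<open>The stalk at \<open>P\<close> is the degree-zero part of the localization of \<open>S\<close> at the homogeneous elements
  outside \<open>P\<close>. A fraction \<open>a / f\<close> is encoded as the set of all pairs equivalent to \<open>(a, f)\<close>.\<close>

definition fraction_pairs :: "(nat \<Rightarrow> 's set) \<Rightarrow> 's set \<Rightarrow> ('s \<times> 's) set" where
  "fraction_pairs D P = {(a, f). \<exists>n. a \<in> D n \<and> f \<in> D n \<and> f \<notin> P}"

definition frac_class :: "'s ring \<Rightarrow> (nat \<Rightarrow> 's set) \<Rightarrow> 's set \<Rightarrow> 's \<Rightarrow> 's \<Rightarrow> ('s \<times> 's) set" where
  "frac_class S D P a f =
     {(b, g) \<in> fraction_pairs D P.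
        \<exists>u\<in>(\<Union>n. D n) - P. u \<otimes>\<^bsub>S\<^esub> (a \<otimes>\<^bsub>S\<^esub> g \<ominus>\<^bsub>S\<^esub> b \<otimes>\<^bsub>S\<^esub> f) = \<zero>\<^bsub>S\<^esub>}"

definition stalk :: "'s ring \<Rightarrow> (nat \<Rightarrow> 's set) \<Rightarrow> 's set \<Rightarrow> ('s \<times> 's) set ring" where
  "stalk S D P =
     \<lparr>carrier = {frac_class S D P a f | a f. (a, f) \<in> fraction_pairs D P},
      monoid.mult = (\<lambda>x y. \<Union>(a, f)\<in>x. \<Union>(b, g)\<in>y. frac_class S D P (a \<otimes>\<^bsub>S\<^esub> b) (f \<otimes>\<^bsub>S\<^esub> g)),
      one = frac_class S D P \<one>\<^bsub>S\<^esub> \<one>\<^bsub>S\<^esub>,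
      zero = frac_class S D P \<zero>\<^bsub>S\<^esub> \<one>\<^bsub>S\<^esub>,
      add = (\<lambda>x y. \<Union>(a, f)\<in>x. \<Union>(b, g)\<in>y.
               frac_class S D P (a \<otimes>\<^bsub>S\<^esub> g \<oplus>\<^bsub>S\<^esub> b \<otimes>\<^bsub>S\<^esub> f) (f \<otimes>\<^bsub>S\<^esub> g))\<rparr>"

text \<open>Sections are functions to the stalks that are locally given by a single fraction; outside
  their domain they take the value \<open>undefined\<close>.\<close>

definition regular_sections ::
  "'s ring \<Rightarrow> (nat \<Rightarrow> 's set) \<Rightarrow> 's set set \<Rightarrow> ('s set \<Rightarrow> ('s \<times> 's) set) set" where
  "regular_sections S D U =
     {s \<in> (\<Pi>\<^sub>E P\<in>U. carrier (stalk S D P)).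
        \<forall>P\<in>U. \<exists>V a f n. openin (zariski S D) V \<and> P \<in> V \<and> V \<subseteq> U \<and> a \<in> D n \<and> f \<in> D n \<and>
          (\<forall>Q\<in>V. f \<notin> Q \<and> s Q = frac_class S D Q a f)}"

definition Proj ::
  "'s ring \<Rightarrow> (nat \<Rightarrow> 's set) \<Rightarrow> ('k \<Rightarrow> 's) \<Rightarrow> ('s set, 's set \<Rightarrow> ('s \<times> 's) set, 'k) ringed_space"
where
  "Proj S D \<kappa> =
     \<lparr>base = zariski S D,
      sec = (\<lambda>U. \<lparr>carrier = regular_sections S D U,
                  monoid.mult = (\<lambda>s t. \<lambda>P\<in>U. s P \<otimes>\<^bsub>stalk S D P\<^esub> t P),
                  one = (\<lambda>P\<in>U. \<one>\<^bsub>stalk S D P\<^esub>),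
                  zero = (\<lambda>P\<in>U. \<zero>\<^bsub>stalk S D P\<^esub>),
                  add = (\<lambda>s t. \<lambda>P\<in>U. s P \<oplus>\<^bsub>stalk S D P\<^esub> t P)\<rparr>),
      res = (\<lambda>U V s. restrict s V),
      scal = (\<lambda>U c. \<lambda>P\<in>U. frac_class S D P (\<kappa> c) \<one>\<^bsub>S\<^esub>)\<rparr>"


section \<open>Quasilinear p-forms and their hypersurfaces\<close>

definition quasilinear_form ::
  "nat \<Rightarrow> ('k::field \<Rightarrow> 'v::ab_group_add \<Rightarrow> 'v) \<Rightarrow> ('v \<Rightarrow> 'k) \<Rightarrow> bool" where
  "quasilinear_form p scale \<phi> \<longleftrightarrow>
     (\<forall>c v. \<phi> (scale c v) = c ^ p * \<phi> v) \<and> (\<forall>v w. \<phi> (v + w) = \<phi> v + \<phi> w)"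

definition isotropic :: "('v::zero \<Rightarrow> 'k::zero) \<Rightarrow> bool" where
  "isotropic \<phi> \<longleftrightarrow> (\<exists>v. v \<noteq> 0 \<and> \<phi> v = 0)"

text \<open>Polynomials in variables indexed by the elements of a basis \<open>B\<close>; the variable of \<open>b\<close> is the
  coordinate function dual to \<open>b\<close>. A monomial is its exponent function.\<close>

type_synonym ('v, 'k) mpoly = "('v \<Rightarrow>\<^sub>0 nat) \<Rightarrow>\<^sub>0 'k"

definition coord_ring :: "'v set \<Rightarrow> ('v, 'k::field) mpoly ring" where
  "coord_ring B =
     \<lparr>carrier = {f. \<forall>m\<in>Poly_Mapping.keys f. Poly_Mapping.keys m \<subseteq> B},
      monoid.mult = (*), one = 1, zero = 0, add = (+)\<rparr>"

definition forms :: "'v set \<Rightarrow> nat \<Rightarrow> ('v, 'k::field) mpoly set" where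
  "forms B n =
     {f \<in> carrier (coord_ring B).
        \<forall>m\<in>Poly_Mapping.keys f. (\<Sum>b\<in>Poly_Mapping.keys m. Poly_Mapping.lookup m b) = n}"

definition form_poly :: "nat \<Rightarrow> 'v set \<Rightarrow> ('v \<Rightarrow> 'k) \<Rightarrow> ('v, 'k::field) mpoly" where
  "form_poly p B \<phi> = (\<Sum>b\<in>B. Poly_Mapping.single (Poly_Mapping.single b p) (\<phi> b))"

text \<open>The hypersurface of \<open>\<phi>\<close> in the projective space of lines of the ambient vector space, in the
  homogeneous coordinates of a basis \<open>B\<close>: the projective spectrum of the coordinate ring modulo
  the ideal generated by \<open>\<phi>\<close>.\<close>

definition hypersurface ::
  "nat \<Rightarrow> 'v set \<Rightarrow> ('v \<Rightarrow> 'k::field) \<Rightarrow>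
    (('v, 'k) mpoly set set, ('v, 'k) mpoly set set \<Rightarrow> (('v, 'k) mpoly set \<times> ('v, 'k) mpoly set) set,
     'k) ringed_space"
where
  "hypersurface p B \<phi> =
     (let R = coord_ring B;
          I = genideal R {form_poly p B \<phi>}
      in Proj (R Quot I) (\<lambda>n. (\<lambda>f. I +>\<^bsub>R\<^esub> f) ` forms B n)
           (\<lambda>c. I +>\<^bsub>R\<^esub> Poly_Mapping.single 0 c))"

end

theory Submission
  imports Defs "HOL-Computational_Algebra.Computational_Algebra"
begin

text \<open>Let \<open>a\<^sub>v\<close> (\<open>v \<in> B\<close>) and \<open>b\<^sub>w\<close> (\<open>w \<in> C\<close>) be the values of the two forms on bases, and \<open>F(X)\<close>, \<open>F(Y)\<close> the
  function fields. Twisting coefficients by Frobenius turns \<open>\<Sum> a\<^sub>v x\<^sub>v\<^sup>p = 0\<close> into the linear equation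
  \<open>\<Sum> a\<^sub>v x\<^sub>v = 0\<close>, where \<open>F\<^sup>p\<close> plays the role of the base field. A rational map from \<open>X\<close> to \<open>Y\<close> is then a
  linear dependence of the \<open>b\<^sub>w\<close> over \<open>F(X)\<close>. Specializing along a suitable arc in \<open>Y\<close> whose residue
  field is \<open>F(X)\<close> shows that elements of \<open>F\<close> independent over \<open>F(X)\<close> remain so over \<open>F(Y)\<close>. With maps in both
  directions there are hence \<open>P \<subseteq> B\<close> and \<open>Q \<subseteq> C\<close> such that the \<open>a\<^sub>v\<close>, \<open>v \<in> P\<close>, and the \<open>b\<^sub>w\<close>, \<open>w \<in> Q\<close>, are bases
  of the spans of all \<open>a\<^sub>v\<close> and all \<open>b\<^sub>w\<close> over \<open>F(X)\<close> as well as over \<open>F(Y)\<close>. Expressing the other \<open>a\<^sub>i\<close> in the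
  basis over \<open>F(Y)\<close> gives, for every choice of the coordinates outside \<open>P\<close>, a point of \<open>X\<close>; taking for
  these the coordinates of \<open>y \<in> Y\<close> outside \<open>Q\<close> defines a rational map from \<open>Y\<close> to \<open>X\<close>. The same
  construction from \<open>X\<close> to \<open>Y\<close> inverts it. A count of transcendence degrees, by derivations,
  gives \<open>|B - P| = |C - Q|\<close>, so that this is a bijective choice of coordinates.\<close>

section \<open>Evaluation of polynomials and forms\<close>

text \<open>The p-th power of a polynomial has coefficients \<open>c ^ p\<close> in the p-th powers
  of the variables. Through Frobenius, the coordinate ring of X is therefore a ring of polynomials
  over F^p evaluated on a hyperplane over F. A hyperplane has an explicit generic point with all but
  one coordinate free, so both function fields lie in one field F(X_0, X_1, ...), and every point of
  the hyperplane is a specialization of the generic one. Anisotropy says that the values on a basis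
  are independent over F^p. The obstacle is that the rational maps need not be dominant: F(Y) is not
  embedded in F(X), and evaluating a relation over F(Y) at an F(X)-point of Y may give 0 = 0.
  Leading coefficients along an arc remedy this, provided that they lie in F(X) up to a common
  factor. Quasilinear hypersurfaces are nowhere smooth, so smoothness supplies no arcs; instead the
  inseparable generator \<theta> of F(X) is moved to \<theta> + t, and the coordinate solved for in
  the linear equation supplies an element of order one in t whose p-th power stays under
  control.\<close>

definition rhom :: "('a::comm_ring_1 \<Rightarrow> 'b::comm_ring_1) \<Rightarrow> bool" where
  "rhom h \<longleftrightarrow> h 1 = 1 \<and> (\<forall>x y. h (x + y) = h x + h y) \<and> (\<forall>x y. h (x * y) = h x * h y)"

lemma rhom_1: "rhom h \<Longrightarrow> h 1 = 1"
  and rhom_add: "rhom h \<Longrightarrow> h (x + y) = h x + h y"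
  and rhom_mult: "rhom h \<Longrightarrow> h (x * y) = h x * h y"
  by (auto simp: rhom_def)

lemma rhom_0: "rhom h \<Longrightarrow> h 0 = 0"
  using rhom_add[of h 0 0] by simp

lemma rhom_uminus: "rhom h \<Longrightarrow> h (- x) = - h x"
  using rhom_add[of h x "- x"] rhom_0[of h] by (simp add: eq_neg_iff_add_eq_0 add.commute)

lemma rhom_diff: "rhom h \<Longrightarrow> h (x - y) = h x - h y"
  using rhom_add[of h x "- y"] rhom_uminus[of h y] by simp

lemma rhom_sum: "rhom h \<Longrightarrow> h (sum f A) = (\<Sum>i\<in>A. h (f i))"
  by (induction A rule: infinite_finite_induct) (auto simp: rhom_0 rhom_add)

lemma rhom_prod: "rhom h \<Longrightarrow> h (prod f A) = (\<Prod>i\<in>A. h (f i))"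
  by (induction A rule: infinite_finite_induct) (auto simp: rhom_1 rhom_mult)

lemma rhom_power: "rhom h \<Longrightarrow> h (x ^ n) = h x ^ n"
  by (induction n) (auto simp: rhom_1 rhom_mult)

lemma rhom_of_nat: "rhom h \<Longrightarrow> h (of_nat n) = of_nat n"
  by (induction n) (auto simp: rhom_0 rhom_1 rhom_add)

lemma rhom_comp: "rhom h \<Longrightarrow> rhom k \<Longrightarrow> rhom (\<lambda>x. k (h x))"
  by (auto simp: rhom_def)

lemmas rhom_simps = rhom_0 rhom_1 rhom_add rhom_mult rhom_uminus rhom_diff rhom_sum rhom_prod
  rhom_power

lemma rhom_eq_0_iff:
  fixes h :: "'a::field \<Rightarrow> 'b::comm_ring_1"
  assumes "rhom h" shows "h x = 0 \<longleftrightarrow> x = 0"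
proof
  assume "h x = 0"
  then have "h (x * inverse x) = 0" using assms by (simp add: rhom_simps)
  then show "x = 0" using assms by (cases "x = 0") (auto simp: rhom_simps)
qed (use assms in \<open>simp add: rhom_simps\<close>)

lemma CHAR_eq_prime:
  assumes "prime p" "of_nat p = (0::'r::comm_ring_1)"
  shows "CHAR('r) = p"
proof -
  have "CHAR('r) dvd p" using assms(2) by (simp add: of_nat_eq_0_iff_char_dvd)
  moreover have "CHAR('r) \<noteq> 1" using CHAR_not_1 by simp
  ultimately show ?thesis using assms(1) by (metis prime_nat_iff)
qed

lemma frobenius_add:
  fixes x y :: "'r::comm_ring_1"
  assumes "prime p" "of_nat p = (0::'r)"
  shows "(x + y) ^ p = x ^ p + y ^ p"
  using assms(1) CHAR_eq_prime[OF assms] by (intro freshmans_dream) simp_all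

lemma rhom_frobenius:
  assumes "prime p" "of_nat p = (0::'r::comm_ring_1)"
  shows "rhom (\<lambda>x::'r. x ^ p)"
  unfolding rhom_def using frobenius_add[OF assms] by (simp add: power_mult_distrib)

definition mon :: "('v \<Rightarrow> 'r::comm_ring_1) \<Rightarrow> ('v \<Rightarrow>\<^sub>0 nat) \<Rightarrow> 'r" where
  "mon x m = (\<Prod>v\<in>Poly_Mapping.keys m. x v ^ Poly_Mapping.lookup m v)"

text \<open>The coefficient map \<open>h\<close> is a parameter, so that one notion covers values at
  points with or without Frobenius twist, specializations to arbitrary rings, and substitution of
  polynomials into polynomials.\<close>

definition ev ::
  "('k::comm_ring_1 \<Rightarrow> 'r::comm_ring_1) \<Rightarrow> ('v \<Rightarrow> 'r) \<Rightarrow> (('v \<Rightarrow>\<^sub>0 nat) \<Rightarrow>\<^sub>0 'k) \<Rightarrow> 'r" where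
  "ev h x f = (\<Sum>m\<in>Poly_Mapping.keys f. h (Poly_Mapping.lookup f m) * mon x m)"

lemma mon_superset:
  assumes "finite A" "Poly_Mapping.keys m \<subseteq> A"
  shows "mon x m = (\<Prod>v\<in>A. x v ^ Poly_Mapping.lookup m v)"
  unfolding mon_def
  by (rule prod.mono_neutral_left) (use assms in \<open>auto simp: in_keys_iff\<close>)

lemma mon_0: "mon x 0 = 1"
  by (simp add: mon_def)

lemma mon_single: "mon x (Poly_Mapping.single v n) = x v ^ n"
  by (cases "n = 0") (auto simp: mon_def)

lemma mon_add: "mon x (m + n) = mon x m * mon x n"
proof -
  let ?A = "Poly_Mapping.keys m \<union> Poly_Mapping.keys n"
  have "Poly_Mapping.keys (m + n) \<subseteq> ?A" by (rule keys_add)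
  then show ?thesis
    by (simp add: mon_superset[of ?A] lookup_add power_add prod.distrib)
qed

lemma mon_cong:
  assumes "\<And>v. v \<in> Poly_Mapping.keys m \<Longrightarrow> x v = y v" shows "mon x m = mon y m"
  unfolding mon_def by (rule prod.cong) (use assms in auto)

lemma mon_rhom: "rhom s \<Longrightarrow> s (mon x m) = mon (\<lambda>v. s (x v)) m"
  by (simp add: mon_def rhom_simps)

lemma mon_scale:
  "mon (\<lambda>v. c * x v) m = c ^ (\<Sum>v\<in>Poly_Mapping.keys m. Poly_Mapping.lookup m v) * mon x m"
  by (simp add: mon_def power_mult_distrib prod.distrib power_sum)

lemma ev_superset:
  assumes "rhom h" "finite A" "Poly_Mapping.keys f \<subseteq> A"
  shows "ev h x f = (\<Sum>m\<in>A. h (Poly_Mapping.lookup f m) * mon x m)"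
  unfolding ev_def
  by (rule sum.mono_neutral_left) (use assms in \<open>auto simp: in_keys_iff rhom_simps\<close>)

lemma ev_0: "ev h x 0 = 0"
  by (simp add: ev_def)

lemma ev_add:
  assumes "rhom h" shows "ev h x (f + g) = ev h x f + ev h x g"
proof -
  let ?A = "Poly_Mapping.keys f \<union> Poly_Mapping.keys g"
  have "Poly_Mapping.keys (f + g) \<subseteq> ?A" by (rule keys_add)
  then show ?thesis
    by (simp add: ev_superset[of h ?A] assms lookup_add rhom_simps distrib_right sum.distrib)
qed

lemma ev_sum: "rhom h \<Longrightarrow> ev h x (sum f A) = (\<Sum>i\<in>A. ev h x (f i))"
  by (induction A rule: infinite_finite_induct) (auto simp: ev_0 ev_add)

lemma ev_single: "rhom h \<Longrightarrow> ev h x (Poly_Mapping.single m c) = h c * mon x m"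
  by (cases "c = 0") (auto simp: ev_def rhom_simps)

lemma mpoly_expand:
  fixes f :: "'a \<Rightarrow>\<^sub>0 'b::comm_monoid_add"
  shows "f = (\<Sum>m\<in>Poly_Mapping.keys f. Poly_Mapping.single m (Poly_Mapping.lookup f m))"
proof (rule poly_mapping_eqI)
  fix m
  have "(\<Sum>n\<in>Poly_Mapping.keys f. Poly_Mapping.lookup (Poly_Mapping.single n (Poly_Mapping.lookup f n)) m)
     = (\<Sum>n\<in>Poly_Mapping.keys f. if n = m then Poly_Mapping.lookup f m else 0)"
    by (rule sum.cong) (auto simp: lookup_single when_def)
  then show "Poly_Mapping.lookup f m = Poly_Mapping.lookup
     (\<Sum>m\<in>Poly_Mapping.keys f. Poly_Mapping.single m (Poly_Mapping.lookup f m)) m"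
    by (auto simp: lookup_sum in_keys_iff)
qed

lemma ev_mult:
  assumes "rhom h" shows "ev h x (f * g) = ev h x f * ev h x g"
proof -
  let ?s = "\<lambda>f m. Poly_Mapping.single m (Poly_Mapping.lookup f m)"
  have "f * g = (\<Sum>m\<in>Poly_Mapping.keys f. ?s f m) * (\<Sum>n\<in>Poly_Mapping.keys g. ?s g n)"
    using mpoly_expand[of f] mpoly_expand[of g] by simp
  also have "\<dots> = (\<Sum>m\<in>Poly_Mapping.keys f. \<Sum>n\<in>Poly_Mapping.keys g.
      Poly_Mapping.single (m + n) (Poly_Mapping.lookup f m * Poly_Mapping.lookup g n))"
    by (simp add: sum_product mult_single)
  finally have "ev h x (f * g) = (\<Sum>m\<in>Poly_Mapping.keys f. \<Sum>n\<in>Poly_Mapping.keys g.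
      h (Poly_Mapping.lookup f m * Poly_Mapping.lookup g n) * mon x (m + n))"
    by (simp add: ev_sum[OF assms] ev_single[OF assms])
  also have "\<dots> = (\<Sum>m\<in>Poly_Mapping.keys f. \<Sum>n\<in>Poly_Mapping.keys g.
      (h (Poly_Mapping.lookup f m) * mon x m) * (h (Poly_Mapping.lookup g n) * mon x n))"
    by (intro sum.cong refl) (simp add: rhom_simps assms mon_add mult_ac)
  also have "\<dots> = ev h x f * ev h x g"
    by (simp add: ev_def sum_product)
  finally show ?thesis .
qed

lemma ev_const: "rhom h \<Longrightarrow> ev h x (Poly_Mapping.single 0 c) = h c"
  by (simp add: ev_single mon_0)

lemma ev_var: "rhom h \<Longrightarrow> ev h x (Poly_Mapping.single (Poly_Mapping.single v (Suc 0)) 1) = x v"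
  by (simp add: ev_single mon_single rhom_simps)

lemma rhom_ev: "rhom h \<Longrightarrow> rhom (ev h x)"
  using ev_const[of h x 1] by (auto simp: rhom_def ev_add ev_mult)

lemma rhom_const: "rhom (Poly_Mapping.single (0::'m::comm_monoid_add) :: 'k::comm_ring_1 \<Rightarrow> _)"
  by (auto simp: rhom_def single_add mult_single)

lemma rhom_after_ev:
  assumes "rhom s" shows "s (ev h x f) = ev (\<lambda>c. s (h c)) (\<lambda>v. s (x v)) f"
  by (simp add: ev_def rhom_simps mon_rhom assms)

lemma ev_cong:
  assumes "\<And>m v. m \<in> Poly_Mapping.keys f \<Longrightarrow> v \<in> Poly_Mapping.keys m \<Longrightarrow> x v = y v"
  shows "ev h x f = ev h y f"
  unfolding ev_def by (intro sum.cong refl arg_cong2[of _ _ _ _ "(*)"] mon_cong) (use assms in auto)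

lemma rhom_poly: "rhom (\<lambda>f. poly f (x::'a::comm_ring_1))"
  by (simp add: rhom_def)

lemma rhom_pCons: "rhom (\<lambda>c::'a::comm_ring_1. [:c:])"
  by (simp add: rhom_def one_pCons)

text \<open>The evaluation is carried out over the polynomial ring in the line parameter. This is
  the form in which density arguments use \<open>vanish_on_lines\<close>.\<close>

lemma ev_line:
  assumes "rhom h"
  shows "\<exists>q. \<forall>s. ev h (\<lambda>v. x v + s * y v) f = poly q s"
proof (intro exI allI)
  fix s
  show "ev h (\<lambda>v. x v + s * y v) f = poly (ev (\<lambda>c. [:h c:]) (\<lambda>v. [:x v, y v:]) f) s"
    by (simp add: rhom_after_ev[OF rhom_poly])
qed

lemma CR_iff: "f \<in> carrier (coord_ring B) \<longleftrightarrow> (\<forall>m\<in>Poly_Mapping.keys f. Poly_Mapping.keys m \<subseteq> B)"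
  by (simp add: coord_ring_def)

lemma coord_ring_simps:
  "f \<otimes>\<^bsub>coord_ring B\<^esub> g = f * g" "f \<oplus>\<^bsub>coord_ring B\<^esub> g = f + g"
  "\<one>\<^bsub>coord_ring B\<^esub> = 1" "\<zero>\<^bsub>coord_ring B\<^esub> = 0"
  by (simp_all add: coord_ring_def)

lemma CR_add: "f \<in> carrier (coord_ring B) \<Longrightarrow> g \<in> carrier (coord_ring B) \<Longrightarrow> f + g \<in> carrier (coord_ring B)"
  using keys_add[of f g] by (auto simp: CR_iff)

lemma CR_uminus: "f \<in> carrier (coord_ring B) \<Longrightarrow> - f \<in> carrier (coord_ring B)"
  by (auto simp: CR_iff in_keys_iff)

lemma CR_diff: "f \<in> carrier (coord_ring B) \<Longrightarrow> g \<in> carrier (coord_ring B) \<Longrightarrow> f - g \<in> carrier (coord_ring B)"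
  using CR_add[of f B "- g"] CR_uminus[of g B] by simp

lemma CR_mult:
  assumes "f \<in> carrier (coord_ring B)" "g \<in> carrier (coord_ring B)"
  shows "f * g \<in> carrier (coord_ring B)"
  unfolding CR_iff
proof
  fix m assume "m \<in> Poly_Mapping.keys (f * g)"
  then obtain m1 m2 where "m = m1 + m2" "m1 \<in> Poly_Mapping.keys f" "m2 \<in> Poly_Mapping.keys g"
    using keys_mult[of f g] by blast
  moreover have "Poly_Mapping.keys (m1 + m2) \<subseteq> Poly_Mapping.keys m1 \<union> Poly_Mapping.keys m2"
    by (rule keys_add)
  ultimately show "Poly_Mapping.keys m \<subseteq> B" using assms by (auto simp: CR_iff)
qed

lemma CR_0: "0 \<in> carrier (coord_ring B)"
  by (simp add: CR_iff)

lemma CR_1: "1 \<in> carrier (coord_ring B)"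
  by (simp add: CR_iff)

lemma CR_single: "Poly_Mapping.keys m \<subseteq> B \<Longrightarrow> Poly_Mapping.single m c \<in> carrier (coord_ring B)"
  by (auto simp: CR_iff)

lemma CR_sum: "(\<And>i. i \<in> A \<Longrightarrow> f i \<in> carrier (coord_ring B)) \<Longrightarrow> sum f A \<in> carrier (coord_ring B)"
  by (induction A rule: infinite_finite_induct) (auto simp: CR_0 CR_add)

lemma CR_power: "f \<in> carrier (coord_ring B) \<Longrightarrow> f ^ n \<in> carrier (coord_ring B)"
  by (induction n) (auto simp: CR_1 CR_mult)

lemma cring_coord_ring: "cring (coord_ring B)"
proof (rule cringI)
  show "abelian_group (coord_ring B)"
    by (rule abelian_groupI)
       (auto simp: coord_ring_simps CR_add CR_0 add_ac intro!: bexI[of _ "- x" for x] CR_uminus)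
  show "comm_monoid (coord_ring B)"
    by (rule comm_monoidI) (auto simp: coord_ring_simps CR_mult CR_1 mult_ac)
qed (simp add: coord_ring_simps distrib_right)

section \<open>The grading by total degree\<close>

definition mdeg :: "('v \<Rightarrow>\<^sub>0 nat) \<Rightarrow> nat" where
  "mdeg m = (\<Sum>v\<in>Poly_Mapping.keys m. Poly_Mapping.lookup m v)"

lemma mdeg_add: "mdeg (m + n) = mdeg m + mdeg n"
  unfolding mdeg_def
proof -
  let ?A = "Poly_Mapping.keys m \<union> Poly_Mapping.keys n"
  have *: "(\<Sum>v\<in>Poly_Mapping.keys k. Poly_Mapping.lookup k v) = (\<Sum>v\<in>?A. Poly_Mapping.lookup k v)"
    if "Poly_Mapping.keys k \<subseteq> ?A" for k
    by (rule sum.mono_neutral_left) (use that in \<open>auto simp: in_keys_iff\<close>)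
  show "(\<Sum>v\<in>Poly_Mapping.keys (m + n). Poly_Mapping.lookup (m + n) v)
    = (\<Sum>v\<in>Poly_Mapping.keys m. Poly_Mapping.lookup m v) + (\<Sum>v\<in>Poly_Mapping.keys n. Poly_Mapping.lookup n v)"
    using *[of "m + n"] *[of m] *[of n] keys_add[of m n] by (simp add: lookup_add sum.distrib)
qed

lemma mdeg_0: "mdeg 0 = 0"
  by (simp add: mdeg_def)

lemma mdeg_single: "mdeg (Poly_Mapping.single v n) = n"
  by (cases "n = 0") (auto simp: mdeg_def)

lemma forms_iff:
  "f \<in> forms B n \<longleftrightarrow> f \<in> carrier (coord_ring B) \<and> (\<forall>m\<in>Poly_Mapping.keys f. mdeg m = n)"
  by (auto simp: forms_def mdeg_def)

lemma forms_CR: "f \<in> forms B n \<Longrightarrow> f \<in> carrier (coord_ring B)"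
  by (simp add: forms_iff)

lemma forms_0: "0 \<in> forms B n"
  by (simp add: forms_iff CR_0)

lemma forms_1: "1 \<in> forms B 0"
  by (simp add: forms_iff CR_1 mdeg_0)

lemma forms_add: "f \<in> forms B n \<Longrightarrow> g \<in> forms B n \<Longrightarrow> f + g \<in> forms B n"
  using keys_add[of f g] by (auto simp: forms_iff CR_add)

lemma forms_uminus: "f \<in> forms B n \<Longrightarrow> - f \<in> forms B n"
  by (auto simp: forms_iff CR_uminus in_keys_iff)

lemma forms_diff: "f \<in> forms B n \<Longrightarrow> g \<in> forms B n \<Longrightarrow> f - g \<in> forms B n"
  using forms_add[of f B n "- g"] forms_uminus[of g B n] by simp

lemma forms_sum: "(\<And>i. i \<in> A \<Longrightarrow> f i \<in> forms B n) \<Longrightarrow> sum f A \<in> forms B n"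
  by (induction A rule: infinite_finite_induct) (auto simp: forms_0 forms_add)

lemma forms_mult:
  assumes "f \<in> forms B n" "g \<in> forms B k" shows "f * g \<in> forms B (n + k)"
proof -
  have "mdeg m = n + k" if "m \<in> Poly_Mapping.keys (f * g)" for m
  proof -
    obtain m1 m2 where "m = m1 + m2" "m1 \<in> Poly_Mapping.keys f" "m2 \<in> Poly_Mapping.keys g"
      using \<open>m \<in> Poly_Mapping.keys (f * g)\<close> keys_mult[of f g] by blast
    then show ?thesis using assms by (simp add: forms_iff mdeg_add)
  qed
  then show ?thesis using assms by (simp add: forms_iff CR_mult)
qed

lemma forms_prod:
  "finite A \<Longrightarrow> (\<And>i. i \<in> A \<Longrightarrow> f i \<in> forms B (n i)) \<Longrightarrow> prod f A \<in> forms B (sum n A)"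
  by (induction A rule: finite_induct) (auto simp: forms_1 forms_mult)

lemma forms_power: "f \<in> forms B n \<Longrightarrow> f ^ k \<in> forms B (k * n)"
  by (induction k) (auto simp: forms_1 forms_mult)

lemma forms_const: "Poly_Mapping.single 0 c \<in> forms B 0"
  by (auto simp: forms_iff CR_single mdeg_0)

lemma forms_var: "v \<in> B \<Longrightarrow> Poly_Mapping.single (Poly_Mapping.single v (Suc 0)) 1 \<in> forms B 1"
  by (auto simp: forms_iff CR_single mdeg_single)

lemma forms_form_poly: "form_poly p B \<phi> \<in> forms B p"
  unfolding form_poly_def by (rule forms_sum) (auto simp: forms_iff CR_iff mdeg_single)

definition hcomp :: "nat \<Rightarrow> ('v, 'k::field) mpoly \<Rightarrow> ('v, 'k) mpoly" where
  "hcomp n f = (\<Sum>m\<in>{m\<in>Poly_Mapping.keys f. mdeg m = n}. Poly_Mapping.single m (Poly_Mapping.lookup f m))"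

lemma lookup_hcomp:
  "Poly_Mapping.lookup (hcomp n f) m = (if mdeg m = n then Poly_Mapping.lookup f m else 0)"
proof -
  have "Poly_Mapping.lookup (hcomp n f) m
    = (\<Sum>k\<in>{k\<in>Poly_Mapping.keys f. mdeg k = n}. if k = m then Poly_Mapping.lookup f m else 0)"
    unfolding hcomp_def lookup_sum by (rule sum.cong) (auto simp: lookup_single when_def)
  then show ?thesis by (auto simp: in_keys_iff)
qed

lemma hcomp_add: "hcomp n (f + g) = hcomp n f + hcomp n g"
  by (rule poly_mapping_eqI) (simp add: lookup_hcomp lookup_add)

lemma hcomp_diff: "hcomp n (f - g) = hcomp n f - hcomp n g"
  by (rule poly_mapping_eqI) (simp add: lookup_hcomp lookup_minus)

lemma hcomp_0: "hcomp n 0 = 0"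
  by (rule poly_mapping_eqI) (simp add: lookup_hcomp)

lemma hcomp_sum: "hcomp n (sum f A) = (\<Sum>i\<in>A. hcomp n (f i))"
  by (induction A rule: infinite_finite_induct) (auto simp: hcomp_0 hcomp_add)

lemma hcomp_forms: "f \<in> carrier (coord_ring B) \<Longrightarrow> hcomp n f \<in> forms B n"
  unfolding forms_iff CR_iff by (auto simp: in_keys_iff lookup_hcomp split: if_splits)

lemma hcomp_of_form: "f \<in> forms B k \<Longrightarrow> hcomp n f = (if n = k then f else 0)"
  by (rule poly_mapping_eqI) (auto simp: lookup_hcomp forms_iff in_keys_iff)

definition hdegs :: "('v, 'k::field) mpoly \<Rightarrow> nat set" where
  "hdegs f = mdeg ` Poly_Mapping.keys f"

lemma finite_hdegs: "finite (hdegs f)"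
  by (simp add: hdegs_def)

lemma hcomp_expand: "f = (\<Sum>n\<in>hdegs f. hcomp n f)"
proof (rule poly_mapping_eqI)
  fix m
  have "(\<Sum>n\<in>hdegs f. Poly_Mapping.lookup (hcomp n f) m)
    = (if mdeg m \<in> hdegs f then Poly_Mapping.lookup f m else 0)"
    by (simp add: lookup_hcomp finite_hdegs)
  also have "\<dots> = Poly_Mapping.lookup f m"
    by (auto simp: hdegs_def in_keys_iff)
  finally show "Poly_Mapping.lookup f m = Poly_Mapping.lookup (\<Sum>n\<in>hdegs f. hcomp n f) m"
    by (simp add: lookup_sum)
qed

lemma hcomp_mult:
  assumes "g \<in> carrier (coord_ring B)" "f \<in> carrier (coord_ring B)"
  shows "hcomp n (g * f) = (\<Sum>i\<in>hdegs g. \<Sum>j\<in>hdegs f. if n = i + j then hcomp i g * hcomp j f else 0)"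
proof -
  have "g * f = (\<Sum>i\<in>hdegs g. \<Sum>j\<in>hdegs f. hcomp i g * hcomp j f)"
    using hcomp_expand[of g] hcomp_expand[of f] by (metis sum_product)
  also have "hcomp n \<dots> = (\<Sum>i\<in>hdegs g. \<Sum>j\<in>hdegs f. if n = i + j then hcomp i g * hcomp j f else 0)"
    unfolding hcomp_sum
    by (intro sum.cong refl hcomp_of_form[OF forms_mult[OF hcomp_forms[OF assms(1)] hcomp_forms[OF assms(2)]]])
  finally show ?thesis .
qed

lemma ev_forms_scale:
  assumes "f \<in> forms B n"
  shows "ev h (\<lambda>v. c * x v) f = c ^ n * ev h x f"
proof -
  have "ev h (\<lambda>v. c * x v) f = (\<Sum>m\<in>Poly_Mapping.keys f. c ^ n * (h (Poly_Mapping.lookup f m) * mon x m))"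
    unfolding ev_def mon_scale
    by (rule sum.cong) (use assms in \<open>auto simp: forms_iff mdeg_def mult_ac\<close>)
  then show ?thesis by (simp add: ev_def sum_distrib_left)
qed

lemma ev_CR_cong:
  assumes "f \<in> carrier (coord_ring B)" "\<And>v. v \<in> B \<Longrightarrow> x v = y v"
  shows "ev h x f = ev h y f"
  by (rule ev_cong) (use assms in \<open>auto simp: CR_iff\<close>)

lemmas ev_form_cong = ev_CR_cong[OF forms_CR]

text \<open>Pull-back of polynomials along the map with coordinates \<open>G\<close>.\<close>

definition psubst :: "('w \<Rightarrow> ('v, 'k::field) mpoly) \<Rightarrow> ('w, 'k) mpoly \<Rightarrow> ('v, 'k) mpoly" where
  "psubst G = ev (Poly_Mapping.single 0) G"

lemma rhom_psubst: "rhom (psubst G)"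
  unfolding psubst_def by (rule rhom_ev[OF rhom_const])

lemma ev_psubst: "rhom h \<Longrightarrow> ev h x (psubst G f) = ev h (\<lambda>w. ev h x (G w)) f"
  by (simp add: psubst_def rhom_after_ev[OF rhom_ev] ev_const)

lemma mon_forms:
  assumes "\<And>w. w \<in> C \<Longrightarrow> G w \<in> forms B d" "Poly_Mapping.keys m \<subseteq> C"
  shows "mon G m \<in> forms B (mdeg m * d)"
proof -
  have "mon G m \<in> forms B (\<Sum>v\<in>Poly_Mapping.keys m. Poly_Mapping.lookup m v * d)"
    unfolding mon_def by (rule forms_prod) (use assms in \<open>auto intro: forms_power\<close>)
  then show ?thesis by (simp add: mdeg_def sum_distrib_right)
qed

lemma psubst_forms:
  assumes "\<And>w. w \<in> C \<Longrightarrow> G w \<in> forms B d" "f \<in> forms C n"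
  shows "psubst G f \<in> forms B (n * d)"
  unfolding psubst_def ev_def
proof (rule forms_sum)
  fix m assume "m \<in> Poly_Mapping.keys f"
  then have "Poly_Mapping.keys m \<subseteq> C" "mdeg m = n" using assms(2) by (auto simp: forms_iff CR_iff)
  then show "Poly_Mapping.single 0 (Poly_Mapping.lookup f m) * mon G m \<in> forms B (n * d)"
    using forms_mult[OF forms_const mon_forms[OF assms(1)]] by force
qed

lemma psubst_CR:
  assumes "\<And>w. w \<in> C \<Longrightarrow> G w \<in> forms B d" "f \<in> carrier (coord_ring C)"
  shows "psubst G f \<in> carrier (coord_ring B)"
proof -
  have "psubst G f = (\<Sum>n\<in>hdegs f. psubst G (hcomp n f))"
    using hcomp_expand[of f] rhom_sum[OF rhom_psubst] by metis
  also have "\<dots> \<in> carrier (coord_ring B)"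
    by (intro CR_sum forms_CR[OF psubst_forms[OF assms(1) hcomp_forms[OF assms(2)]]])
  finally show ?thesis .
qed

text \<open>Substitution multiplies degrees by \<open>d\<close>. Since \<open>d > 0\<close>,
  distinct degrees stay distinct and no other component lands in degree
  \<open>n * d\<close>.\<close>

lemma hcomp_psubst:
  assumes "\<And>w. w \<in> C \<Longrightarrow> G w \<in> forms B d" "d > 0" "f \<in> carrier (coord_ring C)"
  shows "hcomp (n * d) (psubst G f) = psubst G (hcomp n f)"
proof -
  have "psubst G f = (\<Sum>i\<in>hdegs f. psubst G (hcomp i f))"
    using hcomp_expand[of f] rhom_sum[OF rhom_psubst] by metis
  also have "hcomp (n * d) \<dots> = (\<Sum>i\<in>hdegs f. if i = n then psubst G (hcomp n f) else 0)"
    unfolding hcomp_sum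
  proof (intro sum.cong refl)
    fix i
    have "psubst G (hcomp i f) \<in> forms B (i * d)"
      by (rule psubst_forms[OF assms(1) hcomp_forms[OF assms(3)]])
    then show "hcomp (n * d) (psubst G (hcomp i f)) = (if i = n then psubst G (hcomp n f) else 0)"
      using assms(2) by (auto simp: hcomp_of_form)
  qed
  also have "\<dots> = psubst G (hcomp n f)"
  proof (cases "n \<in> hdegs f")
    case False
    then have "hcomp n f = 0"
      by (intro poly_mapping_eqI) (auto simp: lookup_hcomp hdegs_def in_keys_iff)
    then show ?thesis using False by (simp add: finite_hdegs rhom_0[OF rhom_psubst])
  qed (simp add: finite_hdegs)
  finally show ?thesis .
qed

section \<open>Subfields\<close>

definition subfld :: "'o::field set \<Rightarrow> bool" where
  "subfld T \<longleftrightarrow> 0 \<in> T \<and> 1 \<in> T \<and> (\<forall>x\<in>T. \<forall>y\<in>T. x + y \<in> T \<and> x * y \<in> T) \<and>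
     (\<forall>x\<in>T. - x \<in> T \<and> inverse x \<in> T)"

lemma subfld_0: "subfld T \<Longrightarrow> 0 \<in> T"
  and subfld_1: "subfld T \<Longrightarrow> 1 \<in> T"
  and subfld_add: "subfld T \<Longrightarrow> x \<in> T \<Longrightarrow> y \<in> T \<Longrightarrow> x + y \<in> T"
  and subfld_mult: "subfld T \<Longrightarrow> x \<in> T \<Longrightarrow> y \<in> T \<Longrightarrow> x * y \<in> T"
  and subfld_uminus: "subfld T \<Longrightarrow> x \<in> T \<Longrightarrow> - x \<in> T"
  and subfld_inverse: "subfld T \<Longrightarrow> x \<in> T \<Longrightarrow> inverse x \<in> T"
  by (auto simp: subfld_def)

lemma subfld_diff: "subfld T \<Longrightarrow> x \<in> T \<Longrightarrow> y \<in> T \<Longrightarrow> x - y \<in> T"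
  using subfld_add[of T x "- y"] subfld_uminus[of T y] by simp

lemma subfld_divide: "subfld T \<Longrightarrow> x \<in> T \<Longrightarrow> y \<in> T \<Longrightarrow> x / y \<in> T"
  by (simp add: divide_inverse subfld_mult subfld_inverse)

lemma subfld_sum: "subfld T \<Longrightarrow> (\<And>i. i \<in> A \<Longrightarrow> f i \<in> T) \<Longrightarrow> sum f A \<in> T"
  by (induction A rule: infinite_finite_induct) (auto simp: subfld_0 subfld_add)

lemma subfld_prod: "subfld T \<Longrightarrow> (\<And>i. i \<in> A \<Longrightarrow> f i \<in> T) \<Longrightarrow> prod f A \<in> T"
  by (induction A rule: infinite_finite_induct) (auto simp: subfld_1 subfld_mult)

lemma subfld_power: "subfld T \<Longrightarrow> x \<in> T \<Longrightarrow> x ^ n \<in> T"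
  by (induction n) (auto simp: subfld_1 subfld_mult)

lemma subfld_of_nat: "subfld T \<Longrightarrow> of_nat n \<in> T"
  by (induction n) (auto simp: subfld_0 subfld_1 subfld_add)

lemma subfld_Int: "subfld S \<Longrightarrow> subfld T \<Longrightarrow> subfld (S \<inter> T)"
  by (auto simp: subfld_def)

lemmas subfld_closed = subfld_0 subfld_1 subfld_add subfld_mult subfld_uminus subfld_inverse
  subfld_diff subfld_divide subfld_sum subfld_prod subfld_power subfld_of_nat

lemma subfld_ev:
  assumes "subfld T" "\<And>c. h c \<in> T" "f \<in> carrier (coord_ring B)" "\<And>v. v \<in> B \<Longrightarrow> x v \<in> T"
  shows "ev h x f \<in> T"
  unfolding ev_def mon_def
  by (intro subfld_sum subfld_mult subfld_prod subfld_power assms) (use assms(3) in \<open>auto simp: CR_iff\<close>)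

text \<open>Degree-zero fractions of a graded subring of a field. A constant family \<open>D\<close>
  gives the ordinary fraction field, a genuinely graded one gives the function field of a projective
  variety.\<close>

definition frac :: "(nat \<Rightarrow> 'o::field set) \<Rightarrow> 'o set" where
  "frac D = {a / b | a b n. a \<in> D n \<and> b \<in> D n \<and> b \<noteq> 0}"

locale graded_set =
  fixes D :: "nat \<Rightarrow> 'o::field set"
  assumes D_add: "a \<in> D n \<Longrightarrow> b \<in> D n \<Longrightarrow> a + b \<in> D n"
    and D_uminus: "a \<in> D n \<Longrightarrow> - a \<in> D n"
    and D_0: "0 \<in> D n"
    and D_1: "1 \<in> D 0"
    and D_mult: "a \<in> D n \<Longrightarrow> b \<in> D m \<Longrightarrow> a * b \<in> D (n + m)"
begin

lemma fracI: "a \<in> D n \<Longrightarrow> b \<in> D n \<Longrightarrow> b \<noteq> 0 \<Longrightarrow> a / b \<in> frac D"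
  by (auto simp: frac_def)

lemma fracE:
  assumes "x \<in> frac D" obtains a b n where "a \<in> D n" "b \<in> D n" "b \<noteq> 0" "x = a / b"
  using assms by (auto simp: frac_def)

lemma subfld_frac: "subfld (frac D)"
  unfolding subfld_def
proof (intro conjI ballI)
  show "0 \<in> frac D" using fracI[OF D_0 D_1] by simp
  show "1 \<in> frac D" using fracI[OF D_1 D_1] by simp
  fix x assume "x \<in> frac D"
  then obtain a b n where x: "a \<in> D n" "b \<in> D n" "b \<noteq> 0" "x = a / b" by (rule fracE)
  show "- x \<in> frac D" using fracI[OF D_uminus[OF x(1)] x(2,3)] x by simp
  show "inverse x \<in> frac D"
    using fracI[OF x(2,1)] \<open>0 \<in> frac D\<close> x by (cases "a = 0") auto
  fix y assume "y \<in> frac D"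
  then obtain c d m where y: "c \<in> D m" "d \<in> D m" "d \<noteq> 0" "y = c / d" by (rule fracE)
  show "x * y \<in> frac D" using fracI[OF D_mult[OF x(1) y(1)] D_mult[OF x(2) y(2)]] x y by simp
  have "x + y = (a * d + b * c) / (b * d)" using x y by (simp add: field_simps)
  then show "x + y \<in> frac D"
    using fracI[OF D_add[OF D_mult[OF x(1) y(2)] D_mult[OF x(2) y(1)]] D_mult[OF x(2) y(2)]] x y
    by simp
qed

lemma common_denominator:
  assumes "finite S" "\<And>i. i \<in> S \<Longrightarrow> e i \<in> frac D"
  shows "\<exists>n d u. d \<in> D n \<and> d \<noteq> 0 \<and> (\<forall>i\<in>S. u i \<in> D n \<and> e i = u i / d)"
  using assms
proof (induction S rule: finite_induct)
  case empty
  then show ?case using D_1 by force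
next
  case (insert j S)
  then obtain n d u where u: "d \<in> D n" "d \<noteq> 0" "\<forall>i\<in>S. u i \<in> D n \<and> e i = u i / d" by auto
  obtain a b m where e: "a \<in> D m" "b \<in> D m" "b \<noteq> 0" "e j = a / b"
    using insert.prems[of j] by (auto elim: fracE)
  let ?u = "\<lambda>i. if i = j then d * a else u i * b"
  have "d * b \<in> D (n + m)" "d * b \<noteq> 0" using u e D_mult by auto
  moreover have "\<forall>i\<in>insert j S. ?u i \<in> D (n + m) \<and> e i = ?u i / (d * b)"
    using u e insert.hyps D_mult by auto
  ultimately show ?case by (intro exI[of _ "n + m"] exI[of _ "d * b"] exI[of _ ?u] conjI)
qed

end

section \<open>Polynomials over a subfield and purely inseparable elements of degree p\<close>

definition pol :: "'o::field set \<Rightarrow> 'o poly set" where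
  "pol T = {f. \<forall>i. coeff f i \<in> T}"

lemma pol_0: "subfld T \<Longrightarrow> 0 \<in> pol T"
  and pol_add: "subfld T \<Longrightarrow> f \<in> pol T \<Longrightarrow> g \<in> pol T \<Longrightarrow> f + g \<in> pol T"
  and pol_diff: "subfld T \<Longrightarrow> f \<in> pol T \<Longrightarrow> g \<in> pol T \<Longrightarrow> f - g \<in> pol T"
  and pol_smult: "subfld T \<Longrightarrow> c \<in> T \<Longrightarrow> f \<in> pol T \<Longrightarrow> smult c f \<in> pol T"
  and pol_pCons: "subfld T \<Longrightarrow> c \<in> T \<Longrightarrow> f \<in> pol T \<Longrightarrow> pCons c f \<in> pol T"
  and pol_pderiv: "subfld T \<Longrightarrow> f \<in> pol T \<Longrightarrow> pderiv f \<in> pol T"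
  and pol_monom: "subfld T \<Longrightarrow> c \<in> T \<Longrightarrow> monom c n \<in> pol T"
  by (auto simp: pol_def subfld_closed coeff_pCons coeff_pderiv split: nat.split simp del: of_nat_Suc)

lemma pol_mult: "subfld T \<Longrightarrow> f \<in> pol T \<Longrightarrow> g \<in> pol T \<Longrightarrow> f * g \<in> pol T"
  unfolding pol_def by (auto simp: coeff_mult intro!: subfld_closed)

lemma pol_1: "subfld T \<Longrightarrow> 1 \<in> pol T"
  using pol_pCons[of T 1 0] pol_0[of T] by (simp add: one_pCons subfld_1)

lemma pol_sum: "subfld T \<Longrightarrow> (\<And>i. i \<in> A \<Longrightarrow> f i \<in> pol T) \<Longrightarrow> sum f A \<in> pol T"
  by (induction A rule: infinite_finite_induct) (auto simp: pol_0 pol_add)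

lemma pol_power: "subfld T \<Longrightarrow> f \<in> pol T \<Longrightarrow> f ^ n \<in> pol T"
  by (induction n) (auto simp: pol_1 pol_mult)

lemma pol_poly: "subfld T \<Longrightarrow> f \<in> pol T \<Longrightarrow> x \<in> T \<Longrightarrow> poly f x \<in> T"
  unfolding poly_altdef pol_def by (auto intro!: subfld_closed)

lemma pol_division:
  assumes T: "subfld T" and m: "m \<in> pol T" "m \<noteq> 0" and "f \<in> pol T"
  shows "\<exists>q\<in>pol T. \<exists>r\<in>pol T. f = q * m + r \<and> (r = 0 \<or> degree r < degree m)"
  using \<open>f \<in> pol T\<close>
proof (induction f)
  case 0
  then show ?case using pol_0[OF T] by force
next
  case (pCons a f)
  have a: "a \<in> T" and f: "f \<in> pol T"
    using pCons.prems unfolding pol_def by (auto simp: coeff_pCons split: nat.splits)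
  then obtain q r where qr: "q \<in> pol T" "r \<in> pol T" "f = q * m + r" "r = 0 \<or> degree r < degree m"
    using pCons.IH by blast
  define c where "c = coeff (pCons a r) (degree m) / lead_coeff m"
  define r' where "r' = pCons a r - smult c m"
  have lead: "lead_coeff m \<noteq> 0" "lead_coeff m \<in> T" using m by (auto simp: pol_def)
  have ar: "pCons a r \<in> pol T" by (rule pol_pCons[OF T a qr(2)])
  then have c: "c \<in> T" unfolding c_def using lead T by (auto simp: pol_def intro: subfld_divide)
  have "degree (pCons a r) \<le> degree m" using qr(4) by (auto simp: degree_pCons_eq_if)
  then have "degree r' \<le> degree m" unfolding r'_def
    by (intro degree_diff_le) (auto intro: order.trans[OF degree_smult_le])
  moreover have "coeff r' (degree m) = 0" using lead by (simp add: r'_def c_def)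
  ultimately have "r' = 0 \<or> degree r' < degree m" by (rule eq_zero_or_degree_less)
  moreover have "pCons a f = (pCons 0 q + [:c:]) * m + r'"
    unfolding r'_def qr(3) by (simp add: algebra_simps)
  moreover have "pCons 0 q + [:c:] \<in> pol T" "r' \<in> pol T" unfolding r'_def
    using T qr c m ar by (auto intro!: pol_add pol_pCons pol_0 pol_diff pol_smult subfld_0)
  ultimately show ?case by blast
qed

lemma linear_power_char:
  fixes \<theta> :: "'o::field"
  assumes "prime p" "of_nat p = (0::'o)"
  shows "[:- \<theta>, 1:] ^ p = monom 1 p - [:\<theta> ^ p:]"
proof -
  have "of_nat p = (0::'o poly)" using assms(2) by (simp add: of_nat_poly)
  then have "[:- \<theta>, 1:] ^ p + [:\<theta>:] ^ p = ([:- \<theta>, 1:] + [:\<theta>:]) ^ p"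
    using frobenius_add[OF assms(1)] by metis
  also have "[:- \<theta>, 1:] + [:\<theta>:] = monom 1 1" by (simp add: monom_altdef)
  finally have "[:- \<theta>, 1:] ^ p + [:\<theta> ^ p:] = monom 1 p" by (simp add: poly_const_pow monom_power)
  then show ?thesis by (simp add: algebra_simps)
qed

lemma degree_linear_power_char:
  "degree (monom 1 p - [:c:] :: 'o::field poly) = p" if "p > 0"
proof -
  have "degree (monom 1 p + [:- c:] :: 'o poly) = degree (monom (1::'o) p)"
    by (rule degree_add_eq_left) (use that in \<open>simp add: degree_monom_eq\<close>)
  moreover have "monom 1 p - [:c:] = monom 1 p + [:- c:]"
    by (rule poly_eqI) (simp add: coeff_pCons split: nat.split)
  ultimately show ?thesis by (simp only: degree_monom_eq one_neq_zero not_False_eq_True)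
qed

text \<open>The minimal polynomial of \<open>\<theta>\<close> over \<open>E\<close> divides \<open>(T - \<theta>)\<^sup>p\<close>, and by minimality its derivative
  does not vanish at \<open>\<theta>\<close>; so it is linear unless its degree is \<open>p\<close>.\<close>

lemma purely_inseparable_minpoly:
  fixes \<theta> :: "'o::field"
  assumes p: "prime p" "of_nat p = (0::'o)"
    and E: "subfld E" and \<theta>: "\<theta> ^ p \<in> E" "\<theta> \<notin> E"
    and f: "f \<in> pol E" "degree f < p" "poly f \<theta> = 0"
  shows "f = 0"
proof (rule ccontr)
  assume "f \<noteq> 0"
  define Q where "Q n \<longleftrightarrow> (\<exists>g\<in>pol E. g \<noteq> 0 \<and> poly g \<theta> = 0 \<and> degree g = n)" for n
  have "Q (degree f)" using f \<open>f \<noteq> 0\<close> by (auto simp: Q_def)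
  define n where "n = (LEAST n. Q n)"
  have "Q n" "n \<le> degree f" unfolding n_def using \<open>Q (degree f)\<close> by (auto intro: LeastI Least_le)
  then obtain g where g: "g \<in> pol E" "g \<noteq> 0" "poly g \<theta> = 0" "degree g = n"
    by (auto simp: Q_def)
  have minimal: "h = 0" if "h \<in> pol E" "poly h \<theta> = 0" "h = 0 \<or> degree h < n" for h
    using that not_less_Least[of "degree h" Q] unfolding n_def Q_def by blast
  have "n < p" using \<open>n \<le> degree f\<close> f by simp
  have "n > 0"
  proof (rule ccontr)
    assume "\<not> n > 0"
    then obtain c where "g = [:c:]" using g(4) by (auto elim: degree_eq_zeroE)
    then show False using g by simp
  qed
  have n0: "of_nat n \<noteq> (0::'o)"
    using \<open>n > 0\<close> \<open>n < p\<close> CHAR_eq_prime[OF p] by (auto simp: of_nat_eq_0_iff_char_dvd dest: dvd_imp_le)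
  obtain u where u: "g = [:- \<theta>, 1:] * u" using g(3) by (auto simp: poly_eq_0_iff_dvd)
  have "poly (pderiv g) \<theta> \<noteq> 0"
  proof
    assume *: "poly (pderiv g) \<theta> = 0"
    have "degree (pderiv g) \<le> n - 1"
      by (rule degree_le) (use g(4) in \<open>auto simp: coeff_pderiv coeff_eq_0\<close>)
    then have "degree (pderiv g) < n \<or> pderiv g = 0"
      using \<open>n > 0\<close> by auto
    then have "pderiv g = 0" using minimal[OF pol_pderiv[OF E g(1)] *] by argo
    then have "coeff (pderiv g) (n - 1) = 0" by simp
    then have "of_nat n * coeff g n = 0" using \<open>n > 0\<close> by (simp add: coeff_pderiv)
    moreover have "coeff g n \<noteq> 0" using g(2,4) by auto
    ultimately show False using n0 by simp
  qed
  then have u\<theta>: "poly u \<theta> \<noteq> 0" by (simp add: u pderiv_mult pderiv_pCons del: mult_pCons_left)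
  have mp: "monom 1 p - [:\<theta> ^ p:] \<in> pol E"
    using E \<theta> by (auto intro!: pol_diff pol_monom pol_pCons pol_0 subfld_1)
  obtain q r where qr: "q \<in> pol E" "r \<in> pol E" "monom 1 p - [:\<theta> ^ p:] = q * g + r"
      "r = 0 \<or> degree r < degree g"
    using pol_division[OF E g(1,2) mp] by blast
  have "poly r \<theta> = poly (monom 1 p - [:\<theta> ^ p:]) \<theta> - poly (q * g) \<theta>"
    unfolding qr(3) by simp
  then have "poly r \<theta> = 0" using g(3) by (simp add: poly_monom)
  then have "r = 0" using minimal qr g(4) by auto
  then have "[:- \<theta>, 1:] ^ p = [:- \<theta>, 1:] * (u * q)"
    using qr(3) unfolding linear_power_char[OF p] u by (simp only: add_0_right mult_ac)
  moreover have "[:- \<theta>, 1:] ^ p = [:- \<theta>, 1:] * [:- \<theta>, 1:] ^ (p - 1)"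
    using prime_gt_0_nat[OF p(1)] by (metis power_eq_if not_gr_zero)
  ultimately have uq: "u * q = [:- \<theta>, 1:] ^ (p - 1)" by (metis mult_cancel_left pCons_eq_0_iff zero_neq_one)
  then have "u * q \<noteq> 0" by (metis pCons_eq_0_iff power_not_zero zero_neq_one)
  \<comment> \<open>As \<theta> is a simple root of \<open>g\<close>, the cofactor \<open>u\<close>
    does not vanish at \<theta> and all p - 1 remaining linear factors lie in \<open>q\<close>.
    Comparing degrees makes \<open>u\<close> constant and \<open>g\<close> linear.\<close>
  have "order \<theta> (u * q) = p - 1" by (simp add: uq order_power_n_n)
  moreover have "order \<theta> u = 0" using u\<theta> by (rule order_0I)
  ultimately have "order \<theta> q = p - 1" using order_mult[OF \<open>u * q \<noteq> 0\<close>] by simp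
  then have "p - 1 \<le> degree q" using order_degree[of q \<theta>] \<open>u * q \<noteq> 0\<close> by auto
  moreover have "degree u + degree q = degree (u * q)"
    using \<open>u * q \<noteq> 0\<close> by (simp add: degree_mult_eq)
  moreover have "degree (u * q) = p - 1" unfolding uq by (rule degree_linear_power)
  ultimately have "degree u = 0" by simp
  then have "n = 1" using g u \<open>u * q \<noteq> 0\<close> by (auto simp: degree_mult_eq simp del: mult_pCons_left)
  then have "coeff g 1 \<noteq> 0" using leading_coeff_0_iff[of g] g by simp
  have "poly g \<theta> = coeff g 0 + coeff g 1 * \<theta>"
    using g(4) \<open>n = 1\<close> by (simp add: poly_altdef)
  then have "\<theta> = - coeff g 0 / coeff g 1" using g(3) \<open>coeff g 1 \<noteq> 0\<close>
    by (simp add: field_simps eq_neg_iff_add_eq_0)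
  moreover have "- coeff g 0 / coeff g 1 \<in> E" using E g(1) by (auto simp: pol_def intro!: subfld_closed)
  ultimately show False using \<theta>(2) by simp
qed

lemma adjoin_root_reduce:
  fixes \<theta> :: "'o::field"
  assumes "prime p" and E: "subfld E" and \<theta>: "\<theta> ^ p \<in> E" and f: "f \<in> pol E"
  shows "\<exists>g\<in>pol E. degree g < p \<and> poly g \<theta> = poly f \<theta>"
proof -
  have p: "p > 0" using assms(1) by (simp add: prime_gt_0_nat)
  let ?m = "monom 1 p - [:\<theta> ^ p:]"
  have "?m \<in> pol E" using E \<theta> by (auto intro!: pol_diff pol_monom pol_pCons pol_0 subfld_1)
  moreover have "?m \<noteq> 0" using degree_linear_power_char[OF p, of "\<theta> ^ p"] p by force
  ultimately obtain q r where qr: "q \<in> pol E" "r \<in> pol E" "f = q * ?m + r"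
      "r = 0 \<or> degree r < degree ?m"
    using pol_division[OF E _ _ f] by blast
  have "poly f \<theta> = poly r \<theta>" unfolding qr(3) by (simp add: poly_monom)
  moreover have "degree r < p" using qr(4) p degree_linear_power_char[OF p, of "\<theta> ^ p"] by auto
  ultimately show ?thesis using qr(2) by auto
qed

text \<open>Inverses exist because p-th powers of the values fall into \<open>E\<close>: 1/x =
  x^(p-1) / x^p.\<close>

lemma subfld_adjoin_root:
  fixes \<theta> :: "'o::field"
  assumes p: "prime p" "of_nat p = (0::'o)" and E: "subfld E" and \<theta>: "\<theta> ^ p \<in> E"
  shows "subfld ((\<lambda>f. poly f \<theta>) ` pol E)"
  unfolding subfld_def
proof (intro conjI ballI)
  let ?L = "(\<lambda>f. poly f \<theta>) ` pol E"
  show "0 \<in> ?L" using pol_0[OF E] by (force intro!: image_eqI[of _ _ 0])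
  show "1 \<in> ?L" using pol_1[OF E] by (force intro!: image_eqI[of _ _ 1])
  fix x assume "x \<in> ?L"
  then obtain f where f: "f \<in> pol E" "x = poly f \<theta>" by auto
  show "- x \<in> ?L" using f pol_smult[OF E subfld_uminus[OF E subfld_1[OF E]] f(1)]
    by (intro image_eqI[of _ _ "smult (- 1) f"]) auto
  have "x ^ p = (\<Sum>i\<le>degree f. (coeff f i * \<theta> ^ i) ^ p)"
    unfolding f(2) poly_altdef by (rule rhom_sum[OF rhom_frobenius[OF p]])
  also have "\<dots> = (\<Sum>i\<le>degree f. coeff f i ^ p * (\<theta> ^ p) ^ i)"
    by (simp add: power_mult_distrib flip: power_mult) (simp add: mult.commute)
  also have "\<dots> \<in> E" using E \<theta> f(1) by (auto simp: pol_def intro!: subfld_closed)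
  finally have xp: "inverse (x ^ p) \<in> E" by (rule subfld_inverse[OF E])
  have "inverse x = poly (smult (inverse (x ^ p)) (f ^ (p - 1))) \<theta>" if "x \<noteq> 0"
  proof -
    have "x ^ p = x * x ^ (p - 1)" using prime_gt_0_nat[OF p(1)] by (simp add: power_eq_if)
    then show ?thesis using that f(2) by (simp add: poly_power)
  qed
  then show "inverse x \<in> ?L"
    using pol_smult[OF E xp pol_power[OF E f(1)], of "p - 1"] \<open>0 \<in> ?L\<close>
    by (metis image_eqI inverse_zero)
  fix y assume "y \<in> ?L"
  then obtain g where g: "g \<in> pol E" "y = poly g \<theta>" by auto
  show "x + y \<in> ?L" using f g pol_add[OF E f(1) g(1)] by (intro image_eqI[of _ _ "f + g"]) auto
  show "x * y \<in> ?L" using f g pol_mult[OF E f(1) g(1)] by (intro image_eqI[of _ _ "f * g"]) auto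
qed

definition indp :: "'o::field set \<Rightarrow> ('i \<Rightarrow> 'o) \<Rightarrow> 'i set \<Rightarrow> bool" where
  "indp T c S \<longleftrightarrow> (\<forall>e. (\<forall>i\<in>S. e i \<in> T) \<longrightarrow> (\<Sum>i\<in>S. c i * e i) = 0 \<longrightarrow> (\<forall>i\<in>S. e i = 0))"

lemma indpD: "indp T c S \<Longrightarrow> (\<And>i. i \<in> S \<Longrightarrow> e i \<in> T) \<Longrightarrow> (\<Sum>i\<in>S. c i * e i) = 0 \<Longrightarrow> i \<in> S \<Longrightarrow> e i = 0"
  by (auto simp: indp_def)

section \<open>The generic point of a quasilinear hypersurface\<close>

text \<open>One field serves both hypersurfaces. The variables are numbered, so that the generic
  points of X and Y have coordinates in the same type and new variables are always at hand.\<close>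

type_synonym 'k gpoly = "(nat \<Rightarrow>\<^sub>0 nat) \<Rightarrow>\<^sub>0 'k"
type_synonym 'k gfield = "'k gpoly fract"

definition Em :: "'k::field gpoly \<Rightarrow> 'k gfield" where
  "Em a = Fraction_Field.Fract a 1"

definition kc :: "'k::field \<Rightarrow> 'k gfield" where
  "kc c = Em (Poly_Mapping.single 0 c)"

definition Xg :: "nat \<Rightarrow> 'k::field gpoly" where
  "Xg i = Poly_Mapping.single (Poly_Mapping.single i (Suc 0)) 1"

definition Xf :: "nat \<Rightarrow> 'k::field gfield" where
  "Xf i = Em (Xg i)"

lemma rhom_Em: "rhom Em"
  by (simp add: rhom_def Em_def One_fract_def)

lemma Em_eq_0_iff: "Em a = 0 \<longleftrightarrow> a = 0"
  by (simp add: Em_def Zero_fract_def eq_fract)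

lemma rhom_kc: "rhom kc"
  unfolding kc_def by (rule rhom_comp[OF rhom_const rhom_Em])

lemma kc_eq_0_iff: "kc c = 0 \<longleftrightarrow> c = 0"
  by (rule rhom_eq_0_iff[OF rhom_kc])

locale charp =
  fixes p :: nat and ty :: "'k::field itself"
  assumes p: "prime p" and char: "CHAR('k) = p"
begin

text \<open>Coefficients are twisted by Frobenius: on \<open>\<Sum> a\<^sub>v X\<^sub>v\<^sup>p\<close> the value is \<open>(\<Sum> a\<^sub>v x\<^sub>v)\<^sup>p\<close>.\<close>

abbreviation pev :: "('k \<Rightarrow> 'r::comm_ring_1) \<Rightarrow> ('v \<Rightarrow> 'r) \<Rightarrow> ('v, 'k) mpoly \<Rightarrow> 'r" where
  "pev g \<equiv> ev (\<lambda>c. g (c ^ p))"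

abbreviation kk :: "'k gfield set" where
  "kk \<equiv> range (\<lambda>c. kc (c ^ p))"

lemma of_nat_p: "rhom (g :: 'k \<Rightarrow> 'r::comm_ring_1) \<Longrightarrow> of_nat p = (0::'r)"
  using rhom_of_nat[of g p] char of_nat_CHAR[where ?'a = 'k] by (simp add: rhom_0)

lemma rhom_fp: "rhom (g :: 'k \<Rightarrow> 'r::comm_ring_1) \<Longrightarrow> rhom (\<lambda>c. g (c ^ p))"
  by (rule rhom_comp[OF rhom_frobenius[OF p]]) (use char of_nat_CHAR[where ?'a = 'k] in auto)

lemma of_nat_p_gfield: "of_nat p = (0 :: 'k gfield)"
  by (rule of_nat_p[OF rhom_kc])

lemma of_nat_p_gfield_poly: "of_nat p = (0 :: 'k gfield poly)"
  by (rule of_nat_p[OF rhom_comp[OF rhom_kc rhom_pCons]])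

lemma p_pos: "p > 0"
  using p by (rule prime_gt_0_nat)

lemmas rhom_pev = rhom_ev[OF rhom_fp]
lemmas frob_gfield = rhom_frobenius[OF p of_nat_p_gfield]
lemmas frob_gfield_poly = rhom_frobenius[OF p of_nat_p_gfield_poly]

lemma pev_Em: "pev kc (\<lambda>v. Em (y v)) f = Em (pev (Poly_Mapping.single 0) y f)"
  by (simp add: rhom_after_ev[OF rhom_Em] kc_def)

text \<open>Independence over F^p: the coefficients enter as \<open>e i ^ p\<close>. For the values
  of a form on a basis this is anisotropy.\<close>

definition kindp :: "('i \<Rightarrow> 'k) \<Rightarrow> 'i set \<Rightarrow> bool" where
  "kindp c S \<longleftrightarrow> (\<forall>e. (\<Sum>i\<in>S. c i * e i ^ p) = 0 \<longrightarrow> (\<forall>i\<in>S. e i = 0))"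

sublocale E0: graded_set "\<lambda>n. range (pev kc Xf)"
proof
  note h = rhom_pev[OF rhom_kc, of Xf]
  show "0 \<in> range (pev kc Xf)" by (rule range_eqI[of _ _ 0]) (simp add: rhom_0[OF h])
  show "1 \<in> range (pev kc Xf)" by (rule range_eqI[of _ _ 1]) (simp add: rhom_1[OF h])
  fix x assume x: "x \<in> range (pev kc Xf)"
  then show "- x \<in> range (pev kc Xf)" by (auto simp: rhom_uminus[OF h, symmetric])
  fix y assume y: "y \<in> range (pev kc Xf)"
  show "x + y \<in> range (pev kc Xf)" using x y by (auto simp: rhom_add[OF h, symmetric])
  show "x * y \<in> range (pev kc Xf)" using x y by (auto simp: rhom_mult[OF h, symmetric])
qed

text \<open>This is F^p(X_0, X_1, ...), since the family does not depend on the degree. It serves as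
  an upper bound for subfields over which elements of F remain as independent as over F^p.\<close>

definition E0 :: "'k gfield set" where
  "E0 = frac (\<lambda>n. range (pev kc Xf))"

lemma subfld_E0: "subfld E0"
  unfolding E0_def by (rule E0.subfld_frac)

lemma pev_Xf_in_E0: "pev kc Xf f \<in> E0"
  using E0.fracI[of "pev kc Xf f" 1] E0.D_1 by (simp add: E0_def)

lemma kc_in_E0: "kc (c ^ p) \<in> E0"
  using pev_Xf_in_E0[of "Poly_Mapping.single 0 c"] by (simp add: ev_const rhom_fp rhom_kc)

lemma Xf_in_E0: "Xf i \<in> E0"
  using pev_Xf_in_E0[of "Poly_Mapping.single (Poly_Mapping.single i (Suc 0)) 1"]
  by (simp only: ev_var rhom_fp rhom_kc)

lemma mon_Xg: "mon Xg m = Poly_Mapping.single m (1::'k)"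
proof -
  have 1: "Xg v ^ n = Poly_Mapping.single (Poly_Mapping.single v n) (1::'k)" for v n
    by (induction n) (auto simp: Xg_def mult_single simp flip: single_add)
  have 2: "(\<Prod>v\<in>A. Poly_Mapping.single (f v) 1) = Poly_Mapping.single (sum f A) (1::'k)"
    for A and f :: "nat \<Rightarrow> nat \<Rightarrow>\<^sub>0 nat"
    by (induction A rule: infinite_finite_induct) (auto simp: mult_single)
  show ?thesis unfolding mon_def 1 2 using mpoly_expand[of m] by simp
qed

lemma lookup_pev_Xg: "Poly_Mapping.lookup (pev (Poly_Mapping.single 0) Xg f) m = Poly_Mapping.lookup f m ^ p"
proof -
  have "Poly_Mapping.lookup (pev (Poly_Mapping.single 0) Xg f) m
    = (\<Sum>n\<in>Poly_Mapping.keys f. if n = m then Poly_Mapping.lookup f m ^ p else 0)"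
    unfolding ev_def mon_Xg lookup_sum
    by (rule sum.cong) (auto simp: mult_single lookup_single when_def)
  then show ?thesis using p_pos by (auto simp: in_keys_iff)
qed

lemma lookup_const_mult:
  "Poly_Mapping.lookup (Poly_Mapping.single 0 c * f) m = c * Poly_Mapping.lookup f m"
  by (simp add: mult_map_scale_conv_mult[symmetric] Poly_Mapping.map.rep_eq when_def)

text \<open>F and F^p(X_0, X_1, ...) are linearly disjoint over F^p: after clearing denominators,
  each monomial yields a relation between the \<open>c i\<close> with coefficients in F^p.\<close>

lemma indp_E0:
  fixes c :: "'i \<Rightarrow> 'k"
  assumes "finite S" "kindp c S"
  shows "indp E0 (\<lambda>i. kc (c i)) S"
  unfolding indp_def
proof (intro allI impI)
  fix e assume e: "\<forall>i\<in>S. e i \<in> E0" and 0: "(\<Sum>i\<in>S. kc (c i) * e i) = 0"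
  obtain d u where du: "d \<noteq> 0" "\<forall>i\<in>S. u i \<in> range (pev kc Xf) \<and> e i = u i / d"
    using E0.common_denominator[OF assms(1), of e] e unfolding E0_def by metis
  then have "\<forall>i\<in>S. \<exists>f. u i = pev kc Xf f" by auto
  then obtain f where f: "\<forall>i\<in>S. u i = pev kc Xf (f i)" by (rule bchoice[THEN exE])
  have "(\<Sum>i\<in>S. kc (c i) * u i) = d * (\<Sum>i\<in>S. kc (c i) * e i)"
    using du by (simp add: sum_distrib_left)
  then have "(\<Sum>i\<in>S. kc (c i) * pev kc Xf (f i)) = 0" using f 0 by simp
  moreover have "pev kc Xf (f i) = Em (pev (Poly_Mapping.single 0) Xg (f i))" for i
    using pev_Em[of Xg "f i"] by (simp add: Xf_def[abs_def])
  ultimately have "Em (\<Sum>i\<in>S. Poly_Mapping.single 0 (c i) * pev (Poly_Mapping.single 0) Xg (f i)) = 0"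
    by (simp add: rhom_simps[OF rhom_Em] kc_def)
  then have *: "(\<Sum>i\<in>S. Poly_Mapping.single 0 (c i) * pev (Poly_Mapping.single 0) Xg (f i)) = 0"
    by (simp add: Em_eq_0_iff)
  have "f i = 0" if "i \<in> S" for i
  proof (rule poly_mapping_eqI)
    fix m
    have "(\<Sum>i\<in>S. c i * Poly_Mapping.lookup (f i) m ^ p) = 0"
      using arg_cong[OF *, of "\<lambda>f. Poly_Mapping.lookup f m"]
      by (simp add: lookup_sum lookup_const_mult lookup_pev_Xg)
    then show "Poly_Mapping.lookup (f i) m = Poly_Mapping.lookup 0 m"
      using assms(2) \<open>i \<in> S\<close> by (auto simp: kindp_def)
  qed
  then show "\<forall>i\<in>S. e i = 0" using du f by (simp add: ev_0)
qed

end

text \<open>The coordinate \<open>b0\<close> is eliminated by the linear equation, and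
  \<open>ix\<close> numbers the remaining, free ones. \<open>B \<noteq> {b0}\<close> excludes
  one-dimensional forms, whose hypersurface is empty.\<close>

locale qform = charp p "TYPE('k)"
  for p :: nat and B :: "'v set" and a :: "'v \<Rightarrow> 'k::field" and ix :: "'v \<Rightarrow> nat" and b0 :: 'v +
  assumes finB: "finite B" and b0: "b0 \<in> B" and B1: "B \<noteq> {b0}"
    and kind: "kindp a B" and inj_ix: "inj_on ix (B - {b0})"
begin

text \<open>The generic point of the hyperplane with coefficients \<open>a v\<close>: the equation
  is solved for the coordinate \<open>b0\<close>.\<close>

definition gp :: "'v \<Rightarrow> 'k gpoly" where
  "gp v = (if v = b0 then - (\<Sum>u\<in>B - {b0}. Poly_Mapping.single 0 (a u / a b0) * Xg (ix u)) else Xg (ix v))"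

definition gx :: "'v \<Rightarrow> 'k gfield" where
  "gx v = Em (gp v)"

lemma a_nz: assumes "v \<in> B" shows "a v \<noteq> 0"
proof
  assume "a v = 0"
  then have "(\<Sum>u\<in>B. a u * (if u = v then 1 else 0) ^ p) = 0"
    using p_pos by (auto intro!: sum.neutral)
  then show False using kind assms unfolding kindp_def by force
qed

lemma sum_b0: "(\<Sum>v\<in>B. f v) = f b0 + (\<Sum>v\<in>B - {b0}. f v)" for f :: "'v \<Rightarrow> 'r::comm_monoid_add"
  using finB b0 by (simp add: sum.remove)

lemma gp_rel: "(\<Sum>v\<in>B. Poly_Mapping.single 0 (a v) * gp v) = 0"
proof -
  have "Poly_Mapping.single 0 (a b0) * gp b0 = - (\<Sum>u\<in>B - {b0}. Poly_Mapping.single 0 (a u) * Xg (ix u))"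
    using a_nz[OF b0] by (simp add: gp_def sum_distrib_left mult_single flip: mult.assoc)
  then show ?thesis unfolding sum_b0 by (simp add: gp_def)
qed

lemma gx_rel: "(\<Sum>v\<in>B. kc (a v) * gx v) = 0"
  using arg_cong[OF gp_rel, of Em] by (simp add: rhom_simps[OF rhom_Em] kc_def gx_def)

lemma ev_gp:
  fixes g :: "'k \<Rightarrow> 'r::comm_ring_1"
  assumes g: "rhom g" and z: "(\<Sum>v\<in>B. g (a v) * z v) = 0"
    and u: "\<And>v. v \<in> B - {b0} \<Longrightarrow> u (ix v) = z v" and "v \<in> B"
  shows "ev g u (gp v) = z v"
proof (cases "v = b0")
  case True
  have "g (inverse (a b0)) * (g (a b0) * z b0 + (\<Sum>v\<in>B - {b0}. g (a v) * z v)) = 0"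
    using z unfolding sum_b0 by simp
  moreover have "g (inverse (a b0)) * g (a b0) = 1"
    using a_nz[OF b0] by (simp add: rhom_1[OF g] flip: rhom_mult[OF g])
  ultimately have "z b0 = - g (inverse (a b0)) * (\<Sum>v\<in>B - {b0}. g (a v) * z v)"
    by (simp add: distrib_left eq_neg_iff_add_eq_0 flip: mult.assoc)
  also have "\<dots> = - (\<Sum>v\<in>B - {b0}. g (a v / a b0) * z v)"
    by (simp add: sum_distrib_left rhom_mult[OF g] divide_inverse mult_ac sum_negf)
  also have "\<dots> = ev g u (gp v)"
    using True u by (simp add: gp_def rhom_simps[OF rhom_ev[OF g]] ev_const[OF g] Xg_def ev_var[OF g])
  finally show ?thesis using True by simp
next
  case False
  then show ?thesis using assms by (simp add: gp_def Xg_def ev_var[OF g])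
qed

text \<open>The free coordinates of the generic point are variables and can be sent to those of
  \<open>z\<close>; the coordinate \<open>b0\<close> then follows from the linear equation. The
  target is an arbitrary ring, which admits arcs as points with polynomial coordinates.\<close>

lemma specialization:
  fixes g :: "'k \<Rightarrow> 'r::comm_ring_1"
  assumes g: "rhom g" and z: "(\<Sum>v\<in>B. g (a v) * z v) = 0"
  obtains s where "rhom s" "\<And>c. s (Poly_Mapping.single 0 c) = g c" "\<And>v. v \<in> B \<Longrightarrow> s (gp v) = z v"
proof
  let ?u = "\<lambda>i. z (the_inv_into (B - {b0}) ix i)"
  show "rhom (ev g ?u)" by (rule rhom_ev[OF g])
  show "ev g ?u (Poly_Mapping.single 0 c) = g c" for c by (rule ev_const[OF g])
  show "ev g ?u (gp v) = z v" if "v \<in> B" for v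
    by (rule ev_gp[OF g z _ that]) (simp add: the_inv_into_f_f[OF inj_ix])
qed

text \<open>The \<open>c i\<close> enter without Frobenius twist, unlike the coefficients of the
  \<open>f i\<close>. Thus linear dependences of elements of F over the function field, once
  denominators are cleared, persist at every point of the hyperplane.\<close>

lemma special_comb:
  fixes g :: "'k \<Rightarrow> 'r::comm_ring_1"
  assumes g: "rhom g" and z: "(\<Sum>v\<in>B. g (a v) * z v) = 0"
    and f: "\<And>i. i \<in> S \<Longrightarrow> f i \<in> carrier (coord_ring B)"
    and 0: "(\<Sum>i\<in>S. kc (c i) * pev kc gx (f i)) = 0"
  shows "(\<Sum>i\<in>S. g (c i) * pev g z (f i)) = 0"
proof -
  obtain s where s: "rhom s" "\<And>c. s (Poly_Mapping.single 0 c) = g c" "\<And>v. v \<in> B \<Longrightarrow> s (gp v) = z v"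
    using specialization[OF g z] by blast
  have "(\<Sum>i\<in>S. kc (c i) * pev kc gx (f i))
    = Em (\<Sum>i\<in>S. Poly_Mapping.single 0 (c i) * pev (Poly_Mapping.single 0) gp (f i))"
    using pev_Em[of gp] by (simp add: rhom_simps[OF rhom_Em] kc_def gx_def[abs_def])
  then have "(\<Sum>i\<in>S. Poly_Mapping.single 0 (c i) * pev (Poly_Mapping.single 0) gp (f i)) = 0"
    using 0 by (simp add: Em_eq_0_iff)
  then have "(\<Sum>i\<in>S. s (Poly_Mapping.single 0 (c i)) * s (pev (Poly_Mapping.single 0) gp (f i))) = 0"
    using rhom_0[OF s(1)] by (simp flip: rhom_sum[OF s(1)] rhom_mult[OF s(1)])
  moreover have "s (pev (Poly_Mapping.single 0) gp (f i)) = pev g z (f i)" if "i \<in> S" for i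
    unfolding rhom_after_ev[OF s(1)] s(2) by (rule ev_CR_cong[OF f[OF that] s(3)])
  ultimately show ?thesis by (simp add: s(2) cong: sum.cong)
qed

lemma special_zero:
  fixes g :: "'k \<Rightarrow> 'r::comm_ring_1"
  assumes "rhom g" "(\<Sum>v\<in>B. g (a v) * z v) = 0" "f \<in> carrier (coord_ring B)" "pev kc gx f = 0"
  shows "pev g z f = 0"
  using special_comb[of g z "{()}" "\<lambda>_. f" "\<lambda>_. 1"] assms by (simp add: rhom_1 rhom_kc)

text \<open>Otherwise \<open>gx_rel\<close> would be a nontrivial relation over \<open>E0\<close>
  between the \<open>a v\<close>, which are independent there by \<open>indp_E0\<close>.\<close>

lemma gx_b0_not_E0: "gx b0 \<notin> E0"
proof
  assume *: "gx b0 \<in> E0"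
  have "gx v = 0" if "v \<in> B" for v
  proof (rule indpD[OF indp_E0[OF finB kind] _ gx_rel that])
    show "gx u \<in> E0" for u using * Xf_in_E0[of "ix u"] by (auto simp: gx_def gp_def Xf_def)
  qed
  moreover obtain v where "v \<in> B" "v \<noteq> b0" using B1 b0 by auto
  ultimately have "gx v = 0" by blast
  then have "Xg (ix v) = (0::'k gpoly)"
    using \<open>v \<noteq> b0\<close> Em_eq_0_iff[of "gp v"] by (simp add: gx_def gp_def)
  then show False by (metis Xg_def lookup_single_eq lookup_zero zero_neq_one)
qed

lemma gx_in_E0: "v \<noteq> b0 \<Longrightarrow> gx v \<in> E0"
  using Xf_in_E0[of "ix v"] by (simp add: gx_def gp_def Xf_def)

lemma gx_nz: assumes "v \<in> B" shows "gx v \<noteq> 0"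
proof (cases "v = b0")
  case True
  then show ?thesis using gx_b0_not_E0 subfld_0[OF subfld_E0] by auto
next
  case False
  have "Xg (ix v) \<noteq> (0::'k gpoly)" by (metis Xg_def lookup_single_eq lookup_zero zero_neq_one)
  then show ?thesis using False by (simp add: gx_def gp_def Em_eq_0_iff)
qed

lemma gx_b0_power: "gx b0 ^ p = (\<Sum>u\<in>B - {b0}. kc ((- a u / a b0) ^ p) * gx u ^ p)"
proof -
  have "kc (a b0) * gx b0 = - (\<Sum>v\<in>B - {b0}. kc (a v) * gx v)"
    using gx_rel unfolding sum_b0 by (simp add: eq_neg_iff_add_eq_0)
  then have "gx b0 = - (\<Sum>v\<in>B - {b0}. kc (a v) * gx v) / kc (a b0)"
    using a_nz[OF b0] by (simp add: field_simps kc_eq_0_iff)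
  also have "\<dots> = (\<Sum>v\<in>B - {b0}. kc (- a v / a b0) * gx v)"
  proof -
    have "kc (- a v / a b0) = - kc (a v) / kc (a b0)" for v
    proof -
      have "kc (- a v / a b0) * kc (a b0) = - kc (a v)"
        using a_nz[OF b0] by (simp add: rhom_uminus[OF rhom_kc] flip: rhom_mult[OF rhom_kc])
      then show ?thesis using a_nz[OF b0] by (simp add: field_simps kc_eq_0_iff)
    qed
    then show ?thesis by (simp add: sum_divide_distrib sum_negf)
  qed
  finally have "gx b0 ^ p = (\<Sum>v\<in>B - {b0}. (kc (- a v / a b0) * gx v) ^ p)"
    using rhom_sum[OF frob_gfield] by metis
  then show ?thesis by (simp add: power_mult_distrib rhom_power[OF rhom_kc])
qed

definition red_mon :: "('v \<Rightarrow>\<^sub>0 nat) \<Rightarrow> (nat \<Rightarrow>\<^sub>0 nat)" where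
  "red_mon m = (\<Sum>v\<in>B - {b0}. Poly_Mapping.single (ix v) (Poly_Mapping.lookup m v))"

lemma lookup_red_mon: assumes "v \<in> B - {b0}"
  shows "Poly_Mapping.lookup (red_mon m) (ix v) = Poly_Mapping.lookup m v"
proof -
  have "Poly_Mapping.lookup (red_mon m) (ix v)
    = (\<Sum>u\<in>B - {b0}. if u = v then Poly_Mapping.lookup m v else 0)"
    unfolding red_mon_def lookup_sum
    by (rule sum.cong) (use assms inj_ix in \<open>auto simp: lookup_single when_def inj_on_def\<close>)
  then show ?thesis using assms finB by simp
qed

lemma mon_gx:
  assumes "Poly_Mapping.keys m \<subseteq> B"
  shows "mon gx m = Em (Poly_Mapping.single (red_mon m) 1) * gx b0 ^ Poly_Mapping.lookup m b0"
proof -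
  have 1: "Xg v ^ n = Poly_Mapping.single (Poly_Mapping.single v n) (1::'k)" for v n
    using mon_single[of Xg v n] mon_Xg by metis
  have 2: "(\<Prod>v\<in>A. Poly_Mapping.single (f v) 1) = Poly_Mapping.single (sum f A) (1::'k)"
    for A and f :: "'v \<Rightarrow> nat \<Rightarrow>\<^sub>0 nat"
    by (induction A rule: infinite_finite_induct) (auto simp: mult_single)
  have "(\<Prod>v\<in>B - {b0}. gx v ^ Poly_Mapping.lookup m v)
    = Em (\<Prod>v\<in>B - {b0}. Xg (ix v) ^ Poly_Mapping.lookup m v)"
    by (simp add: rhom_simps[OF rhom_Em] gx_def gp_def)
  also have "\<dots> = Em (Poly_Mapping.single (red_mon m) 1)"
    by (simp add: 1 2 red_mon_def)
  finally show ?thesis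
    unfolding mon_superset[OF finB assms] using finB b0 by (simp add: prod.remove mult.commute)
qed

text \<open>Sorting by the exponent of \<open>b0\<close> turns the value into a polynomial of degree
  below p in \<open>gx b0\<close> over \<open>E0\<close>. As \<open>gx b0\<close> has degree p over
  \<open>E0\<close>, every coefficient vanishes, and inside a coefficient distinct monomials cannot
  cancel.\<close>

lemma reduced_eq_0:
  assumes r: "r \<in> carrier (coord_ring B)" "pev kc gx r = 0"
    and red: "\<And>m. m \<in> Poly_Mapping.keys r \<Longrightarrow> Poly_Mapping.lookup m b0 < p"
  shows "r = 0"
proof -
  let ?K = "Poly_Mapping.keys r"
  let ?c = "\<lambda>m. Poly_Mapping.single (red_mon m) (Poly_Mapping.lookup r m ^ p)"
  define F where "F = (\<Sum>m\<in>?K. monom (Em (?c m)) (Poly_Mapping.lookup m b0))"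
  have KB: "Poly_Mapping.keys m \<subseteq> B" if "m \<in> ?K" for m using r(1) that by (auto simp: CR_iff)
  have "kc c * Em (Poly_Mapping.single k 1) = Em (Poly_Mapping.single k c)" for c :: 'k and k
    by (simp add: kc_def mult_single flip: rhom_mult[OF rhom_Em])
  then have "poly F (gx b0) = pev kc gx r"
    unfolding F_def ev_def
    by (simp add: poly_sum poly_monom) (intro sum.cong refl, simp add: mon_gx KB flip: mult.assoc)
  moreover have "Em (Poly_Mapping.single k (c ^ p)) \<in> E0" for c :: 'k and k
  proof -
    have "Em (Poly_Mapping.single k (c ^ p)) = pev kc Xf (Poly_Mapping.single k c)"
      using pev_Em[of Xg "Poly_Mapping.single k c"]
      by (simp add: ev_single rhom_fp rhom_const mon_Xg mult_single Xf_def[abs_def])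
    then show ?thesis by (simp add: pev_Xf_in_E0)
  qed
  then have "F \<in> pol E0" unfolding F_def by (intro pol_sum pol_monom subfld_E0)
  moreover have "degree F < p"
  proof (cases "F = 0")
    case False
    have "degree F \<le> p - 1" unfolding F_def
    proof (rule degree_sum_le)
      fix m assume "m \<in> ?K"
      then have "Poly_Mapping.lookup m b0 \<le> p - 1" using red[of m] by simp
      then show "degree (monom (Em (?c m)) (Poly_Mapping.lookup m b0)) \<le> p - 1"
        using degree_monom_le order.trans by blast
    qed simp
    then show ?thesis using p_pos by simp
  qed (use p_pos in auto)
  moreover have "gx b0 ^ p \<in> E0" unfolding gx_b0_power
    by (intro subfld_closed subfld_E0 kc_in_E0 gx_in_E0) auto
  ultimately have "F = 0"
    using purely_inseparable_minpoly[OF p of_nat_p_gfield subfld_E0 _ gx_b0_not_E0] r(2) by auto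
  have "Poly_Mapping.lookup r k = 0" if k: "k \<in> ?K" for k
  proof -
    have "coeff F (Poly_Mapping.lookup k b0)
      = Em (\<Sum>m\<in>?K. if Poly_Mapping.lookup m b0 = Poly_Mapping.lookup k b0 then ?c m else 0)"
      unfolding F_def coeff_sum rhom_sum[OF rhom_Em]
      by (rule sum.cong) (auto simp: rhom_0[OF rhom_Em])
    then have s0: "(\<Sum>m\<in>?K. if Poly_Mapping.lookup m b0 = Poly_Mapping.lookup k b0 then ?c m else 0) = 0"
      using \<open>F = 0\<close> Em_eq_0_iff by auto
    have "0 = (\<Sum>m\<in>?K. Poly_Mapping.lookup
        (if Poly_Mapping.lookup m b0 = Poly_Mapping.lookup k b0 then ?c m else 0) (red_mon k))"
      unfolding lookup_sum[symmetric] s0 by simp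
    also have "\<dots> = (\<Sum>m\<in>?K. if m = k then Poly_Mapping.lookup r k ^ p else 0)"
    proof (intro sum.cong refl)
      fix m assume m: "m \<in> ?K"
      have "m = k" if "red_mon m = red_mon k" "Poly_Mapping.lookup m b0 = Poly_Mapping.lookup k b0"
      proof (rule poly_mapping_eqI)
        fix v
        show "Poly_Mapping.lookup m v = Poly_Mapping.lookup k v"
        proof (cases "v \<in> B")
          case True
          then show ?thesis using that lookup_red_mon[of v m] lookup_red_mon[of v k] by (cases "v = b0") auto
        next
          case False
          then show ?thesis using KB[OF m] KB[OF k] by (metis in_keys_iff subsetD)
        qed
      qed
      then show "Poly_Mapping.lookup
        (if Poly_Mapping.lookup m b0 = Poly_Mapping.lookup k b0 then ?c m else 0) (red_mon k)
        = (if m = k then Poly_Mapping.lookup r k ^ p else 0)"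
        by (auto simp: lookup_single when_def)
    qed
    finally show ?thesis using k p_pos by simp
  qed
  then show ?thesis by (intro poly_mapping_eqI) (metis in_keys_iff lookup_zero)
qed

abbreviation R :: "('v, 'k) mpoly ring" where "R \<equiv> coord_ring B"
abbreviation I where "I \<equiv> genideal R {form_poly p B a}"

lemma ring_R: "ring R"
  using cring_coord_ring by (rule cring.axioms(1))

lemma form_poly_in: "form_poly p B a \<in> carrier R"
  using forms_form_poly by (rule forms_CR)

lemma ideal_I: "ideal I R"
  using form_poly_in by (intro ring.genideal_ideal[OF ring_R]) auto

lemma I_CR: "f \<in> I \<Longrightarrow> f \<in> carrier R"
  using ideal.Icarr[OF ideal_I] by blast

lemma I_add: "f \<in> I \<Longrightarrow> g \<in> I \<Longrightarrow> f + g \<in> I"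
  using additive_subgroup.a_closed[OF ideal.axioms(1)[OF ideal_I]] by (simp add: coord_ring_simps)

lemma I_0: "0 \<in> I"
  using additive_subgroup.zero_closed[OF ideal.axioms(1)[OF ideal_I]] by (simp add: coord_ring_simps)

lemma I_mult: "f \<in> I \<Longrightarrow> g \<in> carrier R \<Longrightarrow> g * f \<in> I"
  using ideal.I_l_closed[OF ideal_I] by (simp add: coord_ring_simps)

lemma I_sum: "(\<And>i. i \<in> A \<Longrightarrow> f i \<in> I) \<Longrightarrow> sum f A \<in> I"
  by (induction A rule: infinite_finite_induct) (auto simp: I_0 I_add)

lemma form_poly_in_I: "form_poly p B a \<in> I"
  using ring.genideal_self'[OF ring_R] form_poly_in by blast

lemma I_least:
  assumes "J \<subseteq> carrier R" "0 \<in> J" "form_poly p B a \<in> J"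
    and "\<And>f g. f \<in> J \<Longrightarrow> g \<in> J \<Longrightarrow> f + g \<in> J" "\<And>f g. f \<in> J \<Longrightarrow> g \<in> carrier R \<Longrightarrow> g * f \<in> J"
  shows "I \<subseteq> J"
proof -
  note ring = ring_R
  have "- f \<in> J" if "f \<in> J" for f
    using assms(5)[OF that CR_uminus[OF CR_1]] by simp
  then have "subgroup J (add_monoid R)"
  proof (intro group.subgroupI[OF abelian_group.a_group[OF ring.is_abelian_group[OF ring]]])
    fix f assume neg: "\<And>f. f \<in> J \<Longrightarrow> - f \<in> J" and f: "f \<in> J"
    then have "f \<in> carrier R" using assms(1) by auto
    then have "\<ominus>\<^bsub>R\<^esub> f = - f"
      by (intro abelian_group.minus_equality[OF ring.is_abelian_group[OF ring]])
        (auto simp: coord_ring_simps CR_uminus)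
    then show "inv\<^bsub>add_monoid R\<^esub> f \<in> J" using neg[OF f] by (simp add: a_inv_def)
  qed (use assms in \<open>auto simp: coord_ring_simps\<close>)
  then have "ideal J R"
    by (intro idealI ring) (use assms(5) in \<open>auto simp: coord_ring_simps mult.commute\<close>)
  then show ?thesis using assms(3) by (intro ring.genideal_minimal[OF ring]) auto
qed

text \<open>Division by the form as a polynomial in the variable \<open>b0\<close>: its p-th power
  is exchanged for p-th powers of the other variables, which lowers the exponent of
  \<open>b0\<close> by p.\<close>

lemma reduce_single:
  assumes "Poly_Mapping.keys m \<subseteq> B"
  shows "\<exists>r\<in>carrier R. Poly_Mapping.single m c - r \<in> I \<and>
    (\<forall>k\<in>Poly_Mapping.keys r. Poly_Mapping.lookup k b0 < p)"
  using assms
proof (induction "Poly_Mapping.lookup m b0" arbitrary: m c rule: less_induct)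
  case less
  show ?case
  proof (cases "Poly_Mapping.lookup m b0 < p")
    case True
    then show ?thesis using CR_single[OF less.prems] I_0
      by (intro bexI[of _ "Poly_Mapping.single m c"]) auto
  next
    case False
    define m' where "m' = m - Poly_Mapping.single b0 p"
    have m: "m = m' + Poly_Mapping.single b0 p"
      by (rule poly_mapping_eqI) (use False in \<open>auto simp: m'_def lookup_add lookup_minus lookup_single when_def\<close>)
    have "Poly_Mapping.keys m' \<subseteq> B"
      using less.prems unfolding m by (auto simp: in_keys_iff lookup_add)
    let ?c = "\<lambda>v. - (c / a b0 * a v)" and ?m = "\<lambda>v. m' + Poly_Mapping.single v p"
    have "\<exists>r\<in>carrier R. Poly_Mapping.single (?m v) (?c v) - r \<in> I \<and>
      (\<forall>k\<in>Poly_Mapping.keys r. Poly_Mapping.lookup k b0 < p)" if "v \<in> B - {b0}" for v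
    proof (rule less.hyps)
      show "Poly_Mapping.lookup (?m v) b0 < Poly_Mapping.lookup m b0"
        using that p_pos by (simp add: m lookup_add lookup_single when_def)
      show "Poly_Mapping.keys (?m v) \<subseteq> B"
        using keys_add[of m' "Poly_Mapping.single v p"] \<open>Poly_Mapping.keys m' \<subseteq> B\<close> that by (auto split: if_splits)
    qed
    then obtain r where r: "\<And>v. v \<in> B - {b0} \<Longrightarrow> r v \<in> carrier R"
      "\<And>v. v \<in> B - {b0} \<Longrightarrow> Poly_Mapping.single (?m v) (?c v) - r v \<in> I"
      "\<And>v k. v \<in> B - {b0} \<Longrightarrow> k \<in> Poly_Mapping.keys (r v) \<Longrightarrow> Poly_Mapping.lookup k b0 < p"
      by metis
    have "Poly_Mapping.single m' (c / a b0) * form_poly p B a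
      = Poly_Mapping.single m c - (\<Sum>v\<in>B - {b0}. Poly_Mapping.single (?m v) (?c v))"
      unfolding form_poly_def sum_b0 distrib_left sum_distrib_left mult_single m
      using a_nz[OF b0] by (simp add: single_uminus sum_negf)
    moreover have "Poly_Mapping.single m' (c / a b0) * form_poly p B a \<in> I"
      by (intro I_mult form_poly_in_I CR_single \<open>Poly_Mapping.keys m' \<subseteq> B\<close>)
    moreover have "(\<Sum>v\<in>B - {b0}. Poly_Mapping.single (?m v) (?c v) - r v) \<in> I"
      by (intro I_sum r(2))
    ultimately have "Poly_Mapping.single m c - sum r (B - {b0}) \<in> I"
      using I_add by (fastforce simp: sum_subtractf)
    moreover have "sum r (B - {b0}) \<in> carrier R" by (intro CR_sum r(1))
    moreover have "Poly_Mapping.lookup k b0 < p" if "k \<in> Poly_Mapping.keys (sum r (B - {b0}))" for k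
    proof -
      have "\<exists>v\<in>B - {b0}. Poly_Mapping.lookup (r v) k \<noteq> 0"
        using that unfolding in_keys_iff lookup_sum by (meson sum.not_neutral_contains_not_neutral)
      then show ?thesis using r(3) by (auto simp: in_keys_iff)
    qed
    ultimately show ?thesis by blast
  qed
qed

lemma pev_form_poly:
  assumes g: "rhom (g :: 'k \<Rightarrow> 'r::comm_ring_1)" and z: "(\<Sum>v\<in>B. g (a v) * z v) = 0"
  shows "pev g z (form_poly p B a) = 0"
proof -
  have "pev g z (form_poly p B a) = (\<Sum>v\<in>B. (g (a v) * z v) ^ p)"
    unfolding form_poly_def ev_sum[OF rhom_fp[OF g]] ev_single[OF rhom_fp[OF g]] mon_single
    by (simp add: power_mult_distrib rhom_power[OF g])
  also have "\<dots> = (\<Sum>v\<in>B. g (a v) * z v) ^ p"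
    by (rule rhom_sum[OF rhom_frobenius[OF p of_nat_p[OF g]], symmetric])
  finally show ?thesis using z zero_power[OF p_pos] by simp
qed

lemma I_pev_0:
  assumes "rhom (g :: 'k \<Rightarrow> 'r::comm_ring_1)" "(\<Sum>v\<in>B. g (a v) * z v) = 0" "f \<in> I"
  shows "pev g z f = 0"
proof -
  note h = rhom_pev[OF assms(1), of z]
  have "I \<subseteq> {f \<in> carrier R. pev g z f = 0}"
    by (rule I_least) (auto simp: CR_0 CR_add CR_mult form_poly_in rhom_simps[OF h] pev_form_poly[OF assms(1,2)])
  then show ?thesis using assms(3) by blast
qed

text \<open>The twisted evaluation embeds the coordinate ring in a field; in particular
  \<open>I\<close> is prime. Modulo \<open>I\<close> every polynomial has degree below p in
  \<open>b0\<close>, and such a polynomial vanishes at the generic point only if it is zero.\<close>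

theorem I_iff: "f \<in> I \<longleftrightarrow> f \<in> carrier R \<and> pev kc gx f = 0"
proof (intro iffI conjI)
  show "f \<in> carrier R" "pev kc gx f = 0" if "f \<in> I"
    using that I_CR I_pev_0[OF rhom_kc gx_rel] by auto
  assume f: "f \<in> carrier R \<and> pev kc gx f = 0"
  have "\<exists>r\<in>carrier R. Poly_Mapping.single m (Poly_Mapping.lookup f m) - r \<in> I \<and>
      (\<forall>k\<in>Poly_Mapping.keys r. Poly_Mapping.lookup k b0 < p)" if "m \<in> Poly_Mapping.keys f" for m
    using reduce_single that f by (auto simp: CR_iff)
  then obtain r where r: "\<And>m. m \<in> Poly_Mapping.keys f \<Longrightarrow> r m \<in> carrier R"
      "\<And>m. m \<in> Poly_Mapping.keys f \<Longrightarrow> Poly_Mapping.single m (Poly_Mapping.lookup f m) - r m \<in> I"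
      "\<And>m k. m \<in> Poly_Mapping.keys f \<Longrightarrow> k \<in> Poly_Mapping.keys (r m) \<Longrightarrow> Poly_Mapping.lookup k b0 < p"
    by metis
  let ?r = "sum r (Poly_Mapping.keys f)"
  have "(\<Sum>m\<in>Poly_Mapping.keys f. Poly_Mapping.single m (Poly_Mapping.lookup f m) - r m) \<in> I"
    by (intro I_sum r(2))
  then have fr: "f - ?r \<in> I" using mpoly_expand[of f] by (simp add: sum_subtractf)
  have "?r \<in> carrier R" by (intro CR_sum r(1))
  moreover have "pev kc gx (f - ?r) = 0" using I_pev_0[OF rhom_kc gx_rel fr] .
  then have "pev kc gx ?r = 0" using f by (simp add: rhom_diff[OF rhom_pev[OF rhom_kc]])
  moreover have "Poly_Mapping.lookup k b0 < p" if "k \<in> Poly_Mapping.keys ?r" for k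
  proof -
    have "\<exists>m\<in>Poly_Mapping.keys f. Poly_Mapping.lookup (r m) k \<noteq> 0"
      using that unfolding in_keys_iff lookup_sum by (meson sum.not_neutral_contains_not_neutral)
    then show ?thesis using r(3) by (auto simp: in_keys_iff)
  qed
  ultimately have "?r = 0" by (rule reduced_eq_0)
  then show "f \<in> I" using fr by simp
qed

end

section \<open>Specialization along arcs\<close>

text \<open>Orders below \<open>N\<close> vanish and \<open>c\<close> is the coefficient of order
  \<open>N\<close>. It may be zero: a whole family is compared at one common order, so that these
  coefficients add up.\<close>

definition lead :: "nat \<Rightarrow> 'o::field poly \<Rightarrow> 'o \<Rightarrow> bool" where
  "lead N h c \<longleftrightarrow> (\<exists>q. h = monom 1 N * q \<and> poly q 0 = c)"

lemma lead_0: "lead N 0 0"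
  unfolding lead_def by (rule exI[of _ 0]) simp

lemma lead_add: "lead N f c \<Longrightarrow> lead N g d \<Longrightarrow> lead N (f + g) (c + d)"
  unfolding lead_def by (metis distrib_left poly_add)

lemma lead_sum: "(\<And>i. i \<in> A \<Longrightarrow> lead N (f i) (c i)) \<Longrightarrow> lead N (sum f A) (sum c A)"
  by (induction A rule: infinite_finite_induct) (auto simp: lead_0 lead_add)

lemma lead_const_mult: assumes "lead N f c" shows "lead N ([:k:] * f) (k * c)"
proof -
  obtain q where "f = monom 1 N * q" "poly q 0 = c" using assms by (auto simp: lead_def)
  then show ?thesis unfolding lead_def by (intro exI[of _ "[:k:] * q"]) (simp add: mult_ac)
qed

lemma lead_shift: assumes "lead N f c" shows "lead (M + N) (monom 1 M * f) c"
proof -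
  obtain q where q: "f = monom 1 N * q" "poly q 0 = c" using assms by (auto simp: lead_def)
  have "monom 1 M * f = (monom 1 M * monom 1 N) * q" unfolding q(1) by (rule mult.assoc[symmetric])
  then show ?thesis unfolding lead_def using q(2) by (intro exI[of _ q]) (simp only: mult_monom mult_1 simp_thms)
qed

lemma lead_monom_mult: assumes "N < M" shows "lead N (monom 1 M * f) 0"
proof -
  have "monom 1 M = monom 1 N * monom (1::'a) (M - N)" using assms by (simp add: mult_monom)
  then have "monom 1 M * f = monom 1 N * (monom 1 (M - N) * f)" by (simp only: mult.assoc)
  moreover have "poly (monom 1 (M - N) * f) 0 = 0" using assms by (simp add: poly_monom)
  ultimately show ?thesis unfolding lead_def by (intro exI conjI)
qed

lemma lead_unique: assumes "lead N h c" "lead N h d" shows "c = d"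
proof -
  obtain q where q: "h = monom 1 N * q" "poly q 0 = c" using assms(1) unfolding lead_def by (elim exE conjE)
  obtain r where r: "h = monom 1 N * r" "poly r 0 = d" using assms(2) unfolding lead_def by (elim exE conjE)
  have "monom (1::'a) N \<noteq> 0" by (simp add: monom_eq_0_iff)
  then have "q = r" using q(1) r(1) by (metis mult_left_cancel)
  then show ?thesis using q r by simp
qed

lemma rhom_pcompose: "rhom (\<lambda>f. pcompose f (q::'a::comm_ring_1 poly))"
  by (simp add: rhom_def pcompose_add pcompose_mult pcompose_1)

text \<open>The ring E[\<theta> + t] inside the polynomials in the arc parameter t.\<close>

definition tpol :: "'o::field set \<Rightarrow> 'o \<Rightarrow> 'o poly set" where
  "tpol E \<theta> = (\<lambda>f. pcompose f [:\<theta>, 1:]) ` pol E"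

lemma tpol_I: "f \<in> pol E \<Longrightarrow> pcompose f [:\<theta>, 1:] \<in> tpol E \<theta>"
  by (simp add: tpol_def)

lemma tpol_add: "subfld E \<Longrightarrow> f \<in> tpol E \<theta> \<Longrightarrow> g \<in> tpol E \<theta> \<Longrightarrow> f + g \<in> tpol E \<theta>"
  unfolding tpol_def by (auto simp: pol_add simp flip: pcompose_add)

lemma tpol_mult: "subfld E \<Longrightarrow> f \<in> tpol E \<theta> \<Longrightarrow> g \<in> tpol E \<theta> \<Longrightarrow> f * g \<in> tpol E \<theta>"
  unfolding tpol_def by (auto simp: pol_mult simp flip: pcompose_mult)

lemma tpol_const: "subfld E \<Longrightarrow> c \<in> E \<Longrightarrow> [:c:] \<in> tpol E \<theta>"
  unfolding tpol_def by (rule image_eqI[of _ _ "[:c:]"]) (auto intro: pol_pCons pol_0)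

lemma tpol_sum: "subfld E \<Longrightarrow> (\<And>i. i \<in> A \<Longrightarrow> f i \<in> tpol E \<theta>) \<Longrightarrow> sum f A \<in> tpol E \<theta>"
  using tpol_const[of E 0 \<theta>]
  by (induction A rule: infinite_finite_induct) (auto simp: tpol_add subfld_0)

lemma tpol_power: "subfld E \<Longrightarrow> f \<in> tpol E \<theta> \<Longrightarrow> f ^ n \<in> tpol E \<theta>"
  using tpol_const[of E 1 \<theta>] by (induction n) (auto simp: tpol_mult subfld_1 one_pCons)

text \<open>The minimal polynomial T^p - \<theta>^p takes the value t^p at \<theta> + t, so nonzero
  elements of E[\<theta> + t] have order divisible by p. The element \<open>\<eta>\<close> has order
  one and supplies the other orders.\<close>

locale arc =
  fixes p :: nat and E :: "'o::field set" and \<theta> :: 'o and \<eta> :: "'o poly"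
  assumes p: "prime p" and char: "of_nat p = (0::'o)" and E: "subfld E"
    and \<theta>: "\<theta> ^ p \<in> E" "\<theta> \<notin> E"
    and \<eta>0: "coeff \<eta> 0 = 0" and \<eta>1: "coeff \<eta> 1 \<noteq> 0" and \<eta>p: "\<eta> ^ p \<in> tpol E \<theta>"
begin

abbreviation "\<tau> \<equiv> [:\<theta>, 1:]"

text \<open>The ring generated by \<open>\<eta>\<close> over E[\<theta> + t]. As
  \<open>\<eta> ^ p\<close> already lies in E[\<theta> + t], the powers below p suffice
  (\<open>arcs_term\<close>).\<close>

definition arcs :: "'o poly set" where
  "arcs = {\<Sum>j<p. pcompose (F j) \<tau> * \<eta> ^ j | F. \<forall>j. F j \<in> pol E}"

lemma p_pos: "p > 0"
  using p by (rule prime_gt_0_nat)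

lemma arcs_term: assumes "f \<in> tpol E \<theta>" shows "f * \<eta> ^ n \<in> arcs"
proof -
  have "f * (\<eta> ^ p) ^ (n div p) \<in> tpol E \<theta>" by (intro tpol_mult tpol_power E assms \<eta>p)
  then obtain g where g: "g \<in> pol E" "f * (\<eta> ^ p) ^ (n div p) = pcompose g \<tau>"
    by (auto simp: tpol_def)
  have "f * \<eta> ^ n = pcompose g \<tau> * \<eta> ^ (n mod p)"
    unfolding g(2)[symmetric] by (simp add: mult.assoc flip: power_mult power_add)
  also have "\<dots> = (\<Sum>j<p. if j = n mod p then pcompose g \<tau> * \<eta> ^ j else 0)"
    using p_pos by simp
  also have "\<dots> = (\<Sum>j<p. pcompose (if j = n mod p then g else 0) \<tau> * \<eta> ^ j)"
    by (rule sum.cong) auto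
  finally show ?thesis unfolding arcs_def using g(1) pol_0[OF E]
    by (intro CollectI exI[of _ "\<lambda>j. if j = n mod p then g else 0"]) auto
qed

lemma arcs_tpol: "f \<in> tpol E \<theta> \<Longrightarrow> f \<in> arcs"
  using arcs_term[of f 0] by simp

lemma arcs_\<eta>: "\<eta> \<in> arcs"
  using arcs_term[OF tpol_const[OF E subfld_1[OF E]], of 1] by (simp flip: one_pCons)

lemma arcs_add: assumes "f \<in> arcs" "g \<in> arcs" shows "f + g \<in> arcs"
proof -
  obtain F G where F: "\<forall>j. F j \<in> pol E" "f = (\<Sum>j<p. pcompose (F j) \<tau> * \<eta> ^ j)"
    and G: "\<forall>j. G j \<in> pol E" "g = (\<Sum>j<p. pcompose (G j) \<tau> * \<eta> ^ j)"
    using assms by (auto simp: arcs_def)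
  have "f + g = (\<Sum>j<p. pcompose (F j + G j) \<tau> * \<eta> ^ j)"
    by (simp add: F G pcompose_add distrib_right sum.distrib)
  moreover have "\<forall>j. F j + G j \<in> pol E" using F G pol_add[OF E] by simp
  ultimately show ?thesis unfolding arcs_def by (intro CollectI exI conjI)
qed

lemma arcs_sum: "(\<And>i. i \<in> A \<Longrightarrow> f i \<in> arcs) \<Longrightarrow> sum f A \<in> arcs"
  using arcs_tpol[OF tpol_const[OF E subfld_0[OF E]]]
  by (induction A rule: infinite_finite_induct) (auto simp: arcs_add)

lemma arcs_mult: assumes "f \<in> arcs" "g \<in> arcs" shows "f * g \<in> arcs"
proof -
  obtain F G where F: "\<forall>j. F j \<in> pol E" "f = (\<Sum>j<p. pcompose (F j) \<tau> * \<eta> ^ j)"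
    and G: "\<forall>j. G j \<in> pol E" "g = (\<Sum>j<p. pcompose (G j) \<tau> * \<eta> ^ j)"
    using assms by (auto simp: arcs_def)
  have "f * g = (\<Sum>i<p. \<Sum>j<p. (pcompose (F i) \<tau> * pcompose (G j) \<tau>) * \<eta> ^ (i + j))"
    by (simp add: F G sum_product power_add mult_ac)
  also have "\<dots> \<in> arcs" using F G E by (intro arcs_sum arcs_term tpol_mult tpol_I) auto
  finally show ?thesis .
qed

lemma arcs_ev:
  fixes x :: "'v \<Rightarrow> 'o poly"
  assumes "\<And>c. [:h c:] \<in> arcs" "f \<in> carrier (coord_ring B)" "\<And>v. v \<in> B \<Longrightarrow> x v \<in> arcs"
  shows "ev (\<lambda>c. [:h c:]) x f \<in> arcs"
proof -
  have 1: "1 \<in> arcs" using arcs_tpol[OF tpol_const[OF E subfld_1[OF E]]] by (simp add: one_pCons)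
  have pow: "y ^ n \<in> arcs" if "y \<in> arcs" for y n using that 1 by (induction n) (auto simp: arcs_mult)
  have prd: "prod y A \<in> arcs" if "\<And>i. i \<in> A \<Longrightarrow> y i \<in> arcs" for A and y :: "'v \<Rightarrow> 'o poly"
    using that 1 by (induction A rule: infinite_finite_induct) (auto simp: arcs_mult)
  show ?thesis unfolding ev_def mon_def
    by (intro arcs_sum arcs_mult assms(1) prd pow) (use assms in \<open>auto simp: CR_iff\<close>)
qed

lemma minpoly_shift: "pcompose (monom 1 p - [:\<theta> ^ p:]) \<tau> = monom 1 p"
proof -
  have "pcompose ([:- \<theta>, 1:] ^ p) \<tau> = pcompose [:- \<theta>, 1:] \<tau> ^ p"
    by (rule rhom_power[OF rhom_pcompose])
  also have "pcompose [:- \<theta>, 1:] \<tau> = monom 1 1" by (simp add: pcompose_pCons monom_altdef)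
  finally show ?thesis by (simp add: linear_power_char[OF p char] monom_power)
qed

text \<open>A polynomial vanishing at \<theta> is divisible by T^p - \<theta>^p, whose shift is t^p.
  The drop in degree drives the induction in \<open>common_lead\<close>.\<close>

lemma vanishing_factor:
  assumes "f \<in> pol E" "poly f \<theta> = 0"
  shows "\<exists>g\<in>pol E. pcompose f \<tau> = monom 1 p * pcompose g \<tau> \<and> (f = 0 \<longleftrightarrow> g = 0) \<and>
     (f \<noteq> 0 \<longrightarrow> degree g < degree f)"
proof -
  let ?m = "monom 1 p - [:\<theta> ^ p:]"
  have m: "?m \<in> pol E" using E \<theta> by (auto intro!: pol_diff pol_monom pol_pCons pol_0 subfld_1)
  have "?m \<noteq> 0" using degree_linear_power_char[OF p_pos, of "\<theta> ^ p"] p_pos by force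
  obtain q r where qr: "q \<in> pol E" "r \<in> pol E" "f = q * ?m + r" "r = 0 \<or> degree r < degree ?m"
    using pol_division[OF E m \<open>?m \<noteq> 0\<close> assms(1)] by blast
  have "poly r \<theta> = 0" using assms(2) unfolding qr(3) by (simp add: poly_monom)
  moreover have "degree r < p" using qr(4) p_pos degree_linear_power_char[OF p_pos, of "\<theta> ^ p"] by auto
  ultimately have "r = 0" using purely_inseparable_minpoly[OF p char E \<theta> qr(2)] by simp
  then have f: "f = q * ?m" using qr(3) by simp
  have "pcompose f \<tau> = monom 1 p * pcompose q \<tau>"
    unfolding f pcompose_mult minpoly_shift by (simp add: mult.commute)
  moreover have "f = 0 \<longleftrightarrow> q = 0" using f \<open>?m \<noteq> 0\<close> by simp
  moreover have "degree q < degree f" if "f \<noteq> 0"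
  proof -
    have "q \<noteq> 0" using that f by auto
    then have "degree f = degree q + degree ?m" unfolding f using \<open>?m \<noteq> 0\<close> by (rule degree_mult_eq)
    then show ?thesis using degree_linear_power_char[OF p_pos, of "\<theta> ^ p"] p_pos by simp
  qed
  ultimately show ?thesis using qr(1) by blast
qed

lemma \<eta>_factor: obtains \<omega> where "\<eta> = monom 1 1 * \<omega>" "poly \<omega> 0 = coeff \<eta> 1"
proof -
  obtain \<omega> where "\<eta> = pCons 0 \<omega>" using \<eta>0 by (cases \<eta>) auto
  then show ?thesis using that[of \<omega>] by (simp add: monom_altdef poly_0_coeff_0)
qed

text \<open>The valuations of the terms \<open>F\<^sub>j(\<tau>) \<eta>\<^sup>j\<close> are distinct modulo \<open>p\<close>, so that the ring of arcs is a
  totally ramified extension of \<open>E[\<tau>]\<close> whose residue field is still \<open>E(\<theta>)\<close>.\<close>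

lemma common_lead:
  assumes "finite Z" "\<And>s. s \<in> Z \<Longrightarrow> h s \<in> arcs" "s1 \<in> Z" "h s1 \<noteq> 0"
  shows "\<exists>N \<kappa> lm. \<kappa> \<noteq> 0 \<and> (\<exists>s\<in>Z. lm s \<noteq> 0) \<and>
    (\<forall>s\<in>Z. lm s \<in> (\<lambda>f. poly f \<theta>) ` pol E \<and> lead N (h s) (\<kappa> * lm s))"
proof -
  have *: "\<exists>N \<kappa> lm. \<kappa> \<noteq> 0 \<and> (\<exists>s\<in>Z. lm s \<noteq> 0) \<and>
    (\<forall>s\<in>Z. lm s \<in> (\<lambda>f. poly f \<theta>) ` pol E \<and> lead N (\<Sum>j<p. pcompose (F s j) \<tau> * \<eta> ^ j) (\<kappa> * lm s))"
    if "\<And>s j. s \<in> Z \<Longrightarrow> F s j \<in> pol E" "\<exists>s\<in>Z. \<exists>j<p. F s j \<noteq> 0"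
      "\<And>s j. s \<in> Z \<Longrightarrow> F s j = 0 \<or> degree (F s j) < n" for F n
    using that
  proof (induction n arbitrary: F)
    case 0
    then show ?case by blast
  next
    case (Suc n)
    define Q where "Q j \<longleftrightarrow> j < p \<and> (\<exists>s\<in>Z. poly (F s j) \<theta> \<noteq> 0)" for j
    show ?case
    proof (cases "\<exists>j. Q j")
      \<comment> \<open>All coefficients vanish at \<theta>: the whole family is divided by t^p, and
        the common order grows by p.\<close>
      case False
      define G where "G s j = (SOME g. g \<in> pol E \<and>
        (j < p \<longrightarrow> pcompose (F s j) \<tau> = monom 1 p * pcompose g \<tau> \<and> (F s j = 0 \<longleftrightarrow> g = 0)) \<and>
        (g = 0 \<or> degree g < n))" for s j
      have "\<exists>g. g \<in> pol E \<and> (j < p \<longrightarrow> pcompose (F s j) \<tau> = monom 1 p * pcompose g \<tau> \<and> (F s j = 0 \<longleftrightarrow> g = 0)) \<and>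
        (g = 0 \<or> degree g < n)" if sZ: "s \<in> Z" for s j
      proof (cases "j < p")
        case True
        then have "poly (F s j) \<theta> = 0" using False sZ by (auto simp: Q_def)
        then obtain g where "g \<in> pol E" "pcompose (F s j) \<tau> = monom 1 p * pcompose g \<tau>"
          "F s j = 0 \<longleftrightarrow> g = 0" "F s j \<noteq> 0 \<longrightarrow> degree g < degree (F s j)"
          using vanishing_factor[OF Suc.prems(1)[OF sZ]] by blast
        then show ?thesis using Suc.prems(3)[OF sZ, of j] by (intro exI[of _ g]) auto
      qed (use pol_0[OF E] in auto)
      from someI_ex[OF this] have G: "\<And>s j. s \<in> Z \<Longrightarrow> G s j \<in> pol E"
        "\<And>s j. s \<in> Z \<Longrightarrow> j < p \<Longrightarrow> pcompose (F s j) \<tau> = monom 1 p * pcompose (G s j) \<tau>"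
        "\<And>s j. s \<in> Z \<Longrightarrow> j < p \<Longrightarrow> F s j = 0 \<longleftrightarrow> G s j = 0"
        "\<And>s j. s \<in> Z \<Longrightarrow> G s j = 0 \<or> degree (G s j) < n"
        unfolding G_def[symmetric] by simp_all
      have "\<exists>s\<in>Z. \<exists>j<p. G s j \<noteq> 0" using Suc.prems(2) G(3) by auto
      from Suc.IH[OF G(1) this G(4)] obtain N \<kappa> lm where IH: "\<kappa> \<noteq> 0" "\<exists>s\<in>Z. lm s \<noteq> 0"
        "\<forall>s\<in>Z. lm s \<in> (\<lambda>f. poly f \<theta>) ` pol E \<and> lead N (\<Sum>j<p. pcompose (G s j) \<tau> * \<eta> ^ j) (\<kappa> * lm s)"
        by blast
      have "lead (p + N) (\<Sum>j<p. pcompose (F s j) \<tau> * \<eta> ^ j) (\<kappa> * lm s)" if "s \<in> Z" for s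
      proof -
        have "(\<Sum>j<p. pcompose (F s j) \<tau> * \<eta> ^ j) = monom 1 p * (\<Sum>j<p. pcompose (G s j) \<tau> * \<eta> ^ j)"
          by (simp add: G(2)[OF that] sum_distrib_left mult.assoc)
        moreover have "lead (p + N) (monom 1 p * (\<Sum>j<p. pcompose (G s j) \<tau> * \<eta> ^ j)) (\<kappa> * lm s)"
          by (rule lead_shift) (use IH(3) that in auto)
        ultimately show ?thesis by simp
      qed
      then show ?thesis using IH by blast
    next
      case True
      \<comment> \<open>The common order is the least exponent of \<open>\<eta>\<close> with a
        coefficient not vanishing at \<theta>. Terms with a smaller exponent have order at least p >
        \<open>N\<close>, those with a larger exponent \<open>j\<close> have order at least
        \<open>j\<close>.\<close>
      define N where "N = (LEAST j. Q j)"
      have "Q N" unfolding N_def using True by (rule LeastI_ex)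
      then have N: "N < p" "\<exists>s\<in>Z. poly (F s N) \<theta> \<noteq> 0" by (auto simp: Q_def)
      have small: "poly (F s j) \<theta> = 0" if "s \<in> Z" "j < N" for s j
        using not_less_Least[of j Q] that N(1) by (auto simp: N_def Q_def)
      obtain \<omega> where \<omega>: "\<eta> = monom 1 1 * \<omega>" "poly \<omega> 0 = coeff \<eta> 1" by (rule \<eta>_factor)
      have \<eta>j: "\<eta> ^ j = monom 1 j * \<omega> ^ j" for j
        by (simp add: \<omega>(1) power_mult_distrib monom_power)
      have "lead N (\<Sum>j<p. pcompose (F s j) \<tau> * \<eta> ^ j) (\<Sum>j<p. if j = N then coeff \<eta> 1 ^ N * poly (F s N) \<theta> else 0)"
        if s: "s \<in> Z" for s
      proof (rule lead_sum)
        fix j assume "j \<in> {..<p}"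
        consider "j < N" | "j = N" | "j > N" by linarith
        then show "lead N (pcompose (F s j) \<tau> * \<eta> ^ j)
          (if j = N then coeff \<eta> 1 ^ N * poly (F s N) \<theta> else 0)"
        proof cases
          case 1
          then obtain g where "pcompose (F s j) \<tau> = monom 1 p * pcompose g \<tau>"
            using vanishing_factor[OF Suc.prems(1)[OF s] small[OF s]] by blast
          then show ?thesis using 1 N(1) by (simp add: mult.assoc lead_monom_mult)
        next
          case 2
          then show ?thesis unfolding lead_def \<eta>j
            by (intro exI[of _ "\<omega> ^ N * pcompose (F s N) \<tau>"]) (simp add: \<omega>(2) poly_power poly_pcompose mult_ac)
        next
          case 3
          then show ?thesis using lead_monom_mult[of N j "\<omega> ^ j * pcompose (F s j) \<tau>"]
            by (simp add: \<eta>j mult_ac)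
        qed
      qed
      then have "lead N (\<Sum>j<p. pcompose (F s j) \<tau> * \<eta> ^ j) (coeff \<eta> 1 ^ N * poly (F s N) \<theta>)" if "s \<in> Z" for s
        using N(1) that by simp
      \<comment> \<open>The factor \<open>\<kappa>\<close> stems from \<open>\<eta>\<close> alone.
        It need not lie in E(\<theta>), but it is the same for the whole family.\<close>
      then show ?thesis using \<eta>1 N(2) Suc.prems(1)
        by (intro exI[of _ N] exI[of _ "coeff \<eta> 1 ^ N"] exI[of _ "\<lambda>s. poly (F s N) \<theta>"]) auto
    qed
  qed
  have "\<exists>F. (\<forall>j. F j \<in> pol E) \<and> h s = (\<Sum>j<p. pcompose (F j) \<tau> * \<eta> ^ j)" if "s \<in> Z" for s
    using assms(2)[OF that] by (auto simp: arcs_def)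
  then obtain F0 where F0: "\<And>s j. s \<in> Z \<Longrightarrow> F0 s j \<in> pol E"
      "\<And>s. s \<in> Z \<Longrightarrow> h s = (\<Sum>j<p. pcompose (F0 s j) \<tau> * \<eta> ^ j)"
    by metis
  define F where "F s j = (if j < p then F0 s j else 0)" for s j
  have F: "F s j \<in> pol E" "h s = (\<Sum>j<p. pcompose (F s j) \<tau> * \<eta> ^ j)" if "s \<in> Z" for s j
    using F0[OF that] pol_0[OF E] by (auto simp: F_def)
  have "\<exists>j<p. F s1 j \<noteq> 0"
  proof (rule ccontr)
    assume "\<not> ?thesis"
    then have "h s1 = 0" unfolding F(2)[OF assms(3)] by (intro sum.neutral) auto
    then show False using assms(4) by simp
  qed
  define n where "n = Suc (Max ((\<lambda>(s, j). degree (F s j)) ` (Z \<times> {..<p})))"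
  have "F s j = 0 \<or> degree (F s j) < n" if "s \<in> Z" for s j
  proof (cases "j < p")
    case True
    then have "degree (F s j) \<le> Max ((\<lambda>(s, j). degree (F s j)) ` (Z \<times> {..<p}))"
      using that assms(1) by (intro Max_ge) force+
    then show ?thesis by (simp add: n_def)
  qed (simp add: F_def)
  from *[of F, OF F(1) _ this] \<open>\<exists>j<p. F s1 j \<noteq> 0\<close> assms(3) F(2) show ?thesis
    by (metis (no_types, lifting))
qed

end

text \<open>The coordinates are freed one at a time: along each of them \<open>F\<close> is a
  polynomial with infinitely many zeros. Only restrictions to lines occur, so \<open>F\<close> may
  be the value of a form at a parametrized point.\<close>

lemma vanish_on_lines:
  fixes F :: "('i \<Rightarrow> 'o::idom) \<Rightarrow> 'o"
  assumes line: "\<And>x y. \<exists>q. \<forall>s. F (\<lambda>i. x i + s * y i) = poly q s"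
    and "infinite K" "finite J" and 0: "\<And>t. (\<And>i. i \<in> J \<Longrightarrow> t i \<in> K) \<Longrightarrow> F t = 0"
  shows "F t = 0"
proof -
  have "\<forall>t. (\<forall>i\<in>J - J'. t i \<in> K) \<longrightarrow> F t = 0" if "finite J'" for J'
    using that
  proof (induction J')
    case empty
    then show ?case using 0 by auto
  next
    case (insert j J')
    show ?case
    proof (intro allI impI)
      fix t assume t: "\<forall>i\<in>J - insert j J'. t i \<in> K"
      obtain q where q: "\<And>s. F (\<lambda>i. (t(j := 0)) i + s * (if i = j then 1 else 0)) = poly q s"
        using line[of "t(j := 0)" "\<lambda>i. if i = j then 1 else 0"] by blast
      have "(\<lambda>i. (t(j := 0)) i + s * (if i = j then 1 else 0)) = t(j := s)" for s by auto
      then have q: "F (t(j := s)) = poly q s" for s using q by simp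
      have "poly q s = 0" if "s \<in> K" for s
        using insert.IH t that by (subst q[symmetric]) auto
      then have "K \<subseteq> {s. poly q s = 0}" by auto
      then have "q = 0" using assms(2) poly_roots_finite finite_subset by blast
      then show "F t = 0" using q[of "t j"] by simp
    qed
  qed
  from this[OF assms(3)] show ?thesis by auto
qed

section \<open>The function field, and arcs through points over another field\<close>

context qform
begin

lemma frob_inj: "x ^ p = y ^ p \<Longrightarrow> x = y" for x y :: 'k
proof -
  assume "x ^ p = y ^ p"
  have "of_nat p = (0::'k)" using of_nat_CHAR[where ?'a = 'k] unfolding char .
  then have "(x - y) ^ p = 0"
    using \<open>x ^ p = y ^ p\<close> rhom_diff[OF rhom_frobenius[OF p], of x y] by simp
  then show ?thesis by simp
qed

text \<open>On a finite field Frobenius is onto, so - \<open>a v / a b0\<close> would be a p-th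
  power. That is a relation over F^p between two values of the form on basis vectors.\<close>

lemma infinite_k: "infinite (UNIV :: 'k set)"
proof
  assume "finite (UNIV :: 'k set)"
  then have "surj (\<lambda>x::'k. x ^ p)"
    by (rule finite_UNIV_inj_surj) (auto intro: injI frob_inj)
  obtain v where v: "v \<in> B" "v \<noteq> b0" using B1 b0 by auto
  obtain e where e: "- (a v / a b0) = e ^ p" using \<open>surj (\<lambda>x::'k. x ^ p)\<close> by (metis surjD)
  let ?e = "\<lambda>u. if u = v then 1 else if u = b0 then e else 0"
  have "(\<Sum>u\<in>B - {b0}. a u * ?e u ^ p) = (\<Sum>u\<in>B - {b0}. if u = v then a v else 0)"
    using p_pos by (intro sum.cong) (auto simp: zero_power)
  then have "(\<Sum>u\<in>B. a u * ?e u ^ p) = 0"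
    unfolding sum_b0 using v finB a_nz[OF b0] by (simp add: e[symmetric])
  then show False using kind v unfolding kindp_def by force
qed

lemma inj_kk: "inj (\<lambda>c::'k. kc (c ^ p))"
proof (rule injI)
  fix c d :: 'k assume "kc (c ^ p) = kc (d ^ p)"
  then have "kc (c ^ p - d ^ p) = 0" by (simp add: rhom_diff[OF rhom_kc])
  then show "c = d" using frob_inj[of c d] by (simp add: kc_eq_0_iff)
qed

lemma infinite_kk: "infinite kk"
  using finite_imageD[OF _ inj_kk] infinite_k by blast

sublocale L: graded_set "\<lambda>n. pev kc gx ` forms B n"
proof
  note h = rhom_pev[OF rhom_kc, of gx]
  show "0 \<in> pev kc gx ` forms B n" for n by (rule image_eqI[of _ _ 0]) (auto simp: rhom_0[OF h] forms_0)
  show "1 \<in> pev kc gx ` forms B 0" by (rule image_eqI[of _ _ 1]) (auto simp: rhom_1[OF h] forms_1)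
qed (auto simp: rhom_simps[OF rhom_pev[OF rhom_kc, of gx], symmetric] forms_add forms_uminus forms_mult)

text \<open>The function field of X in twisted form: the base field occurs in it as F^p.\<close>

definition Lf :: "'k gfield set" where
  "Lf = frac (\<lambda>n. pev kc gx ` forms B n)"

lemma subfld_Lf: "subfld Lf"
  unfolding Lf_def by (rule L.subfld_frac)

lemma LfI: "f \<in> forms B n \<Longrightarrow> g \<in> forms B n \<Longrightarrow> pev kc gx g \<noteq> 0 \<Longrightarrow> pev kc gx f / pev kc gx g \<in> Lf"
  unfolding Lf_def by (rule L.fracI) auto

lemma Lf_kc: "kc (c ^ p) \<in> Lf"
  using LfI[OF forms_const forms_1, of c]
  by (simp add: rhom_1[OF rhom_pev[OF rhom_kc]] ev_const[OF rhom_fp[OF rhom_kc]])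

lemma Lf_ratio: "v \<in> B \<Longrightarrow> w \<in> B \<Longrightarrow> gx v / gx w \<in> Lf"
  using LfI[OF forms_var[of v B] forms_var[of w B]] gx_nz[of w]
  by (simp add: ev_var[OF rhom_fp[OF rhom_kc]])

lemma Lf_common_denominator:
  assumes "finite S" "\<And>i. i \<in> S \<Longrightarrow> e i \<in> Lf"
  obtains n d u where "d \<in> forms B n" "pev kc gx d \<noteq> 0" "\<And>i. i \<in> S \<Longrightarrow> u i \<in> forms B n"
    "\<And>i. i \<in> S \<Longrightarrow> e i * pev kc gx d = pev kc gx (u i)"
proof -
  obtain n d u where du: "d \<in> pev kc gx ` forms B n" "d \<noteq> 0"
      "\<forall>i\<in>S. u i \<in> pev kc gx ` forms B n \<and> e i = u i / d"
    using L.common_denominator[OF assms(1), of e] assms(2) unfolding Lf_def by metis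
  then have "\<forall>i\<in>S. \<exists>f. f \<in> forms B n \<and> u i = pev kc gx f" by auto
  then obtain f where "\<forall>i\<in>S. f i \<in> forms B n \<and> u i = pev kc gx (f i)" by (rule bchoice[THEN exE])
  moreover obtain d' where "d' \<in> forms B n" "d = pev kc gx d'" using du(1) by auto
  ultimately show ?thesis using du by (intro that[of d' n f]) auto
qed

definition b1 :: 'v where "b1 = (SOME v. v \<in> B - {b0})"

lemma b1: "b1 \<in> B" "b1 \<noteq> b0"
proof -
  have "\<exists>v. v \<in> B - {b0}" using B1 b0 by auto
  then have "b1 \<in> B - {b0}" unfolding b1_def by (rule someI_ex)
  then show "b1 \<in> B" "b1 \<noteq> b0" by auto
qed

text \<open>The function field is \<open>Es\<close> with \<open>th\<close> adjoined, of degree p: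
  \<open>Es\<close> contains F^p and the ratios of all coordinates other than \<open>b0\<close>.
  Being part of \<open>E0\<close>, it keeps elements of F that are independent over F^p
  independent.\<close>

definition th :: "'k gfield" where "th = gx b0 / gx b1"
definition Es :: "'k gfield set" where "Es = Lf \<inter> E0"

lemma subfld_Es: "subfld Es"
  unfolding Es_def by (intro subfld_Int subfld_Lf subfld_E0)

lemma kk_Es: "kc (c ^ p) \<in> Es"
  by (simp add: Es_def Lf_kc kc_in_E0)

lemma th_not_Es: "th \<notin> Es"
proof
  assume "th \<in> Es"
  then have "th * gx b1 \<in> E0" using gx_in_E0[OF b1(2)] subfld_mult[OF subfld_E0] by (simp add: Es_def)
  then show False using gx_b0_not_E0 gx_nz[OF b1(1)] by (simp add: th_def)
qed

lemma th_power: "th ^ p \<in> Es"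
proof -
  have "th ^ p \<in> Lf" unfolding th_def by (intro subfld_power subfld_Lf Lf_ratio b0 b1)
  moreover have "gx b0 ^ p \<in> E0" unfolding gx_b0_power
    by (intro subfld_closed subfld_E0 kc_in_E0 gx_in_E0) auto
  then have "th ^ p \<in> E0" unfolding th_def power_divide
    by (rule subfld_divide[OF subfld_E0 _ subfld_power[OF subfld_E0 gx_in_E0[OF b1(2)]]])
  ultimately show ?thesis by (simp add: Es_def)
qed

text \<open>A quotient of forms of degree n is unchanged when both are divided by
  \<open>gx b1 ^ n\<close>. They become polynomials in the ratios \<open>gx v / gx b1\<close>, and
  all of these except \<open>th\<close> lie in \<open>Es\<close>.\<close>

lemma Lf_adjoin: "Lf = (\<lambda>f. poly f th) ` pol Es"
proof
  let ?L = "(\<lambda>f. poly f th) ` pol Es"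
  have L: "subfld ?L" by (rule subfld_adjoin_root[OF p of_nat_p_gfield subfld_Es th_power])
  have Es: "c \<in> ?L" if "c \<in> Es" for c
    using that pol_pCons[OF subfld_Es that pol_0[OF subfld_Es]] by (intro image_eqI[of _ _ "[:c:]"]) auto
  have "th \<in> ?L"
    using pol_pCons[OF subfld_Es subfld_0[OF subfld_Es] pol_1[OF subfld_Es]]
    by (intro image_eqI[of _ _ "pCons 0 1"]) auto
  have ratio: "gx v / gx b1 \<in> ?L" if "v \<in> B" for v
  proof (cases "v = b0")
    case True
    then show ?thesis using \<open>th \<in> ?L\<close> by (simp add: th_def)
  next
    case False
    then have "gx v / gx b1 \<in> E0" by (intro subfld_divide subfld_E0 gx_in_E0 b1)
    then show ?thesis using Lf_ratio[OF that b1(1)] by (intro Es) (simp add: Es_def)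
  qed
  have q: "pev kc gx f / gx b1 ^ n \<in> ?L" if "f \<in> forms B n" for f n
  proof -
    have "pev kc (\<lambda>v. inverse (gx b1) * gx v) f \<in> ?L"
      using ratio by (intro subfld_ev[OF L Es[OF kk_Es] forms_CR[OF that]]) (simp add: divide_inverse mult.commute)
    then show ?thesis unfolding ev_forms_scale[OF that] by (simp add: divide_inverse mult.commute power_inverse)
  qed
  then have *: "(pev kc gx f / gx b1 ^ n) / (pev kc gx g / gx b1 ^ n) \<in> ?L"
    if "f \<in> forms B n" "g \<in> forms B n" for f g n using that by (intro subfld_divide[OF L q])
  show "Lf \<subseteq> ?L"
    unfolding Lf_def
  proof (rule subsetI, elim L.fracE)
    fix x f g n assume "f \<in> pev kc gx ` forms B n" "g \<in> pev kc gx ` forms B n" "x = f / g"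
    then show "x \<in> ?L" using * gx_nz[OF b1(1)] by auto
  qed
  have "th \<in> Lf" unfolding th_def by (rule Lf_ratio[OF b0 b1(1)])
  moreover have "pol Es \<subseteq> pol Lf" by (auto simp: pol_def Es_def)
  ultimately show "?L \<subseteq> Lf" using pol_poly[OF subfld_Lf] by auto
qed

text \<open>F^p is infinite, so its points are dense in the space of free coordinates. The
  coordinate \<open>b0\<close> is determined by the equation and need not lie in F^p.\<close>

lemma kk_point:
  assumes "f \<in> carrier R" "pev kc gx f \<noteq> 0"
  obtains z where "(\<Sum>v\<in>B. kc (a v) * z v) = 0" "\<And>v. v \<noteq> b0 \<Longrightarrow> v \<in> B \<Longrightarrow> z v \<in> kk" "pev kc z f \<noteq> 0"
proof -
  define z where "z t v = (if v = b0 then - (\<Sum>u\<in>B - {b0}. kc (a u) * t u) / kc (a b0) else t v)"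
    for t :: "'v \<Rightarrow> 'k gfield" and v
  have rel: "(\<Sum>v\<in>B. kc (a v) * z t v) = 0" for t
    unfolding sum_b0 using a_nz[OF b0] by (simp add: z_def kc_eq_0_iff)
  have lin: "z (\<lambda>i. x i + s * y i) v = z x v + s * z y v" for x y s v
    by (simp add: z_def distrib_left sum.distrib sum_distrib_left mult_ac add_divide_distrib diff_divide_distrib)
  have "z gx v = gx v" if "v \<in> B" for v
  proof -
    have "kc (a b0) * gx b0 = - (\<Sum>v\<in>B - {b0}. kc (a v) * gx v)"
      using gx_rel unfolding sum_b0 by (simp add: eq_neg_iff_add_eq_0)
    then show ?thesis using a_nz[OF b0] by (simp add: z_def field_simps kc_eq_0_iff)
  qed
  then have nz: "pev kc (z gx) f \<noteq> 0" using assms ev_CR_cong[OF assms(1)] by metis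
  have "\<exists>t. (\<forall>v\<in>B - {b0}. t v \<in> kk) \<and> pev kc (z t) f \<noteq> 0"
  proof (rule ccontr)
    assume *: "\<not> ?thesis"
    have "pev kc (z gx) f = 0"
    proof (rule vanish_on_lines[of "\<lambda>t. pev kc (z t) f" kk "B - {b0}"])
      show "\<exists>q. \<forall>s. pev kc (z (\<lambda>i. x i + s * y i)) f = poly q s" for x y
        unfolding lin by (rule ev_line[OF rhom_fp[OF rhom_kc]])
      show "finite (B - {b0})" using finB by simp
      show "pev kc (z t) f = 0" if "\<And>i. i \<in> B - {b0} \<Longrightarrow> t i \<in> kk" for t
        using * that by blast
    qed (rule infinite_kk)
    then show False using nz by simp
  qed
  then obtain t where "\<forall>v\<in>B - {b0}. t v \<in> kk" "pev kc (z t) f \<noteq> 0" by blast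
  then show ?thesis using rel by (intro that[of "z t"]) (auto simp: z_def)
qed

lemma coeff_1_pcompose: "coeff (pcompose f [:\<theta>, 1:]) 1 = poly (pderiv f) \<theta>" for \<theta> :: "'k gfield"
proof -
  have "coeff (pcompose f [:\<theta>, 1:]) 1 = poly (pderiv (pcompose f [:\<theta>, 1:])) 0"
    by (simp add: poly_0_coeff_0 coeff_pderiv)
  then show ?thesis by (simp add: pderiv_pcompose poly_pcompose pderiv_pCons)
qed

text \<open>A nonzero relation of least degree in \<theta> is chosen. If its derivatives also
  satisfied the equation, minimality would make them zero; as degrees are below p, the relation
  would be constant, against independence over \<open>E0\<close>. The resulting point may differ
  from \<open>y\<close>.\<close>

lemma minimal_relation:
  assumes E: "subfld E" "E \<subseteq> E0" and \<theta>: "\<theta> ^ p \<in> E"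
    and y: "\<And>v. v \<in> B \<Longrightarrow> y v \<in> (\<lambda>f. poly f \<theta>) ` pol E" "\<exists>v\<in>B. y v \<noteq> 0" "(\<Sum>v\<in>B. kc (a v) * y v) = 0"
  obtains Y where "\<And>v. v \<in> B \<Longrightarrow> Y v \<in> pol E" "(\<Sum>v\<in>B. kc (a v) * poly (Y v) \<theta>) = 0"
    "(\<Sum>v\<in>B. kc (a v) * poly (pderiv (Y v)) \<theta>) \<noteq> 0"
proof -
  define Q where "Q n \<longleftrightarrow> (\<exists>Y. (\<forall>v\<in>B. Y v \<in> pol E \<and> degree (Y v) \<le> n) \<and> (\<exists>v\<in>B. Y v \<noteq> 0) \<and>
    (\<Sum>v\<in>B. kc (a v) * poly (Y v) \<theta>) = 0)" for n
  have "\<forall>v\<in>B. \<exists>f. f \<in> pol E \<and> degree f < p \<and> poly f \<theta> = y v"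
  proof
    fix v assume "v \<in> B"
    then obtain f where "f \<in> pol E" "y v = poly f \<theta>" using y(1) by blast
    then show "\<exists>f. f \<in> pol E \<and> degree f < p \<and> poly f \<theta> = y v"
      using adjoin_root_reduce[OF p E(1) \<theta>] by metis
  qed
  then obtain Y0 where Y0: "\<forall>v\<in>B. Y0 v \<in> pol E \<and> degree (Y0 v) < p \<and> poly (Y0 v) \<theta> = y v"
    by (rule bchoice[THEN exE])
  then have "Q (p - 1)" unfolding Q_def using y(2,3)
    by (intro exI[of _ Y0]) (force simp: Suc_leI less_Suc_eq_le[symmetric] p_pos)
  define n where "n = (LEAST n. Q n)"
  have "Q n" "n \<le> p - 1" unfolding n_def using \<open>Q (p - 1)\<close> by (auto intro: LeastI Least_le)
  have small: "\<not> Q m" if "m < n" for m using that not_less_Least unfolding n_def by blast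
  obtain Y where Y: "\<And>v. v \<in> B \<Longrightarrow> Y v \<in> pol E" "\<And>v. v \<in> B \<Longrightarrow> degree (Y v) \<le> n"
    "\<exists>v\<in>B. Y v \<noteq> 0" "(\<Sum>v\<in>B. kc (a v) * poly (Y v) \<theta>) = 0"
    using \<open>Q n\<close> unfolding Q_def by auto
  have "n \<noteq> 0"
  proof
    assume "n = 0"
    then have c: "Y v = [:coeff (Y v) 0:]" if "v \<in> B" for v
      using Y(2)[OF that] by (metis degree_eq_zeroE coeff_pCons_0 le_zero_eq)
    have "poly (Y v) \<theta> = coeff (Y v) 0" if "v \<in> B" for v
      by (subst c[OF that]) simp
    then have "(\<Sum>v\<in>B. kc (a v) * coeff (Y v) 0) = 0" using Y(4) by simp
    then have c0: "coeff (Y v) 0 = 0" if "v \<in> B" for v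
      using indpD[OF indp_E0[OF finB kind], of "\<lambda>v. coeff (Y v) 0" v] Y(1) E(2) that by (auto simp: pol_def)
    have "Y v = 0" if "v \<in> B" for v by (subst c[OF that]) (simp add: c0[OF that])
    then show False using Y(3) by auto
  qed
  have "(\<Sum>v\<in>B. kc (a v) * poly (pderiv (Y v)) \<theta>) \<noteq> 0"
  proof
    assume 0: "(\<Sum>v\<in>B. kc (a v) * poly (pderiv (Y v)) \<theta>) = 0"
    have d: "degree (pderiv (Y v)) \<le> n - 1" if "v \<in> B" for v
      by (rule degree_le) (use Y(2)[OF that] in \<open>auto simp: coeff_pderiv coeff_eq_0\<close>)
    have pd: "pderiv (Y v) = 0" if "v \<in> B" for v
    proof (rule ccontr)
      assume "pderiv (Y v) \<noteq> 0"
      then have "Q (n - 1)" unfolding Q_def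
        by (intro exI[of _ "\<lambda>v. pderiv (Y v)"] conjI ballI bexI[of _ v] d 0 that pol_pderiv[OF E(1)] Y(1))
      then show False using small[of "n - 1"] \<open>n \<noteq> 0\<close> by simp
    qed
    have "coeff (Y v) i = 0" if "v \<in> B" "i \<noteq> 0" for v i
    proof (cases "i \<le> n")
      case True
      have "coeff (pderiv (Y v)) (i - 1) = of_nat i * coeff (Y v) i"
        using \<open>i \<noteq> 0\<close> by (simp add: coeff_pderiv)
      moreover have "of_nat i \<noteq> (0 :: 'k gfield)"
        using True \<open>n \<le> p - 1\<close> \<open>i \<noteq> 0\<close> p_pos CHAR_eq_prime[OF p of_nat_p_gfield]
        by (auto simp: of_nat_eq_0_iff_char_dvd dest: dvd_imp_le)
      ultimately show ?thesis using pd[OF that(1)] by simp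
    next
      case False
      then show ?thesis using Y(2)[OF that(1)] by (simp add: coeff_eq_0)
    qed
    then have "degree (Y v) \<le> 0" if "v \<in> B" for v using that by (intro degree_le) auto
    then have "Q 0" unfolding Q_def using Y by blast
    then show False using small \<open>n \<noteq> 0\<close> by auto
  qed
  then show ?thesis using that Y by blast
qed

text \<open>The form plays the role of Y, and E(\<theta>) that of the function field of X. The arc
  starts at a multiple of an E(\<theta>)-point and leaves the zero set of \<open>f s1\<close>. All
  its coordinates except \<open>b0\<close> lie in E[\<theta> + t]; the coordinate \<open>b0\<close>
  gives rise to \<open>\<eta>\<close>.\<close>

lemma arc_family:
  fixes E :: "'k gfield set" and f :: "'s \<Rightarrow> ('v, 'k) mpoly"
  assumes E: "subfld E" "E \<subseteq> E0" "\<And>c. kc (c ^ p) \<in> E" and \<theta>: "\<theta> ^ p \<in> E" "\<theta> \<notin> E"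
    and y: "\<And>v. v \<in> B \<Longrightarrow> y v \<in> (\<lambda>f. poly f \<theta>) ` pol E" "\<exists>v\<in>B. y v \<noteq> 0" "(\<Sum>v\<in>B. kc (a v) * y v) = 0"
    and f: "finite Z" "\<And>s. s \<in> Z \<Longrightarrow> f s \<in> carrier R" "s1 \<in> Z" "f s1 \<in> forms B n" "pev kc gx (f s1) \<noteq> 0"
  obtains ys N \<kappa> lm where "(\<Sum>v\<in>B. [:kc (a v):] * ys v) = 0" "\<kappa> \<noteq> 0" "\<exists>s\<in>Z. lm s \<noteq> 0"
    "\<And>s. s \<in> Z \<Longrightarrow> lm s \<in> (\<lambda>f. poly f \<theta>) ` pol E"
    "\<And>s. s \<in> Z \<Longrightarrow> lead N (pev (\<lambda>c. [:kc c:]) ys (f s)) (\<kappa> * lm s)"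
proof -
  let ?C = "\<lambda>c. [:kc c:]"
  have C: "rhom ?C" by (rule rhom_comp[OF rhom_kc rhom_pCons])
  obtain Y where Y: "\<And>v. v \<in> B \<Longrightarrow> Y v \<in> pol E" "(\<Sum>v\<in>B. kc (a v) * poly (Y v) \<theta>) = 0"
    "(\<Sum>v\<in>B. kc (a v) * poly (pderiv (Y v)) \<theta>) \<noteq> 0"
    using minimal_relation[OF E(1,2) \<theta>(1) y] by blast
  obtain w where w: "(\<Sum>v\<in>B. kc (a v) * w v) = 0" "\<And>v. v \<noteq> b0 \<Longrightarrow> v \<in> B \<Longrightarrow> w v \<in> kk"
    "pev kc w (f s1) \<noteq> 0" using kk_point[OF forms_CR[OF f(4)] f(5)] by blast
  let ?\<tau> = "[:\<theta>, 1:]" and ?b = "inverse (kc (a b0))"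
  have b: "?b * kc (a b0) = 1" using a_nz[OF b0] by (simp add: kc_eq_0_iff)
  define Yt where "Yt v = pcompose (Y v) ?\<tau>" for v
  \<comment> \<open>The defect of the shifted point in the linear equation. By the choice of
    \<open>Y\<close> it vanishes at t = 0 to order exactly one.\<close>
  define \<beta> where "\<beta> = (\<Sum>v\<in>B. [:kc (a v):] * Yt v)"
  \<comment> \<open>The whole correction goes into the coordinate \<open>b0\<close>, so that the
    other coordinates stay in E[\<theta> + t].\<close>
  define yo where "yo v = Yt v - (if v = b0 then [:?b:] * \<beta> else 0)" for v
  have "(\<Sum>v\<in>B. [:kc (a v):] * yo v)
    = \<beta> - (\<Sum>v\<in>B. if v = b0 then ([:kc (a b0):] * [:?b:]) * \<beta> else 0)"
    unfolding \<beta>_def yo_def right_diff_distrib sum_subtractf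
    by (intro arg_cong2[of _ _ _ _ "(-)"] sum.cong refl) (auto simp: mult_ac)
  also have "\<dots> = \<beta> - ([:kc (a b0):] * [:?b:]) * \<beta>" using finB b0 by simp
  finally have yo_rel: "(\<Sum>v\<in>B. [:kc (a v):] * yo v) = 0"
    using b by (simp add: mult.commute)
  \<comment> \<open>The term in t^p brings in \<open>w\<close>, where \<open>f s1\<close> does not
    vanish. It leaves the orders 0 and 1 in t alone, since p > 1.\<close>
  define Y2 where "Y2 \<mu> v = monom (w v) p + \<mu> * yo v" for \<mu> v
  have rel: "(\<Sum>v\<in>B. [:kc (a v):] * Y2 \<mu> v) = 0" for \<mu>
  proof -
    have "(\<Sum>v\<in>B. [:kc (a v):] * Y2 \<mu> v)
      = monom (\<Sum>v\<in>B. kc (a v) * w v) p + \<mu> * (\<Sum>v\<in>B. [:kc (a v):] * yo v)"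
      unfolding Y2_def
      by (simp add: distrib_left sum.distrib sum_distrib_left monom_sum smult_monom mult.left_commute[of "[:_:]"]
          del: mult_pCons_left) (simp add: smult_monom)
    then show ?thesis using w(1) yo_rel by simp
  qed
  obtain q where q: "\<And>\<mu>. pev ?C (Y2 \<mu>) (f s1) = poly q \<mu>"
    using ev_line[OF rhom_fp[OF C], of "\<lambda>v. monom (w v) p" yo "f s1"] unfolding Y2_def by blast
  \<comment> \<open>At \<mu> = 0 the arc is t^p times \<open>w\<close>. Hence \<open>q\<close> is a
    nonzero polynomial, and only finitely many \<mu> are excluded.\<close>
  have "Y2 0 = (\<lambda>v. monom 1 p * [:w v:])" by (auto simp: Y2_def monom_altdef smult_monom)
  then have "poly q 0 = monom 1 p ^ n * pev ?C (\<lambda>v. [:w v:]) (f s1)"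
    unfolding q[symmetric] by (simp only: ev_forms_scale[OF f(4)])
  also have "pev ?C (\<lambda>v. [:w v:]) (f s1) = [:pev kc w (f s1):]"
    by (simp add: rhom_after_ev[OF rhom_pCons])
  finally have "poly q 0 \<noteq> 0" using w(3) by (simp add: monom_eq_0_iff)
  then have "finite {\<mu>. poly q \<mu> = 0}" by (intro poly_roots_finite) auto
  then have "finite ((\<lambda>c. ?C (c ^ p)) -` {\<mu>. poly q \<mu> = 0})"
    using inj_kk by (intro finite_vimageI) (auto simp: inj_def)
  then have fin: "finite ((\<lambda>c. ?C (c ^ p)) -` {\<mu>. poly q \<mu> = 0} \<union> {0})" by simp
  obtain c where "c \<notin> (\<lambda>c. ?C (c ^ p)) -` {\<mu>. poly q \<mu> = 0} \<union> {0}"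
    using ex_new_if_finite[OF infinite_k fin] by (elim exE)
  then have c: "c \<noteq> 0" "poly q (?C (c ^ p)) \<noteq> 0" by auto
  \<comment> \<open>A p-th power, in order to lie in \<open>E\<close>; nonzero, in order that
    \<open>\<eta>\<close> has order one.\<close>
  define \<mu> where "\<mu> = kc (c ^ p)"
  have \<mu>: "\<mu> \<in> E" "\<mu> \<noteq> 0" using E(3) c(1) by (auto simp: \<mu>_def kc_eq_0_iff)
  define ys where "ys = Y2 [:\<mu>:]"
  \<comment> \<open>What remains of the coordinate \<open>b0\<close> when its part in
    E[\<theta> + t] is removed.\<close>
  define \<eta> where "\<eta> = ys b0 - [:\<mu>:] * Yt b0"
  have \<eta>: "\<eta> = monom (w b0) p - [:\<mu> * ?b:] * \<beta>"
    by (simp add: \<eta>_def ys_def Y2_def yo_def algebra_simps)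
  have \<beta>: "coeff \<beta> 0 = 0" "coeff \<beta> 1 \<noteq> 0"
  proof -
    have "coeff \<beta> 0 = (\<Sum>v\<in>B. kc (a v) * poly (Y v) \<theta>)"
      by (simp add: \<beta>_def Yt_def poly_sum poly_pcompose flip: poly_0_coeff_0)
    then show "coeff \<beta> 0 = 0" using Y(2) by simp
    have "coeff \<beta> 1 = (\<Sum>v\<in>B. kc (a v) * poly (pderiv (Y v)) \<theta>)"
      using coeff_1_pcompose by (simp add: \<beta>_def Yt_def coeff_sum)
    then show "coeff \<beta> 1 \<noteq> 0" using Y(3) by simp
  qed
  have p1: "p > 1" using p by (rule prime_gt_1_nat)
  have m: "monom 1 p \<in> tpol E \<theta>"
  proof -
    have "pcompose ([:- \<theta>, 1:] ^ p) ?\<tau> = pcompose [:- \<theta>, 1:] ?\<tau> ^ p"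
      by (rule rhom_power[OF rhom_pcompose])
    also have "\<dots> = monom 1 p" by (simp add: pcompose_pCons monom_altdef)
    finally have "monom 1 p = pcompose (monom 1 p - [:\<theta> ^ p:]) ?\<tau>"
      by (simp add: linear_power_char[OF p of_nat_p_gfield])
    moreover have "monom 1 p - [:\<theta> ^ p:] \<in> pol E"
      using E \<theta> by (auto intro!: pol_diff pol_monom pol_pCons pol_0 subfld_1)
    ultimately show ?thesis using tpol_I by metis
  qed
  have ys_t: "ys v \<in> tpol E \<theta>" if "v \<in> B" "v \<noteq> b0" for v
  proof -
    have "w v \<in> E" using w(2)[OF that(2,1)] E(3) by (elim rangeE) simp
    then have "[:w v:] * monom 1 p + [:\<mu>:] * Yt v \<in> tpol E \<theta>"
      unfolding Yt_def by (intro tpol_add tpol_mult tpol_const tpol_I E m \<mu> Y that)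
    moreover have "ys v = [:w v:] * monom 1 p + [:\<mu>:] * Yt v"
      using that by (simp add: ys_def Y2_def yo_def smult_monom)
    ultimately show ?thesis by simp
  qed
  have V: "[:\<mu>:] * Yt b0 \<in> tpol E \<theta>"
    unfolding Yt_def by (intro tpol_mult tpol_const tpol_I E \<mu> Y b0)
  have "ys b0 = (\<Sum>u\<in>B - {b0}. [:kc (- a u / a b0):] * ys u)"
  proof -
    have k: "kc (- a u / a b0) = - (?b * kc (a u))" for u
    proof -
      have "kc (- a u / a b0) = kc (- a u) * kc (inverse (a b0))"
        by (simp add: divide_inverse flip: rhom_mult[OF rhom_kc])
      moreover have "kc (inverse (a b0)) = ?b"
        using a_nz[OF b0] by (intro inverse_unique[symmetric])
          (simp add: rhom_1[OF rhom_kc] flip: rhom_mult[OF rhom_kc])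
      ultimately show ?thesis by (simp add: rhom_uminus[OF rhom_kc] mult.commute)
    qed
    have "[:?b:] * (\<Sum>v\<in>B. [:kc (a v):] * ys v) = 0" using rel by (simp add: ys_def)
    then have "ys b0 + (\<Sum>u\<in>B - {b0}. [:?b * kc (a u):] * ys u) = 0"
      unfolding sum_b0 distrib_left sum_distrib_left mult.assoc[symmetric]
      using b by (simp add: mult.commute)
    then show ?thesis unfolding k by (simp add: eq_neg_iff_add_eq_0 sum_negf)
  qed
  \<comment> \<open>The p-th power of the solved equation has coefficients in F^p, hence in
    \<open>E\<close>.\<close>
  then have "ys b0 ^ p = (\<Sum>u\<in>B - {b0}. ([:kc (- a u / a b0):] * ys u) ^ p)"
    by (simp only: rhom_sum[OF frob_gfield_poly])
  also have "\<dots> = (\<Sum>u\<in>B - {b0}. [:kc ((- a u / a b0) ^ p):] * ys u ^ p)"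
    by (simp only: power_mult_distrib poly_const_pow rhom_power[OF rhom_kc])
  also have "\<dots> \<in> tpol E \<theta>" by (intro tpol_sum tpol_mult tpol_power tpol_const E ys_t) auto
  finally have ysp: "ys b0 ^ p \<in> tpol E \<theta>" .
  have "\<eta> ^ p = ys b0 ^ p + [:- 1:] * ([:\<mu>:] * Yt b0) ^ p"
    unfolding \<eta>_def by (simp add: rhom_diff[OF frob_gfield_poly])
  also have "\<dots> \<in> tpol E \<theta>"
    by (rule tpol_add[OF E(1) ysp tpol_mult[OF E(1) tpol_const[OF E(1)] tpol_power[OF E(1) V]]])
       (intro subfld_closed E)
  finally have \<eta>p: "\<eta> ^ p \<in> tpol E \<theta>" .
  note kkE = E(3)
  interpret arc p E \<theta> \<eta>
  proof
    show "coeff \<eta> 0 = 0" using \<beta>(1) p_pos by (simp add: \<eta>)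
    show "coeff \<eta> 1 \<noteq> 0" using \<beta>(2) \<mu> p1 a_nz[OF b0] by (simp add: \<eta> kc_eq_0_iff)
  qed (use p of_nat_p_gfield E \<theta> \<eta>p in auto)
  have ys_arc: "ys v \<in> arcs" if "v \<in> B" for v
  proof (cases "v = b0")
    case True
    have "ys b0 = [:\<mu>:] * Yt b0 + \<eta>" by (simp add: \<eta>_def)
    then show ?thesis using True arcs_add[OF arcs_tpol[OF V] arcs_\<eta>] by simp
  qed (use ys_t that arcs_tpol in auto)
  have m1: "pev ?C ys (f s) \<in> arcs" if "s \<in> Z" for s
    by (rule arcs_ev[OF _ f(2)[OF that] ys_arc]) (rule arcs_tpol[OF tpol_const[OF E kkE]])
  have m2: "pev ?C ys (f s1) \<noteq> 0" using c(2) unfolding q[symmetric] by (simp add: ys_def \<mu>_def)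
  obtain N \<kappa> lm where o: "\<kappa> \<noteq> 0" "\<exists>s\<in>Z. lm s \<noteq> 0"
    "\<forall>s\<in>Z. lm s \<in> (\<lambda>f. poly f \<theta>) ` pol E \<and> lead N (pev ?C ys (f s)) (\<kappa> * lm s)"
    using common_lead[of Z "\<lambda>s. pev ?C ys (f s)", OF f(1) m1 f(3) m2] by blast
  show ?thesis by (rule that[OF rel[of "[:\<mu>:]", folded ys_def] o(1,2)]) (use o(3) in auto)
qed

end

section \<open>Linear algebra over subfields\<close>

lemma indp_unique:
  assumes "subfld T" "indp T c S" "\<And>i. i \<in> S \<Longrightarrow> u i \<in> T" "\<And>i. i \<in> S \<Longrightarrow> v i \<in> T"
    and "(\<Sum>i\<in>S. c i * u i) = (\<Sum>i\<in>S. c i * v i)" "i \<in> S"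
  shows "u i = v i"
proof -
  have "u i - v i = 0"
    by (rule indpD[OF assms(2), of "\<lambda>i. u i - v i"])
       (use assms in \<open>auto simp: subfld_diff right_diff_distrib sum_subtractf\<close>)
  then show ?thesis by simp
qed

lemma dependent_combination:
  assumes T: "subfld T" and P: "finite P" "indp T c P" and i: "i \<notin> P" "\<not> indp T c (insert i P)"
  shows "\<exists>m. (\<forall>l\<in>P. m l \<in> T) \<and> c i = (\<Sum>l\<in>P. c l * m l)"
proof -
  obtain e where e: "\<forall>j\<in>insert i P. e j \<in> T" "(\<Sum>j\<in>insert i P. c j * e j) = 0"
    "\<exists>j\<in>insert i P. e j \<noteq> 0"
    using i(2) unfolding indp_def by blast
  have s: "c i * e i + (\<Sum>j\<in>P. c j * e j) = 0" using e(2) P(1) i(1) by simp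
  have "e i \<noteq> 0"
  proof
    assume "e i = 0"
    then have "e j = 0" if "j \<in> P" for j
      by (intro indpD[OF P(2), of e]) (use s e(1) that in auto)
    then show False using e(3) \<open>e i = 0\<close> by auto
  qed
  have "c i * e i = - (\<Sum>j\<in>P. c j * e j)" using s by (simp add: eq_neg_iff_add_eq_0)
  then have "c i = - (\<Sum>j\<in>P. c j * e j) / e i"
    using nonzero_eq_divide_eq[OF \<open>e i \<noteq> 0\<close>] by blast
  then have "c i = (\<Sum>l\<in>P. c l * (- e l / e i))"
    by (simp add: sum_divide_distrib sum_negf)
  moreover have "\<forall>l\<in>P. - e l / e i \<in> T" using e(1) T by (auto intro!: subfld_closed)
  ultimately show ?thesis by (intro exI[of _ "\<lambda>l. - e l / e i"] conjI)
qed

lemma maximal_indp: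
  assumes "finite B"
  obtains P where "P \<subseteq> B" "indp T c P" "\<And>i. i \<in> B - P \<Longrightarrow> \<not> indp T c (insert i P)"
proof -
  have "indp T c {}" by (simp add: indp_def)
  then have "\<exists>P. (P \<subseteq> B \<and> indp T c P) \<and> (\<forall>P'. P' \<subseteq> B \<and> indp T c P' \<longrightarrow> card P' \<le> card P)"
    by (intro ex_has_greatest_nat[of _ "{}" _ "Suc (card B)"])
       (use card_mono[OF assms] in \<open>auto simp: less_Suc_eq_le\<close>)
  then obtain P where P: "P \<subseteq> B" "indp T c P" "\<And>P'. P' \<subseteq> B \<Longrightarrow> indp T c P' \<Longrightarrow> card P' \<le> card P"
    by blast
  have "\<not> indp T c (insert i P)" if "i \<in> B - P" for i
  proof
    assume "indp T c (insert i P)"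
    then have "card (insert i P) \<le> card P" using P that by auto
    then show False using that finite_subset[OF P(1) assms] by simp
  qed
  then show ?thesis using that P by blast
qed

text \<open>Elimination: an equation with a nonzero coefficient at \<open>k0\<close> is solved for
  that unknown, which removes one equation and one unknown.\<close>

lemma homogeneous_system:
  fixes M :: "'e \<Rightarrow> 'i \<Rightarrow> 'o::field"
  assumes "finite Eq" "finite K" "card Eq < card K"
  shows "\<exists>c. (\<exists>k\<in>K. c k \<noteq> 0) \<and> (\<forall>v\<in>Eq. (\<Sum>k\<in>K. c k * M v k) = 0)"
  using assms
proof (induction Eq arbitrary: K M rule: finite_induct)
  case empty
  then obtain k where "k \<in> K" by fastforce
  then show ?case by (intro exI[of _ "\<lambda>_. 1"]) auto
next
  case (insert v Eq)
  show ?case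
  proof (cases "\<exists>k0\<in>K. M v k0 \<noteq> 0")
    case False
    obtain c where "\<exists>k\<in>K. c k \<noteq> 0" "\<forall>v\<in>Eq. (\<Sum>k\<in>K. c k * M v k) = 0"
      using insert.IH[of K M] insert.prems insert.hyps by auto
    then show ?thesis using False by (intro exI[of _ c]) auto
  next
    case True
    then obtain k0 where k0: "k0 \<in> K" "M v k0 \<noteq> 0" by auto
    let ?K = "K - {k0}" and ?M = "\<lambda>u k. M u k - M u k0 * (M v k / M v k0)"
    have "card Eq < card ?K" using insert.prems insert.hyps k0 by simp
    then obtain c where c: "\<exists>k\<in>?K. c k \<noteq> 0" "\<forall>u\<in>Eq. (\<Sum>k\<in>?K. c k * ?M u k) = 0"
      using insert.IH[of ?K ?M] insert.prems by auto
    define s where "s = (\<Sum>k\<in>?K. c k * (M v k / M v k0))"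
    let ?c = "\<lambda>k. if k = k0 then - s else c k"
    have split: "(\<Sum>k\<in>K. ?c k * M u k) = (\<Sum>k\<in>?K. c k * M u k) - s * M u k0" for u
      using insert.prems k0 by (simp add: sum.remove)
    have "(\<Sum>k\<in>K. ?c k * M u k) = 0" if "u \<in> insert v Eq" for u
    proof (cases "u = v")
      case True
      have "(\<Sum>k\<in>?K. c k * M v k) = s * M v k0"
        unfolding s_def sum_distrib_right using k0 by (intro sum.cong) auto
      then show ?thesis using split[of v] True by simp
    next
      case False
      then have "(\<Sum>k\<in>?K. c k * M u k - c k * (M v k / M v k0) * M u k0) = 0"
        using c(2) that by (simp add: right_diff_distrib mult_ac)
      then have "(\<Sum>k\<in>?K. c k * M u k) = s * M u k0"
        unfolding s_def by (simp add: sum_subtractf sum_distrib_right)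
      then show ?thesis using split[of u] by simp
    qed
    then show ?thesis using c(1) by (intro exI[of _ ?c]) auto
  qed
qed

text \<open>Linear parametrization of the space of relations between the \<open>a\<^sub>v\<close>, given the coordinates \<open>m\<close>
  of the \<open>a\<^sub>i\<close>, \<open>i \<in> J\<close>, with respect to a basis indexed by \<open>P\<close>.\<close>

definition par :: "'v set \<Rightarrow> 'v set \<Rightarrow> ('v \<Rightarrow> 'v \<Rightarrow> 'o::field) \<Rightarrow> ('v \<Rightarrow> 'o) \<Rightarrow> 'v \<Rightarrow> 'o" where
  "par J P m t v = (if v \<in> P then - (\<Sum>i\<in>J. t i * m i v) else t v)"

lemma par_line: "par J P m (\<lambda>i. x i + s * y i) v = par J P m x v + s * par J P m y v"
  by (simp add: par_def sum.distrib sum_distrib_left algebra_simps)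

lemma par_scale: "par J P m (\<lambda>i. s * y i) v = s * par J P m y v"
  by (simp add: par_def sum_distrib_left mult_ac)

lemma par_rel:
  assumes "finite B" "P \<subseteq> B" "\<And>i. i \<in> B - P \<Longrightarrow> c i = (\<Sum>l\<in>P. c l * m i l)"
  shows "(\<Sum>v\<in>B. c v * par (B - P) P m t v) = 0"
proof -
  have "(\<Sum>v\<in>B. c v * par (B - P) P m t v)
    = (\<Sum>i\<in>B - P. c i * t i) - (\<Sum>l\<in>P. \<Sum>i\<in>B - P. c l * (t i * m i l))"
    using sum.subset_diff[OF assms(2,1), of "\<lambda>v. c v * par (B - P) P m t v"]
    by (simp add: par_def sum_distrib_left sum_negf)
  also have "(\<Sum>l\<in>P. \<Sum>i\<in>B - P. c l * (t i * m i l)) = (\<Sum>i\<in>B - P. t i * (\<Sum>l\<in>P. c l * m i l))"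
    by (subst sum.swap) (simp add: sum_distrib_left mult_ac)
  also have "\<dots> = (\<Sum>i\<in>B - P. c i * t i)"
    by (rule sum.cong) (use assms(3) in \<open>auto simp: mult.commute\<close>)
  finally show ?thesis by simp
qed

text \<open>\<open>z\<close> and its parametrization are relations that agree outside
  \<open>P\<close>, so they differ by a relation between basis elements. Only the ratios
  \<open>z v / s\<close> are asked to lie in \<open>T\<close>, because generic points are
  homogeneous.\<close>

lemma par_of_relation:
  assumes T: "subfld T" and ind: "indp T c P" and B: "finite B" "P \<subseteq> B"
    and m: "\<And>i l. i \<in> B - P \<Longrightarrow> l \<in> P \<Longrightarrow> m i l \<in> T" "\<And>i. i \<in> B - P \<Longrightarrow> c i = (\<Sum>l\<in>P. c l * m i l)"
    and z: "s \<noteq> 0" "\<And>v. v \<in> B \<Longrightarrow> z v / s \<in> T" "(\<Sum>v\<in>B. c v * z v) = 0" and v: "v \<in> B"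
  shows "par (B - P) P m z v = z v"
proof (cases "v \<in> P")
  case True
  let ?e = "\<lambda>l. z l / s - par (B - P) P m z l / s"
  have "(\<Sum>v\<in>B. c v * (z v - par (B - P) P m z v)) = 0"
    using z(3) par_rel[OF B m(2), where t = z] by (simp add: right_diff_distrib sum_subtractf)
  also have "(\<Sum>v\<in>B. c v * (z v - par (B - P) P m z v)) = (\<Sum>v\<in>P. c v * (z v - par (B - P) P m z v))"
    by (rule sum.mono_neutral_right) (use B in \<open>auto simp: par_def\<close>)
  finally have "(\<Sum>l\<in>P. c l * (z l - par (B - P) P m z l)) / s = 0" by simp
  moreover have "(\<Sum>l\<in>P. c l * ?e l) = (\<Sum>l\<in>P. c l * (z l - par (B - P) P m z l)) / s"
    unfolding sum_divide_distrib by (rule sum.cong) (auto simp: diff_divide_distrib right_diff_distrib)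
  ultimately have 0: "(\<Sum>l\<in>P. c l * ?e l) = 0" by simp
  have "par (B - P) P m z l / s = - (\<Sum>i\<in>B - P. z i / s * m i l)" if "l \<in> P" for l
    using that by (simp add: par_def sum_divide_distrib)
  moreover have "z l / s - - (\<Sum>i\<in>B - P. z i / s * m i l) \<in> T" if "l \<in> P" for l
    using that z(2) m(1) B(2)
    by (intro subfld_diff[OF T] subfld_uminus[OF T] subfld_sum[OF T] subfld_mult[OF T]) auto
  ultimately have "?e l \<in> T" if "l \<in> P" for l using that by simp
  from indpD[OF ind, of ?e, OF this 0 True] z(1) show ?thesis by simp
qed (simp add: par_def)

section \<open>A pair of hypersurfaces with a point of Y over the function field of X\<close>

locale qpair = X: qform p B a ix b0 + Y: qform p C b iy c0
  for p :: nat and B :: "'v set" and a :: "'v \<Rightarrow> 'k::field" and ix b0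
    and C :: "'w set" and b :: "'w \<Rightarrow> 'k" and iy c0 +
  assumes XY: "\<exists>y. (\<forall>w\<in>C. y w \<in> X.Lf) \<and> (\<exists>w\<in>C. y w \<noteq> 0) \<and> (\<Sum>w\<in>C. kc (b w) * y w) = 0"
begin

abbreviation pev :: "('k \<Rightarrow> 'r::comm_ring_1) \<Rightarrow> ('u \<Rightarrow> 'r) \<Rightarrow> ('u, 'k) mpoly \<Rightarrow> 'r" where
  "pev g \<equiv> ev (\<lambda>c. g (c ^ p))"

abbreviation kk :: "'k gfield set" where
  "kk \<equiv> range (\<lambda>c. kc (c ^ p))"

abbreviation kp :: "'k \<Rightarrow> 'k gfield poly" where "kp c \<equiv> [:kc c:]"

lemma rhom_kp: "rhom kp"
  by (rule rhom_comp[OF rhom_kc rhom_pCons])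

lemmas kev = X.rhom_fp[OF rhom_kc]
lemmas kpev = X.rhom_fp[OF rhom_kp]

lemma arcs:
  assumes f: "finite Z" "\<And>s. s \<in> Z \<Longrightarrow> f s \<in> forms C n" "s1 \<in> Z" "pev kc Y.gx (f s1) \<noteq> 0"
  obtains ys N \<kappa> lm where "(\<Sum>w\<in>C. kp (b w) * ys w) = 0" "\<kappa> \<noteq> 0" "\<exists>s\<in>Z. lm s \<noteq> 0"
    "\<And>s. s \<in> Z \<Longrightarrow> lm s \<in> X.Lf"
    "\<And>s. s \<in> Z \<Longrightarrow> lead N (pev kp ys (f s)) (\<kappa> * lm s)"
proof -
  obtain y where y: "\<forall>w\<in>C. y w \<in> X.Lf" "\<exists>w\<in>C. y w \<noteq> 0" "(\<Sum>w\<in>C. kc (b w) * y w) = 0"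
    using XY by blast
  have "X.Es \<subseteq> X.E0" by (simp add: X.Es_def)
  obtain ys N \<kappa> lm where "(\<Sum>w\<in>C. kp (b w) * ys w) = 0" "\<kappa> \<noteq> 0" "\<exists>s\<in>Z. lm s \<noteq> 0"
    "\<And>s. s \<in> Z \<Longrightarrow> lm s \<in> X.Lf"
    "\<And>s. s \<in> Z \<Longrightarrow> lead N (pev kp ys (f s)) (\<kappa> * lm s)"
    by (rule Y.arc_family[of X.Es X.th y Z f s1 n, OF X.subfld_Es \<open>X.Es \<subseteq> X.E0\<close> X.kk_Es X.th_power X.th_not_Es
        _ y(2,3) f(1) _ f(3) f(2)[OF f(3)] f(4)])
       (erule bspec[OF y(1)[unfolded X.Lf_adjoin]], erule forms_CR[OF f(2)], rule that, (assumption | simp add: X.Lf_adjoin)+)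
  then show ?thesis by (rule that)
qed

text \<open>A relation over the function field of Y is cleared of denominators and restricted to an
  arc. Up to the common factor \<open>\<kappa>\<close>, the leading coefficients form a relation
  over the function field of X, and they are not all zero.\<close>

theorem indp_transfer:
  assumes "finite S" "indp X.Lf (\<lambda>i. kc (c i)) S"
  shows "indp Y.Lf (\<lambda>i. kc (c i)) S"
  unfolding indp_def
proof (intro allI impI, rule ccontr)
  fix e assume e: "\<forall>i\<in>S. e i \<in> Y.Lf" "(\<Sum>i\<in>S. kc (c i) * e i) = 0" "\<not> (\<forall>i\<in>S. e i = 0)"
  then obtain i0 where i0: "i0 \<in> S" "e i0 \<noteq> 0" by auto
  obtain n d u where du: "d \<in> forms C n" "pev kc Y.gx d \<noteq> 0" "\<And>i. i \<in> S \<Longrightarrow> u i \<in> forms C n"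
    "\<And>i. i \<in> S \<Longrightarrow> e i * pev kc Y.gx d = pev kc Y.gx (u i)"
    using Y.Lf_common_denominator[OF assms(1)] e(1) by metis
  \<comment> \<open>This numerator does not vanish at the generic point of Y, which is what lets the
    arc leave its zero set.\<close>
  have nz: "pev kc Y.gx (u i0) \<noteq> 0" using du(2) du(4)[OF i0(1)] i0(2) by (metis mult_eq_0_iff)
  obtain ys N \<kappa> lm where
    r: "(\<Sum>w\<in>C. kp (b w) * ys w) = 0" "\<kappa> \<noteq> 0" "\<exists>s\<in>S. lm s \<noteq> 0"
    "\<And>s. s \<in> S \<Longrightarrow> lm s \<in> X.Lf" "\<And>s. s \<in> S \<Longrightarrow> lead N (pev kp ys (u s)) (\<kappa> * lm s)"
    by (rule arcs[of S u n, OF assms(1) _ i0(1) nz]) (erule du(3), rule that)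
  have "(\<Sum>i\<in>S. kc (c i) * pev kc Y.gx (u i)) = (\<Sum>i\<in>S. kc (c i) * e i) * pev kc Y.gx d"
    using du(4) by (simp add: sum_distrib_right mult.assoc)
  then have "(\<Sum>i\<in>S. kp (c i) * pev kp ys (u i)) = 0"
    using Y.special_comb[OF rhom_kp r(1) forms_CR[OF du(3)]] e(2) by simp
  moreover have "lead N (\<Sum>i\<in>S. kp (c i) * pev kp ys (u i)) (\<Sum>i\<in>S. kc (c i) * (\<kappa> * lm i))"
    by (intro lead_sum lead_const_mult r(5))
  ultimately have "\<kappa> * (\<Sum>i\<in>S. kc (c i) * lm i) = 0"
    using lead_unique[OF _ lead_0] by (simp add: sum_distrib_left mult_ac)
  then have 0: "(\<Sum>i\<in>S. kc (c i) * lm i) = 0" using r(2) by simp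
  have "lm i = 0" if "i \<in> S" for i
    by (rule indpD[OF assms(2) r(4) 0 that])
  then show False using r(3) by blast
qed

end

text \<open>The matrices \<open>mX\<close>, \<open>mY\<close> hold the coordinates of the remaining
  \<open>a i\<close> in the basis \<open>P\<close> over the two function fields, \<open>nX\<close>,
  \<open>nY\<close> those of the \<open>b j\<close> in the basis \<open>Q\<close>. The quotients
  \<open>mu / dY\<close> define the map from Y to X and \<open>nu / dX\<close> the map back, so only
  \<open>mY\<close> and \<open>nX\<close> are written as fractions of forms.\<close>

locale qbase = qpair p B a ix b0 C b iy c0
  for p :: nat and B :: "'v set" and a :: "'v \<Rightarrow> 'k::field" and ix b0
    and C :: "'w set" and b :: "'w \<Rightarrow> 'k" and iy c0 +
  fixes P :: "'v set" and Q :: "'w set"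
    and mX mY :: "'v \<Rightarrow> 'v \<Rightarrow> 'k gfield" and nX nY :: "'w \<Rightarrow> 'w \<Rightarrow> 'k gfield"
    and dX :: "('v, 'k) mpoly" and eX :: nat and nu :: "'w \<Rightarrow> 'w \<Rightarrow> ('v, 'k) mpoly"
    and dY :: "('w, 'k) mpoly" and eY :: nat and mu :: "'v \<Rightarrow> 'v \<Rightarrow> ('w, 'k) mpoly"
  assumes PB: "P \<subseteq> B" and QC: "Q \<subseteq> C"
    and indPX: "indp X.Lf (\<lambda>v. kc (a v)) P" and indPY: "indp Y.Lf (\<lambda>v. kc (a v)) P"
    and indQY: "indp Y.Lf (\<lambda>w. kc (b w)) Q"
    and mX: "\<And>i l. i \<in> B - P \<Longrightarrow> l \<in> P \<Longrightarrow> mX i l \<in> X.Lf"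
      "\<And>i. i \<in> B - P \<Longrightarrow> kc (a i) = (\<Sum>l\<in>P. kc (a l) * mX i l)"
    and mY: "\<And>i l. i \<in> B - P \<Longrightarrow> l \<in> P \<Longrightarrow> mY i l \<in> Y.Lf"
      "\<And>i. i \<in> B - P \<Longrightarrow> kc (a i) = (\<Sum>l\<in>P. kc (a l) * mY i l)"
    and nX: "\<And>j. j \<in> C - Q \<Longrightarrow> kc (b j) = (\<Sum>l\<in>Q. kc (b l) * nX j l)"
    and nY: "\<And>j l. j \<in> C - Q \<Longrightarrow> l \<in> Q \<Longrightarrow> nY j l \<in> Y.Lf"
      "\<And>j. j \<in> C - Q \<Longrightarrow> kc (b j) = (\<Sum>l\<in>Q. kc (b l) * nY j l)"
    and dX: "dX \<in> forms B eX" "pev kc X.gx dX \<noteq> 0"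
    and nu: "\<And>j l. j \<in> C - Q \<Longrightarrow> l \<in> Q \<Longrightarrow> nu j l \<in> forms B eX"
      "\<And>j l. j \<in> C - Q \<Longrightarrow> l \<in> Q \<Longrightarrow> nX j l * pev kc X.gx dX = pev kc X.gx (nu j l)"
    and dY: "dY \<in> forms C eY" "pev kc Y.gx dY \<noteq> 0"
    and mu: "\<And>i l. i \<in> B - P \<Longrightarrow> l \<in> P \<Longrightarrow> mu i l \<in> forms C eY"
      "\<And>i l. i \<in> B - P \<Longrightarrow> l \<in> P \<Longrightarrow> mY i l * pev kc Y.gx dY = pev kc Y.gx (mu i l)"
begin

lemma finP: "finite P"
  using PB X.finB by (rule finite_subset)

lemma finQ: "finite Q"
  using QC Y.finB by (rule finite_subset)

lemma par_gx: "v \<in> B \<Longrightarrow> par (B - P) P mX X.gx v = X.gx v"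
  by (rule par_of_relation[OF X.subfld_Lf indPX X.finB PB mX X.gx_nz[OF X.b0] X.Lf_ratio[OF _ X.b0] X.gx_rel])

lemma par_gy: "w \<in> C \<Longrightarrow> par (C - Q) Q nY Y.gx w = Y.gx w"
  by (rule par_of_relation[OF Y.subfld_Lf indQY Y.finB QC nY Y.gx_nz[OF Y.b0] Y.Lf_ratio[OF _ Y.b0] Y.gx_rel])

text \<open>With its denominator cleared, the expansion of \<open>a i\<close> is a relation between
  elements of F and so holds at every point of Y in every ring. The family \<open>?f\<close> brings
  it into the shape of \<open>special_comb\<close>.\<close>

lemma mu_rel:
  fixes g :: "'k \<Rightarrow> 'r::comm_ring_1"
  assumes g: "rhom g" and z: "(\<Sum>w\<in>C. g (b w) * z w) = 0" and i: "i \<in> B - P"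
  shows "g (a i) * pev g z dY = (\<Sum>l\<in>P. g (a l) * pev g z (mu i l))"
proof -
  let ?f = "\<lambda>j. if j = i then dY else - mu i j"
  have f: "?f j \<in> carrier (coord_ring C)" if "j \<in> insert i P" for j
    using that i dY(1) mu(1)[OF i] by (auto intro: CR_uminus forms_CR)
  have exp: "(\<Sum>j\<in>insert i P. h (a j) * pev h x (?f j)) = h (a i) * pev h x dY - (\<Sum>l\<in>P. h (a l) * pev h x (mu i l))"
    if "rhom h" for h :: "'k \<Rightarrow> 's::comm_ring_1" and x
  proof -
    have "(\<Sum>j\<in>P. h (a j) * pev h x (?f j)) = (\<Sum>l\<in>P. - (h (a l) * pev h x (mu i l)))"
      using i by (intro sum.cong refl) (auto simp: rhom_uminus[OF X.rhom_pev[OF that]])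
    then show ?thesis using finP i by (simp add: sum_negf)
  qed
  have "(\<Sum>l\<in>P. kc (a l) * pev kc Y.gx (mu i l)) = (\<Sum>l\<in>P. kc (a l) * mY i l) * pev kc Y.gx dY"
    unfolding sum_distrib_right by (rule sum.cong) (auto simp: mu(2)[OF i, symmetric])
  then have "(\<Sum>j\<in>insert i P. kc (a j) * pev kc Y.gx (?f j)) = 0"
    unfolding exp[OF rhom_kc] using mY(2)[OF i] by simp
  from Y.special_comb[OF g z f this] show ?thesis unfolding exp[OF g] by simp
qed

lemma nu_rel:
  fixes g :: "'k \<Rightarrow> 'r::comm_ring_1"
  assumes g: "rhom g" and z: "(\<Sum>w\<in>B. g (a w) * z w) = 0" and i: "i \<in> C - Q"
  shows "g (b i) * pev g z dX = (\<Sum>l\<in>Q. g (b l) * pev g z (nu i l))"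
proof -
  let ?f = "\<lambda>j. if j = i then dX else - nu i j"
  have f: "?f j \<in> carrier (coord_ring B)" if "j \<in> insert i Q" for j
    using that i dX(1) nu(1)[OF i] by (auto intro: CR_uminus forms_CR)
  have exp: "(\<Sum>j\<in>insert i Q. h (b j) * pev h x (?f j)) = h (b i) * pev h x dX - (\<Sum>l\<in>Q. h (b l) * pev h x (nu i l))"
    if "rhom h" for h :: "'k \<Rightarrow> 's::comm_ring_1" and x
  proof -
    have "(\<Sum>j\<in>Q. h (b j) * pev h x (?f j)) = (\<Sum>l\<in>Q. - (h (b l) * pev h x (nu i l)))"
      using i by (intro sum.cong refl) (auto simp: rhom_uminus[OF X.rhom_pev[OF that]])
    then show ?thesis using finQ i by (simp add: sum_negf)
  qed
  have "(\<Sum>l\<in>Q. kc (b l) * pev kc X.gx (nu i l)) = (\<Sum>l\<in>Q. kc (b l) * nX i l) * pev kc X.gx dX"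
    unfolding sum_distrib_right by (rule sum.cong) (auto simp: nu(2)[OF i, symmetric])
  then have "(\<Sum>j\<in>insert i Q. kc (b j) * pev kc X.gx (?f j)) = 0"
    unfolding exp[OF rhom_kc] using nX[OF i] by simp
  from X.special_comb[OF g z f this] show ?thesis unfolding exp[OF g] by simp
qed

text \<open>Coordinates in the basis \<open>P\<close> over the function field of Y are unique. So
  \<open>mu / dY\<close> takes the value \<open>mY\<close> at each point over that field where
  \<open>dY\<close> does not vanish, not only at the generic one.\<close>

lemma mu_at:
  assumes y: "\<And>w. w \<in> C \<Longrightarrow> y w \<in> Y.Lf" "(\<Sum>w\<in>C. kc (b w) * y w) = 0" and i: "i \<in> B - P" "l \<in> P"
  shows "pev kc y (mu i l) = pev kc y dY * mY i l"
proof (rule indp_unique[OF Y.subfld_Lf indPY _ _ _ i(2)])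
  have pevL: "pev kc y f \<in> Y.Lf" if "f \<in> forms C n" for f n
    by (rule subfld_ev[OF Y.subfld_Lf Y.Lf_kc forms_CR[OF that] y(1)])
  show "pev kc y (mu i l) \<in> Y.Lf" "pev kc y dY * mY i l \<in> Y.Lf" if "l \<in> P" for l
    using that i mu(1) dY(1) mY(1) by (auto intro!: pevL subfld_mult[OF Y.subfld_Lf])
  show "(\<Sum>l\<in>P. kc (a l) * pev kc y (mu i l)) = (\<Sum>l\<in>P. kc (a l) * (pev kc y dY * mY i l))"
    unfolding mu_rel[OF rhom_kc y(2) i(1), symmetric] mY(2)[OF i(1)] sum_distrib_right
    by (simp add: mult_ac)
qed

text \<open>The same uniqueness for \<open>Q\<close>: the functions \<open>nu / dX\<close>, equal to
  \<open>nX\<close> at the generic point of X, turn into \<open>nY\<close> at points of X over the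
  function field of Y.\<close>

lemma nu_at:
  assumes z: "\<And>v. v \<in> B \<Longrightarrow> z v \<in> Y.Lf" "(\<Sum>v\<in>B. kc (a v) * z v) = 0" and j: "j \<in> C - Q" "l \<in> Q"
  shows "pev kc z (nu j l) = pev kc z dX * nY j l"
proof (rule indp_unique[OF Y.subfld_Lf indQY _ _ _ j(2)])
  have pevL: "pev kc z f \<in> Y.Lf" if "f \<in> forms B n" for f n
    by (rule subfld_ev[OF Y.subfld_Lf Y.Lf_kc forms_CR[OF that] z(1)])
  show "pev kc z (nu j l) \<in> Y.Lf" "pev kc z dX * nY j l \<in> Y.Lf" if "l \<in> Q" for l
    using that j nu(1) dX(1) nY(1) by (auto intro!: pevL subfld_mult[OF Y.subfld_Lf])
  show "(\<Sum>l\<in>Q. kc (b l) * pev kc z (nu j l)) = (\<Sum>l\<in>Q. kc (b l) * (pev kc z dX * nY j l))"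
    unfolding nu_rel[OF rhom_kc z(2) j(1), symmetric] nY(2)[OF j(1)] sum_distrib_right
    by (simp add: mult_ac)
qed

text \<open>Along a suitable arc in \<open>Y\<close> the matrix \<open>mY\<close> specializes to \<open>mX\<close>.\<close>

lemma par_mY_dense:
  assumes f: "f \<in> forms B n"
    and 0: "\<And>s. (\<And>i. i \<in> B - P \<Longrightarrow> s i \<in> kk) \<Longrightarrow> pev kc (par (B - P) P mY s) f = 0"
  shows "pev kc X.gx f = 0"
proof -
  let ?I = "B - P"
  \<comment> \<open>\<open>None\<close> stands for the denominator \<open>dY\<close> and
    \<open>Some (i, l)\<close> for the numerator \<open>mu i l\<close>; all of them receive leading
    coefficients at one common order.\<close>
  define Z where "Z = insert None (Some ` (?I \<times> P))"
  define F where "F s = (case s of None \<Rightarrow> dY | Some (i, l) \<Rightarrow> mu i l)" for s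
  have "finite Z" using X.finB finP by (simp add: Z_def)
  have FC: "F s \<in> forms C eY" if "s \<in> Z" for s using that dY(1) mu(1) by (auto simp: Z_def F_def)
  have N: "None \<in> Z" "pev kc Y.gx (F None) \<noteq> 0" using dY(2) by (auto simp: Z_def F_def)
  obtain ys N \<kappa> lm where
    r: "(\<Sum>w\<in>C. kp (b w) * ys w) = 0" "\<kappa> \<noteq> 0" "\<exists>s\<in>Z. lm s \<noteq> 0"
    "\<And>s. s \<in> Z \<Longrightarrow> lm s \<in> X.Lf" "\<And>s. s \<in> Z \<Longrightarrow> lead N (pev kp ys (F s)) (\<kappa> * lm s)"
    by (rule arcs[of Z F eY, OF \<open>finite Z\<close> _ N]) (erule FC, rule that)
  have ld: "lead N (pev kp ys dY) (\<kappa> * lm None)" using r(5)[of None] by (simp add: Z_def F_def)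
  have lmu: "lead N (pev kp ys (mu i l)) (\<kappa> * lm (Some (i, l)))" if "i \<in> ?I" "l \<in> P" for i l
    using r(5)[of "Some (i, l)"] that by (simp add: Z_def F_def)
  \<comment> \<open>The leading coefficients of \<open>mu_rel\<close> expand \<open>a i\<close> over
    the function field of X, where the expansion is unique.\<close>
  have lm: "lm (Some (i, l)) = lm None * mX i l" if i: "i \<in> ?I" "l \<in> P" for i l
  proof (rule indp_unique[OF X.subfld_Lf indPX _ _ _ i(2)])
    show "lm (Some (i, l)) \<in> X.Lf" "lm None * mX i l \<in> X.Lf" if "l \<in> P" for l
      using that i r(4) mX(1) by (auto simp: Z_def intro!: subfld_mult[OF X.subfld_Lf])
    have 1: "lead N (kp (a i) * pev kp ys dY) (kc (a i) * (\<kappa> * lm None))"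
      by (intro lead_const_mult ld)
    have 2: "lead N (\<Sum>l\<in>P. kp (a l) * pev kp ys (mu i l)) (\<Sum>l\<in>P. kc (a l) * (\<kappa> * lm (Some (i, l))))"
      by (intro lead_sum lead_const_mult lmu i(1))
    have "(\<Sum>l\<in>P. kc (a l) * (\<kappa> * lm (Some (i, l)))) = kc (a i) * (\<kappa> * lm None)"
      using lead_unique[OF 2 1[unfolded mu_rel[OF rhom_kp r(1) i(1)]]] .
    then have "\<kappa> * (\<Sum>l\<in>P. kc (a l) * lm (Some (i, l))) = \<kappa> * (kc (a i) * lm None)"
      by (simp add: sum_distrib_left mult_ac)
    then have "(\<Sum>l\<in>P. kc (a l) * lm (Some (i, l))) = kc (a i) * lm None"
      using mult_left_cancel[OF r(2)] by blast
    then show "(\<Sum>l\<in>P. kc (a l) * lm (Some (i, l))) = (\<Sum>l\<in>P. kc (a l) * (lm None * mX i l))"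
      unfolding mX(2)[OF i(1)] sum_distrib_right by (simp add: mult_ac)
  qed
  have "lm None \<noteq> 0"
  proof
    assume "lm None = 0"
    then have "lm s = 0" if "s \<in> Z" for s using that lm by (auto simp: Z_def)
    then show False using r(3) by blast
  qed
  have kkzero: "pev kc (par ?I P mX s) f = 0" if s: "\<And>i. i \<in> ?I \<Longrightarrow> s i \<in> kk" for s
  proof -
    have "\<forall>i\<in>?I. \<exists>c. s i = kc (c ^ p)" using s by blast
    then obtain c where c: "\<forall>i\<in>?I. s i = kc (c i ^ p)" by (rule bchoice[THEN exE])
    \<comment> \<open>Forms on Y whose values at the generic point are \<open>dY\<close> times the
      point with parameters \<open>s\<close>. Parameters in F^p are the twisted images of constants,
      so these are polynomials over F.\<close>
    define H where "H v = (if v \<in> P then - (\<Sum>i\<in>?I. Poly_Mapping.single 0 (c i) * mu i v)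
      else Poly_Mapping.single 0 (c v) * dY)" for v
    have HC: "H v \<in> forms C eY" if "v \<in> B" for v
      using that forms_mult[OF forms_const dY(1)] forms_mult[OF forms_const mu(1)]
      by (auto simp: H_def intro!: forms_uminus forms_sum)
    have Hev: "pev g z (H v) = (if v \<in> P then - (\<Sum>i\<in>?I. g (c i ^ p) * pev g z (mu i v)) else g (c v ^ p) * pev g z dY)"
      if "rhom g" for g :: "'k \<Rightarrow> 'r::comm_ring_1" and z v
      by (simp add: H_def rhom_simps[OF X.rhom_pev[OF that]] ev_const[OF X.rhom_fp[OF that]])
    have "pev kc Y.gx (H v) = pev kc Y.gx dY * par ?I P mY s v" if "v \<in> B" for v
      unfolding Hev[OF rhom_kc] par_def using that c
      by (auto simp: mu(2)[symmetric] sum_distrib_left mult_ac)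
    then have "pev kc Y.gx (psubst H f) = pev kc (\<lambda>v. pev kc Y.gx dY * par ?I P mY s v) f"
      unfolding ev_psubst[OF kev] by (intro ev_form_cong[OF f])
    also have "\<dots> = 0" unfolding ev_forms_scale[OF f] using 0[OF s] by simp
    finally have "pev kp ys (psubst H f) = 0"
      by (intro Y.special_zero[OF rhom_kp r(1)] psubst_CR[OF HC forms_CR[OF f]]) auto
    then have z: "pev kp (\<lambda>v. pev kp ys (H v)) f = 0" unfolding ev_psubst[OF kpev] .
    have lead: "lead N (pev kp ys (H v)) (\<kappa> * lm None * par ?I P mX s v)" if "v \<in> B" for v
    proof (cases "v \<in> P")
      case True
      have "lead N (\<Sum>i\<in>?I. kp (c i ^ p) * pev kp ys (mu i v)) (\<Sum>i\<in>?I. kc (c i ^ p) * (\<kappa> * lm (Some (i, v))))"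
        by (intro lead_sum lead_const_mult lmu True)
      from lead_const_mult[OF this, of "- 1"]
      have "lead N (pev kp ys (H v)) (- (\<Sum>i\<in>?I. kc (c i ^ p) * (\<kappa> * lm (Some (i, v)))))"
        unfolding Hev[OF rhom_kp] using True by simp
      moreover have "- (\<Sum>i\<in>?I. kc (c i ^ p) * (\<kappa> * lm (Some (i, v)))) = \<kappa> * lm None * par ?I P mX s v"
        using True lm c by (simp add: par_def sum_distrib_left mult_ac)
      ultimately show ?thesis by simp
    next
      case False
      then have "lead N (pev kp ys (H v)) (kc (c v ^ p) * (\<kappa> * lm None))"
        unfolding Hev[OF rhom_kp] using lead_const_mult[OF ld, of "kc (c v ^ p)"] by simp
      then show ?thesis using c that False by (simp add: par_def mult_ac)
    qed
    have "\<forall>v\<in>B. \<exists>q. pev kp ys (H v) = monom 1 N * q \<and> poly q 0 = \<kappa> * lm None * par ?I P mX s v"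
      using lead unfolding lead_def by blast
    then obtain q where q: "\<forall>v\<in>B. pev kp ys (H v) = monom 1 N * q v \<and>
      poly (q v) 0 = \<kappa> * lm None * par ?I P mX s v" by (rule bchoice[THEN exE])
    have "pev kp (\<lambda>v. pev kp ys (H v)) f = pev kp (\<lambda>v. monom 1 N * q v) f"
      using q by (intro ev_form_cong[OF f]) auto
    \<comment> \<open>The common power of t is removed before t is set to 0.\<close>
    then have "monom 1 N ^ n * pev kp q f = 0" using z unfolding ev_forms_scale[OF f] by simp
    then have "pev kp q f = 0" by (simp add: monom_eq_0_iff)
    then have "poly (pev kp q f) 0 = 0" by simp
    then have "pev kc (\<lambda>v. poly (q v) 0) f = 0" by (simp add: rhom_after_ev[OF rhom_poly])
    moreover have "pev kc (\<lambda>v. poly (q v) 0) f = pev kc (\<lambda>v. \<kappa> * lm None * par ?I P mX s v) f"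
      using q by (intro ev_form_cong[OF f]) auto
    ultimately have "(\<kappa> * lm None) ^ n * pev kc (par ?I P mX s) f = 0"
      unfolding ev_forms_scale[OF f] by simp
    then show ?thesis using r(2) \<open>lm None \<noteq> 0\<close> by simp
  qed
  have "pev kc (par ?I P mX X.gx) f = 0"
  proof (rule vanish_on_lines[of "\<lambda>t. pev kc (par ?I P mX t) f" kk ?I])
    show "\<exists>q. \<forall>s. pev kc (par ?I P mX (\<lambda>i. x i + s * y i)) f = poly q s" for x y
      unfolding par_line by (rule ev_line[OF kev])
    show "finite ?I" using X.finB by simp
  qed (use X.infinite_kk kkzero in auto)
  moreover have "pev kc (par ?I P mX X.gx) f = pev kc X.gx f" by (rule ev_form_cong[OF f par_gx])
  ultimately show ?thesis by simp
qed

end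

section \<open>Maps defined by the coordinate matrices\<close>

text \<open>The hypotheses are the cross-multiplied form of (a/b)' = 0 and (d/e)' = 0. This rule and
  the next one make the constants of a derivation closed under products and sums.\<close>

lemma quotient_mult_rule:
  fixes a b d e :: "'o::field"
  assumes "a' * b = a * b'" "d' * e = d * e'"
  shows "(a' * d + a * d') * (b * e) = a * d * (b' * e + b * e')"
proof -
  have "(a' * d + a * d') * (b * e) = (a' * b) * (d * e) + (a * b) * (d' * e)"
    by (simp add: algebra_simps)
  then show ?thesis unfolding assms by (simp add: algebra_simps)
qed

lemma quotient_add_rule:
  fixes a b d e :: "'o::field"
  assumes "a' * b = a * b'" "d' * e = d * e'"
  shows "(a' * e + a * e' + (d' * b + d * b')) * (b * e) = (a * e + d * b) * (b' * e + b * e')"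
proof -
  have "(a' * e + a * e' + (d' * b + d * b')) * (b * e)
    = (a' * b) * (e * e) + a * e' * b * e + (d' * e) * (b * b) + d * b' * b * e"
    by (simp add: algebra_simps)
  then show ?thesis unfolding assms by (simp add: algebra_simps)
qed

section \<open>Derivations of the field containing the generic points\<close>

context charp
begin

abbreviation cg :: "'k \<Rightarrow> 'k gpoly" where "cg \<equiv> Poly_Mapping.single 0"

definition dlift :: "nat \<Rightarrow> 'k gpoly \<Rightarrow> 'k gpoly poly" where
  "dlift k = ev (\<lambda>c. [:cg c:]) (\<lambda>v. [:Xg v, if v = k then 1 else 0:])"

text \<open>The partial derivatives, read off from the ring homomorphism \<open>X\<^sub>k \<mapsto> X\<^sub>k + \<epsilon>\<close>.\<close>

definition dg :: "nat \<Rightarrow> 'k gpoly \<Rightarrow> 'k gpoly" where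
  "dg k f = coeff (dlift k f) 1"

lemma rhom_dlift: "rhom (dlift k)"
  unfolding dlift_def by (rule rhom_ev[OF rhom_comp[OF rhom_const rhom_pCons]])

lemma coeff_0_dlift: "coeff (dlift k f) 0 = f"
proof -
  have "coeff (dlift k f) 0 = ev cg Xg f"
    unfolding dlift_def poly_0_coeff_0[symmetric] by (simp add: rhom_after_ev[OF rhom_poly])
  also have "\<dots> = f"
    unfolding ev_def mon_Xg by (simp add: mult_single flip: mpoly_expand)
  finally show ?thesis .
qed

lemma dg_add: "dg k (f + g) = dg k f + dg k g"
  by (simp add: dg_def rhom_add[OF rhom_dlift])

lemma dg_mult: "dg k (f * g) = dg k f * g + f * dg k g"
  by (simp add: dg_def rhom_mult[OF rhom_dlift] coeff_mult coeff_0_dlift atMost_Suc add.commute)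

lemma dg_const: "dg k (cg c) = 0"
  by (simp add: dg_def dlift_def ev_const[OF rhom_comp[OF rhom_const rhom_pCons]])

lemma dg_var: "dg k (Xg i) = (if i = k then 1 else 0)"
  by (simp add: dg_def dlift_def Xg_def ev_var[OF rhom_comp[OF rhom_const rhom_pCons]])

text \<open>The derivation over F that sends X_k to \<open>c k\<close> for k in \<open>K\<close>. It
  has values in the field because the \<open>c k\<close> will solve a linear system over it.\<close>

definition derc :: "nat set \<Rightarrow> (nat \<Rightarrow> 'k gfield) \<Rightarrow> 'k gpoly \<Rightarrow> 'k gfield" where
  "derc K c f = (\<Sum>k\<in>K. c k * Em (dg k f))"

lemma derc_add: "derc K c (f + g) = derc K c f + derc K c g"
  by (simp add: derc_def dg_add rhom_add[OF rhom_Em] distrib_left sum.distrib)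

lemma derc_mult: "derc K c (f * g) = derc K c f * Em g + Em f * derc K c g"
  by (simp add: derc_def dg_mult rhom_simps[OF rhom_Em] distrib_left sum.distrib sum_distrib_left
      sum_distrib_right mult_ac)

lemma derc_const: "derc K c (cg x) = 0"
  by (simp add: derc_def dg_const rhom_0[OF rhom_Em])

lemma derc_var: "finite K \<Longrightarrow> derc K c (Xg i) = (if i \<in> K then c i else 0)"
  by (simp add: derc_def dg_var rhom_simps[OF rhom_Em] if_distrib[of Em] if_distrib[of "\<lambda>x. _ * x"] cong: if_cong)

lemma derc_uminus: "derc K c (- f) = - derc K c f"
  using derc_add[of K c f "- f"] derc_const[of K c 0] by (simp add: eq_neg_iff_add_eq_0 add.commute)

text \<open>The field of constants, expressed by cross-multiplication to avoid extending the
  derivation to fractions. It contains all of F.\<close>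

definition kerd :: "nat set \<Rightarrow> (nat \<Rightarrow> 'k gfield) \<Rightarrow> 'k gfield set" where
  "kerd K c = {Em a / Em b | a b. b \<noteq> 0 \<and> derc K c a * Em b = Em a * derc K c b}"

lemma kerdI: "b \<noteq> 0 \<Longrightarrow> derc K c a * Em b = Em a * derc K c b \<Longrightarrow> Em a / Em b \<in> kerd K c"
  by (auto simp: kerd_def)

lemma kerd_Em: "derc K c a = 0 \<Longrightarrow> Em a \<in> kerd K c"
  using kerdI[of 1 K c a] derc_const[of K c 1] by (simp add: rhom_1[OF rhom_Em])

lemma kerd_kc: "kc x \<in> kerd K c"
  unfolding kc_def by (rule kerd_Em[OF derc_const])

lemma subfld_kerd: "subfld (kerd K c)"
  unfolding subfld_def
proof (intro conjI ballI)
  show "0 \<in> kerd K c" using kerd_kc[of 0] by (simp add: rhom_0[OF rhom_kc])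
  show "1 \<in> kerd K c" using kerd_kc[of 1] by (simp add: rhom_1[OF rhom_kc])
  fix x assume "x \<in> kerd K c"
  then obtain a b where x: "b \<noteq> 0" "derc K c a * Em b = Em a * derc K c b" "x = Em a / Em b"
    by (auto simp: kerd_def)
  show "- x \<in> kerd K c"
    using kerdI[of b K c "- a"] x by (simp add: derc_uminus rhom_uminus[OF rhom_Em])
  show "inverse x \<in> kerd K c"
    using kerdI[of a K c b] x \<open>0 \<in> kerd K c\<close> by (cases "a = 0") (auto simp: rhom_0[OF rhom_Em] mult.commute)
  fix y assume "y \<in> kerd K c"
  then obtain d e where y: "e \<noteq> 0" "derc K c d * Em e = Em d * derc K c e" "y = Em d / Em e"
    by (auto simp: kerd_def)
  have nz: "b * e \<noteq> 0" "Em b \<noteq> 0" "Em e \<noteq> 0" using x y by (auto simp: Em_eq_0_iff)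
  have "derc K c (a * d) * Em (b * e) = Em (a * d) * derc K c (b * e)"
    unfolding derc_mult rhom_mult[OF rhom_Em] by (rule quotient_mult_rule[OF x(2) y(2)])
  then show "x * y \<in> kerd K c"
    using kerdI[OF nz(1), of K c "a * d"] x y by (simp add: rhom_mult[OF rhom_Em])
  have "derc K c (a * e + d * b) * Em (b * e) = Em (a * e + d * b) * derc K c (b * e)"
    unfolding derc_mult derc_add rhom_mult[OF rhom_Em] rhom_add[OF rhom_Em]
    by (rule quotient_add_rule[OF x(2) y(2)])
  moreover have "x + y = Em (a * e + d * b) / Em (b * e)"
    using nz x y by (simp add: rhom_simps[OF rhom_Em] add_frac_eq)
  ultimately show "x + y \<in> kerd K c" using kerdI[OF nz(1), of K c "a * e + d * b"] by simp
qed

lemma kerd_var: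
  assumes "finite K" "Xf i \<in> kerd K c" "i \<in> K" shows "c i = 0"
proof -
  obtain a b where ab: "b \<noteq> 0" "derc K c a * Em b = Em a * derc K c b" "Xf i = Em a / Em b"
    using assms(2) by (auto simp: kerd_def)
  have nz: "Em b \<noteq> 0" using ab(1) by (simp add: Em_eq_0_iff)
  then have "Em (Xg i * b - a) = 0"
    using ab(3) by (simp add: Xf_def rhom_diff[OF rhom_Em] rhom_mult[OF rhom_Em] field_simps)
  then have "a = Xg i * b" by (simp add: Em_eq_0_iff)
  then have "derc K c (Xg i) * Em b * Em b = 0"
    using ab(2) by (simp add: derc_mult rhom_mult[OF rhom_Em] algebra_simps)
  then show ?thesis using nz assms by (simp add: derc_var)
qed

end

text \<open>\<open>\<sigma>\<close> matches the free coordinates of Y with free coordinates of X;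
  those of X left over receive new variables \<open>tv\<close>, distinct from the variables of Y.
  For equal dimensions none will be left over (\<open>\<sigma>_surj\<close>).\<close>

locale qsub = qbase p B a ix b0 C b iy c0 P Q mX mY nX nY dX eX nu dY eY mu
  for p :: nat and B :: "'v set" and a :: "'v \<Rightarrow> 'k::field" and ix b0
    and C :: "'w set" and b :: "'w \<Rightarrow> 'k" and iy c0 P Q mX mY nX nY dX eX nu dY eY mu +
  fixes \<sigma> :: "'w \<Rightarrow> 'v" and tv :: "'v \<Rightarrow> nat"
  assumes inj_\<sigma>: "inj_on \<sigma> (C - Q)" and \<sigma>: "\<sigma> ` (C - Q) \<subseteq> B - P"
    and tv: "inj_on tv (B - P - \<sigma> ` (C - Q))" "tv ` (B - P - \<sigma> ` (C - Q)) \<inter> iy ` C = {}"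
begin

abbreviation cg :: "'k \<Rightarrow> 'k gpoly" where "cg \<equiv> Poly_Mapping.single 0"

definition \<sigma>i :: "'v \<Rightarrow> 'w" where "\<sigma>i = inv_into (C - Q) \<sigma>"

lemma \<sigma>i: "j \<in> C - Q \<Longrightarrow> \<sigma>i (\<sigma> j) = j" "i \<in> \<sigma> ` (C - Q) \<Longrightarrow> \<sigma>i i \<in> C - Q"
  "i \<in> \<sigma> ` (C - Q) \<Longrightarrow> \<sigma> (\<sigma>i i) = i"
  by (auto simp: \<sigma>i_def inv_into_f_f[OF inj_\<sigma>] f_inv_into_f inv_into_into)

definition s0 :: "'v \<Rightarrow> 'k gpoly" where
  "s0 i = (if i \<in> \<sigma> ` (C - Q) then Y.gp (\<sigma>i i) else Xg (tv i))"

text \<open>The image of the generic point of \<open>Y \<times> \<AA>\<^sup>r\<close> in \<open>X\<close>.\<close>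

definition z :: "'v \<Rightarrow> 'k gfield" where
  "z = par (B - P) P mY (\<lambda>i. Em (s0 i))"

text \<open>\<open>z\<close> multiplied by \<open>dY\<close>: polynomials, which can be specialized
  without care for denominators.\<close>

definition zc :: "'v \<Rightarrow> 'k gpoly" where
  "zc v = (if v \<in> P then - (\<Sum>i\<in>B - P. s0 i * pev cg Y.gp (mu i v)) else s0 v * pev cg Y.gp dY)"

lemma pev_gx: "pev kc Y.gx f = Em (pev cg Y.gp f)"
  using X.pev_Em[of Y.gp f] by (simp add: Y.gx_def[abs_def])

lemma Em_zc: assumes "v \<in> B" shows "Em (zc v) = pev kc Y.gx dY * z v"
proof (cases "v \<in> P")
  case True
  then have "Em (zc v) = - (\<Sum>i\<in>B - P. Em (s0 i) * pev kc Y.gx (mu i v))"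
    by (simp add: zc_def rhom_simps[OF rhom_Em] pev_gx)
  also have "\<dots> = - (\<Sum>i\<in>B - P. Em (s0 i) * (mY i v * pev kc Y.gx dY))"
    by (intro arg_cong[of _ _ uminus] sum.cong refl) (simp add: mu(2) True)
  finally show ?thesis using True by (simp add: z_def par_def sum_distrib_left mult_ac)
next
  case False
  then show ?thesis by (simp add: zc_def z_def par_def rhom_mult[OF rhom_Em] pev_gx mult.commute)
qed

lemma z_rel: "(\<Sum>v\<in>B. kc (a v) * z v) = 0"
  unfolding z_def by (rule par_rel[OF X.finB PB mY(2)])

lemma par_relY: "(\<Sum>w\<in>C. kc (b w) * par (C - Q) Q nY t w) = 0"
  by (rule par_rel[OF Y.finB QC nY(2)])

lemma par_relX: "(\<Sum>v\<in>B. kc (a v) * par (B - P) P mY t v) = 0"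
  by (rule par_rel[OF X.finB PB mY(2)])

text \<open>The variables are specialized: the generic point of Y to another point over its own
  function field, the new variables to the leftover parameters. By \<open>mu_at\<close> the matrix
  \<open>mY\<close> survives, unless \<open>dY\<close> vanishes at the new point.\<close>

lemma special_z:
  assumes f: "f \<in> forms B n" "pev kc z f = 0"
    and s: "\<And>i. i \<in> B - P \<Longrightarrow> s i \<in> Y.Lf"
  shows "pev kc (par (C - Q) Q nY (\<lambda>j. s (\<sigma> j))) dY = 0 \<or> pev kc (par (B - P) P mY s) f = 0"
proof -
  let ?R = "B - P - \<sigma> ` (C - Q)"
  let ?y = "par (C - Q) Q nY (\<lambda>j. s (\<sigma> j))"
  define u where "u k = (if k \<in> iy ` (C - {c0}) then ?y (the_inv_into (C - {c0}) iy k)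
    else s (the_inv_into ?R tv k))" for k
  have yL: "?y w \<in> Y.Lf" if "w \<in> C" for w
    using that \<sigma> s nY(1) unfolding par_def
    by (auto intro!: subfld_uminus[OF Y.subfld_Lf] subfld_sum[OF Y.subfld_Lf] subfld_mult[OF Y.subfld_Lf])
  have uy: "u (iy w) = ?y w" if "w \<in> C - {c0}" for w
    using that the_inv_into_f_f[OF Y.inj_ix that] by (auto simp: u_def)
  have gp: "ev kc u (Y.gp w) = ?y w" if "w \<in> C" for w
    by (rule Y.ev_gp[OF rhom_kc par_relY uy that])
  have s0: "ev kc u (s0 i) = s i" if i: "i \<in> B - P" for i
  proof (cases "i \<in> \<sigma> ` (C - Q)")
    case True
    then show ?thesis using \<sigma>i(3)[of i] \<sigma>i(2)[OF True] gp[of "\<sigma>i i"] by (simp add: s0_def par_def)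
  next
    case False
    then have iR: "i \<in> ?R" using i by simp
    then have "tv i \<notin> iy ` (C - {c0})" using tv(2) by blast
    then have "u (tv i) = s i" using the_inv_into_f_f[OF tv(1) iR] by (simp add: u_def)
    then show ?thesis using False by (simp add: s0_def Xg_def ev_var[OF rhom_kc])
  qed
  have pev: "ev kc u (pev cg Y.gp g) = pev kc ?y g" if "g \<in> forms C m" for g m
    unfolding rhom_after_ev[OF rhom_ev[OF rhom_kc]] ev_const[OF rhom_kc]
    by (rule ev_form_cong[OF that gp])
  have zc: "ev kc u (zc v) = pev kc ?y dY * par (B - P) P mY s v" if v: "v \<in> B" for v
  proof (cases "v \<in> P")
    case True
    have "ev kc u (zc v) = - (\<Sum>i\<in>B - P. ev kc u (s0 i) * ev kc u (pev cg Y.gp (mu i v)))"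
      using True by (simp add: zc_def rhom_simps[OF rhom_ev[OF rhom_kc]])
    also have "\<dots> = - (\<Sum>i\<in>B - P. s i * (pev kc ?y dY * mY i v))"
      using True by (intro arg_cong[of _ _ uminus] sum.cong refl)
        (simp add: s0 pev[OF mu(1)] mu_at[OF yL par_relY])
    finally show ?thesis using True by (simp add: par_def sum_distrib_left sum_distrib_right mult_ac)
  next
    case False
    then show ?thesis using v s0[of v] pev[OF dY(1)]
      by (simp add: zc_def par_def rhom_simps[OF rhom_ev[OF rhom_kc]] mult.commute)
  qed
  have "Em (pev cg zc f) = pev kc (\<lambda>v. Em (zc v)) f" by (rule X.pev_Em[symmetric])
  also have "\<dots> = pev kc (\<lambda>v. pev kc Y.gx dY * z v) f" by (rule ev_form_cong[OF f(1) Em_zc])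
  also have "\<dots> = 0" unfolding ev_forms_scale[OF f(1)] using f(2) by simp
  finally have "pev cg zc f = 0" by (simp add: Em_eq_0_iff)
  then have "ev kc u (pev cg zc f) = 0" by (simp add: rhom_0[OF rhom_ev[OF rhom_kc]])
  then have "pev kc (\<lambda>v. ev kc u (zc v)) f = 0"
    unfolding rhom_after_ev[OF rhom_ev[OF rhom_kc]] ev_const[OF rhom_kc] .
  moreover have "pev kc (\<lambda>v. ev kc u (zc v)) f = pev kc (\<lambda>v. pev kc ?y dY * par (B - P) P mY s v) f"
    by (rule ev_form_cong[OF f(1) zc])
  ultimately show ?thesis unfolding ev_forms_scale[OF f(1)] by auto
qed

text \<open>By \<open>par_mY_dense\<close> only parameters in F^p matter, and
  \<open>special_z\<close> handles them except where \<open>dY\<close> vanishes. The exception is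
  removed on the line that joins them to a parameter where \<open>dY\<close> does not
  vanish.\<close>

theorem z_generic:
  assumes f: "f \<in> forms B n" "pev kc z f = 0"
  shows "pev kc X.gx f = 0"
proof (rule par_mY_dense[OF f(1)])
  fix s1 assume s1: "\<And>i. i \<in> B - P \<Longrightarrow> s1 i \<in> kk"
  \<comment> \<open>The parameters of the generic point of Y, divided by \<open>Y.gx c0\<close> to
    bring them into the function field.\<close>
  define t where "t i = (if i \<in> \<sigma> ` (C - Q) then Y.gx (\<sigma>i i) / Y.gx c0 else 0)" for i
  have tL: "t i \<in> Y.Lf" for i
    using Y.Lf_ratio[OF _ Y.b0] \<sigma>i(2)[of i] subfld_0[OF Y.subfld_Lf] by (auto simp: t_def)
  have s1L: "s1 i \<in> Y.Lf" if "i \<in> B - P" for i using s1[OF that] Y.Lf_kc by (elim rangeE) simp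
  let ?s = "\<lambda>c i. t i + c * (s1 i - t i)"
  obtain h1 where h1: "\<And>c. pev kc (par (C - Q) Q nY (\<lambda>j. ?s c (\<sigma> j))) dY = poly h1 c"
    unfolding par_line using ev_line[OF kev] by blast
  obtain h2 where h2: "\<And>c. pev kc (par (B - P) P mY (?s c)) f = poly h2 c"
    unfolding par_line using ev_line[OF kev] by blast
  have "par (C - Q) Q nY (\<lambda>j. t (\<sigma> j)) w = inverse (Y.gx c0) * Y.gx w" if "w \<in> C" for w
  proof -
    have "par (C - Q) Q nY (\<lambda>j. t (\<sigma> j)) w = par (C - Q) Q nY (\<lambda>j. inverse (Y.gx c0) * Y.gx j) w"
      using that by (auto simp: par_def t_def \<sigma>i(1) divide_inverse mult.commute intro!: sum.cong)
    then show ?thesis unfolding par_scale par_gy[OF that] .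
  qed
  then have "poly h1 0 = inverse (Y.gx c0) ^ eY * pev kc Y.gx dY"
    unfolding h1[symmetric] ev_forms_scale[OF dY(1), symmetric] by (intro ev_form_cong[OF dY(1)]) simp
  then have "poly h1 0 \<noteq> 0" using dY(2) Y.gx_nz[OF Y.b0] by simp
  then have "h1 \<noteq> 0" by auto
  have "poly (h1 * h2) c = 0" if "c \<in> kk" for c
  proof -
    have "c \<in> Y.Lf" using that Y.Lf_kc by (elim rangeE) simp
    then have "?s c i \<in> Y.Lf" if "i \<in> B - P" for i
      using that tL s1L by (intro subfld_closed Y.subfld_Lf) auto
    then have "poly h1 c = 0 \<or> poly h2 c = 0"
      unfolding h1[symmetric] h2[symmetric] by (rule special_z[OF f])
    then show ?thesis by simp
  qed
  then have "kk \<subseteq> {c. poly (h1 * h2) c = 0}" by blast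
  then have "h1 * h2 = 0" using X.infinite_kk poly_roots_finite finite_subset by blast
  then have "poly h2 1 = 0" using \<open>h1 \<noteq> 0\<close> by simp
  then show "pev kc (par (B - P) P mY s1) f = 0" unfolding h2[symmetric] by simp
qed

lemma z_dX: "pev kc z dX \<noteq> 0"
  using z_generic[OF dX(1)] dX(2) by blast

text \<open>The coordinates of \<open>z\<close> are outside the reach of \<open>nu_at\<close>, which
  asks for the function field of Y. For parameters in F^p it applies, and the identity is polynomial
  in the parameters.\<close>

lemma nu_at_z:
  assumes j: "j \<in> C - Q" "l \<in> Q"
  shows "pev kc z (nu j l) = pev kc z dX * nY j l"
proof -
  have "pev kc (par (B - P) P mY (\<lambda>i. Em (s0 i))) (nu j l)
    - pev kc (par (B - P) P mY (\<lambda>i. Em (s0 i))) dX * nY j l = 0"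
  proof (rule vanish_on_lines[of "\<lambda>t. pev kc (par (B - P) P mY t) (nu j l) - pev kc (par (B - P) P mY t) dX * nY j l"
        kk "B - P"])
    show "\<exists>q. \<forall>s. pev kc (par (B - P) P mY (\<lambda>i. x i + s * y i)) (nu j l)
        - pev kc (par (B - P) P mY (\<lambda>i. x i + s * y i)) dX * nY j l = poly q s" for x y
    proof -
      obtain q1 where q1: "\<And>s. pev kc (par (B - P) P mY (\<lambda>i. x i + s * y i)) (nu j l) = poly q1 s"
        unfolding par_line using ev_line[OF kev] by blast
      obtain q2 where q2: "\<And>s. pev kc (par (B - P) P mY (\<lambda>i. x i + s * y i)) dX = poly q2 s"
        unfolding par_line using ev_line[OF kev] by blast
      show ?thesis by (intro exI[of _ "q1 - q2 * [:nY j l:]"]) (simp add: q1 q2)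
    qed
    show "finite (B - P)" using X.finB by simp
    fix t assume t: "\<And>i. i \<in> B - P \<Longrightarrow> t i \<in> kk"
    have tL: "t i \<in> Y.Lf" if "i \<in> B - P" for i using t[OF that] Y.Lf_kc by (elim rangeE) simp
    have "par (B - P) P mY t v \<in> Y.Lf" if "v \<in> B" for v
      using that tL mY(1) unfolding par_def
      by (auto intro!: subfld_uminus[OF Y.subfld_Lf] subfld_sum[OF Y.subfld_Lf] subfld_mult[OF Y.subfld_Lf])
    from nu_at[OF this par_relX j]
    show "pev kc (par (B - P) P mY t) (nu j l) - pev kc (par (B - P) P mY t) dX * nY j l = 0" by simp
  qed (rule X.infinite_kk)
  then show ?thesis by (simp add: z_def)
qed

lemma z_\<sigma>: "j \<in> C - Q \<Longrightarrow> z (\<sigma> j) = Y.gx j"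
  using \<sigma> \<sigma>i(1)[of j] by (auto simp: z_def par_def s0_def Y.gx_def)

text \<open>The basis coordinates of the generic point of Y are recovered from \<open>z\<close>: the
  map back to Y inverts the one that produced \<open>z\<close>.\<close>

lemma gy_from_z:
  assumes "l \<in> Q"
  shows "- (\<Sum>j\<in>C - Q. z (\<sigma> j) * pev kc z (nu j l)) = pev kc z dX * Y.gx l"
proof -
  have "pev kc z dX * Y.gx l = pev kc z dX * par (C - Q) Q nY Y.gx l"
    using par_gy[of l] assms QC by auto
  also have "\<dots> = - (\<Sum>j\<in>C - Q. pev kc z dX * (Y.gx j * nY j l))"
    using assms by (simp add: par_def sum_distrib_left)
  also have "\<dots> = - (\<Sum>j\<in>C - Q. z (\<sigma> j) * (pev kc z dX * nY j l))"
    by (simp add: z_\<sigma> mult_ac)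
  also have "\<dots> = - (\<Sum>j\<in>C - Q. z (\<sigma> j) * pev kc z (nu j l))"
    using assms by (simp add: nu_at_z)
  finally show ?thesis by simp
qed

text \<open>Otherwise the \<open>card B - 1\<close> independent coordinates of \<open>z\<close> would generate a purely transcendental
  extension of larger degree, and a nonzero derivation would vanish on it.\<close>

theorem \<sigma>_surj:
  assumes card: "card B = card C"
  shows "\<sigma> ` (C - Q) = B - P"
proof (rule ccontr)
  let ?R = "B - P - \<sigma> ` (C - Q)"
  assume "\<sigma> ` (C - Q) \<noteq> B - P"
  then have "?R \<noteq> {}" using \<sigma> by blast
  have finR: "finite ?R" using X.finB by simp
  \<comment> \<open>The variables involved in \<open>z\<close>: card C - 1 for the generic point of
    Y and one for each leftover coordinate, hence more than card B - 1.\<close>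
  define K where "K = iy ` (C - {c0}) \<union> tv ` ?R"
  have finK: "finite K" using Y.finB finR by (simp add: K_def)
  have "card K = card (iy ` (C - {c0})) + card (tv ` ?R)"
    unfolding K_def by (rule card_Un_disjoint) (use Y.finB finR tv(2) in auto)
  also have "card (iy ` (C - {c0})) = card C - 1"
    using Y.finB Y.b0 by (simp add: card_image[OF Y.inj_ix])
  finally have "card (B - {b0}) + card (tv ` ?R) = card K" using card X.finB X.b0 by simp
  moreover have "card (tv ` ?R) > 0" using \<open>?R \<noteq> {}\<close> finR by (simp add: card_gt_0_iff)
  ultimately have "card (B - {b0}) < card K" by simp
  let ?\<delta> = "pev cg Y.gp dY"
  \<comment> \<open>By the quotient rule this is the derivative of \<open>z v\<close> with respect
    to X_k, up to the square of the denominator.\<close>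
  let ?M = "\<lambda>v k. Em (X.dg k (zc v)) * Em ?\<delta> - Em (zc v) * Em (X.dg k ?\<delta>)"
  obtain c where c: "\<exists>k\<in>K. c k \<noteq> 0" "\<forall>v\<in>B - {b0}. (\<Sum>k\<in>K. c k * ?M v k) = 0"
    using homogeneous_system[of "B - {b0}" K ?M] X.finB finK \<open>card (B - {b0}) < card K\<close> by auto
  let ?T = "X.kerd K c"
  note T = X.subfld_kerd[of K c]
  have \<delta>: "?\<delta> \<noteq> 0" using dY(2) by (auto simp: pev_gx Em_eq_0_iff)
  have zT0: "z v \<in> ?T" if v: "v \<in> B - {b0}" for v
  proof -
    have "X.derc K c (zc v) * Em ?\<delta> - Em (zc v) * X.derc K c ?\<delta> = (\<Sum>k\<in>K. c k * ?M v k)"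
      by (simp add: X.derc_def sum_distrib_left sum_distrib_right sum_subtractf right_diff_distrib mult_ac)
    then have "Em (zc v) / Em ?\<delta> \<in> ?T" using c(2) v \<delta> by (intro X.kerdI) auto
    moreover have "z v = Em (zc v) / Em ?\<delta>" using Em_zc[of v] v \<delta> dY(2) by (simp add: pev_gx)
    ultimately show ?thesis by simp
  qed
  have "z b0 \<in> ?T"
  proof -
    have "kc (a b0) * z b0 = - (\<Sum>v\<in>B - {b0}. kc (a v) * z v)"
      using z_rel unfolding X.sum_b0 by (simp add: eq_neg_iff_add_eq_0)
    then have "z b0 = - (\<Sum>v\<in>B - {b0}. kc (a v) * z v) / kc (a b0)"
      using X.a_nz[OF X.b0] by (simp add: field_simps kc_eq_0_iff)
    also have "\<dots> \<in> ?T" by (intro subfld_closed T X.kerd_kc zT0)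
    finally show ?thesis .
  qed
  then have zT: "z v \<in> ?T" if "v \<in> B" for v using zT0 that by (cases "v = b0") auto
  have pevT: "pev kc z f \<in> ?T" if "f \<in> forms B n" for f n
    by (rule subfld_ev[OF T X.kerd_kc forms_CR[OF that] zT])
  \<comment> \<open>The generic point of Y is rational in \<open>z\<close> over F, by
    \<open>z_\<sigma>\<close> and \<open>gy_from_z\<close>, so it consists of constants as
    well.\<close>
  have yT: "Y.gx w \<in> ?T" if "w \<in> C" for w
  proof (cases "w \<in> Q")
    case True
    have "- (\<Sum>j\<in>C - Q. z (\<sigma> j) * pev kc z (nu j w)) / pev kc z dX \<in> ?T"
      using \<sigma> True by (intro subfld_closed T zT pevT[OF nu(1)] pevT[OF dX(1)]) auto
    then show ?thesis unfolding gy_from_z[OF True] using z_dX by simp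
  next
    case False
    then show ?thesis using that z_\<sigma>[of w] zT[of "\<sigma> w"] \<sigma> by auto
  qed
  have "c k = 0" if kK: "k \<in> K" for k
  proof -
    have "Xf k \<in> ?T"
    proof (cases "k \<in> tv ` ?R")
      case True
      then obtain i where i: "i \<in> ?R" "k = tv i" by auto
      then have "z i = Xf k" by (auto simp: z_def par_def s0_def Xf_def)
      then show ?thesis using zT[of i] i by simp
    next
      case False
      then obtain w where "w \<in> C - {c0}" "k = iy w" using kK by (auto simp: K_def)
      then have "Y.gx w = Xf k" by (simp add: Y.gx_def Y.gp_def Xf_def)
      then show ?thesis using yT[of w] \<open>w \<in> C - {c0}\<close> by simp
    qed
    then show ?thesis by (rule X.kerd_var[OF finK _ kK])
  qed
  then show False using c(1) by blast
qed

abbreviation vr :: "'u \<Rightarrow> ('u, 'k) mpoly" where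
  "vr v \<equiv> Poly_Mapping.single (Poly_Mapping.single v (Suc 0)) 1"

text \<open>\<open>H\<close> is the map from Y to X and \<open>G\<close> the map back, cleared of
  denominators. Each coordinate is a variable times an entry or a sum of such products, which
  accounts for the degrees 1 + \<open>eY\<close> and 1 + \<open>eX\<close>.\<close>

theorem birational_polys:
  assumes surj: "\<sigma> ` (C - Q) = B - P"
  shows "\<exists>G D H D' q' m. m + 1 = D * D' \<and> (\<forall>w\<in>C. G w \<in> forms B D) \<and> (\<forall>v\<in>B. H v \<in> forms C D') \<and>
    q' \<in> forms C m \<and> pev kc Y.gx q' \<noteq> 0 \<and>
    (\<Sum>v\<in>B. kc (a v) * pev kc Y.gx (H v)) = 0 \<and>
    (\<forall>n. \<forall>f\<in>forms B n. pev kc (\<lambda>v. pev kc Y.gx (H v)) f = 0 \<longrightarrow> pev kc X.gx f = 0) \<and>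
    (\<forall>w\<in>C. pev kc (\<lambda>v. pev kc Y.gx (H v)) (G w) = pev kc Y.gx q' * Y.gx w)"
proof -
  define H where "H v = (if v \<in> P then - (\<Sum>i\<in>B - P. vr (\<sigma>i i) * mu i v) else vr (\<sigma>i v) * dY)" for v
  define G where "G w = (if w \<in> Q then - (\<Sum>j\<in>C - Q. vr (\<sigma> j) * nu j w) else vr (\<sigma> w) * dX)" for w
  \<comment> \<open>The common factor of \<open>G\<close> after \<open>H\<close>: one
    \<open>dY\<close> from the free coordinates and the pull-back of the denominator
    \<open>dX\<close>. Its degree is one less than that of the composite.\<close>
  define q' where "q' = dY * psubst H dX"
  have \<sigma>iC: "\<sigma>i i \<in> C" if "i \<in> B - P" for i using \<sigma>i(2)[of i] that surj by auto
  have H: "H v \<in> forms C (1 + eY)" if "v \<in> B" for v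
    using that forms_mult[OF forms_var[OF \<sigma>iC] mu(1)] forms_mult[OF forms_var[OF \<sigma>iC] dY(1)]
    unfolding H_def by (auto intro!: forms_uminus forms_sum)
  have \<sigma>B: "\<sigma> j \<in> B" if "j \<in> C - Q" for j using that \<sigma> by auto
  have G: "G w \<in> forms B (1 + eX)" if "w \<in> C" for w
    using that forms_mult[OF forms_var[OF \<sigma>B] nu(1)] forms_mult[OF forms_var[OF \<sigma>B] dX(1)]
    unfolding G_def by (auto intro!: forms_uminus forms_sum)
  have q': "q' \<in> forms C (eY + eX * (1 + eY))"
    unfolding q'_def by (intro forms_mult dY(1) psubst_forms[OF H dX(1)])
  let ?d = "pev kc Y.gx dY"
  have zs: "z i = Y.gx (\<sigma>i i)" if "i \<in> B - P" for i
    using z_\<sigma>[OF \<sigma>i(2)[of i]] \<sigma>i(3)[of i] that surj by auto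
  have Hev: "pev kc Y.gx (H v) = ?d * z v" if v: "v \<in> B" for v
  proof (cases "v \<in> P")
    case True
    have "pev kc Y.gx (H v) = - (\<Sum>i\<in>B - P. Y.gx (\<sigma>i i) * pev kc Y.gx (mu i v))"
      using True by (simp add: H_def rhom_simps[OF rhom_ev[OF kev]] ev_var[OF kev])
    also have "\<dots> = - (\<Sum>i\<in>B - P. z i * (mY i v * ?d))"
      using True by (simp add: mu(2) zs)
    also have "\<dots> = ?d * par (B - P) P mY z v" using True by (simp add: par_def sum_distrib_left mult_ac)
    also have "par (B - P) P mY z v = z v" using True by (simp add: par_def z_def)
    finally show ?thesis .
  next
    case False
    then show ?thesis using v zs[of v]
      by (simp add: H_def rhom_simps[OF rhom_ev[OF kev]] ev_var[OF kev] mult.commute)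
  qed
  have pevH: "pev kc (\<lambda>v. pev kc Y.gx (H v)) f = ?d ^ n * pev kc z f" if "f \<in> forms B n" for f n
    unfolding ev_forms_scale[OF that, symmetric] by (rule ev_form_cong[OF that Hev])
  have q'ev: "pev kc Y.gx q' = ?d * (?d ^ eX * pev kc z dX)"
    by (simp add: q'_def rhom_mult[OF rhom_ev[OF kev]] ev_psubst[OF kev] pevH[OF dX(1)])
  have Gz: "pev kc z (G w) = pev kc z dX * Y.gx w" if "w \<in> C" for w
  proof (cases "w \<in> Q")
    case True
    then show ?thesis unfolding gy_from_z[OF True, symmetric]
      by (simp add: G_def rhom_simps[OF rhom_ev[OF kev]] ev_var[OF kev])
  next
    case False
    then show ?thesis using that z_\<sigma>[of w]
      by (simp add: G_def rhom_simps[OF rhom_ev[OF kev]] ev_var[OF kev] mult.commute)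
  qed
  have r1: "(\<Sum>v\<in>B. kc (a v) * pev kc Y.gx (H v)) = 0"
  proof -
    have "(\<Sum>v\<in>B. kc (a v) * pev kc Y.gx (H v)) = ?d * (\<Sum>v\<in>B. kc (a v) * z v)"
      by (simp add: Hev sum_distrib_left mult_ac)
    then show ?thesis using z_rel by simp
  qed
  have r2: "pev kc X.gx f = 0" if "f \<in> forms B n" "pev kc (\<lambda>v. pev kc Y.gx (H v)) f = 0" for f n
    using that(2) dY(2) z_generic[OF that(1)] unfolding pevH[OF that(1)] by simp
  have r3: "pev kc (\<lambda>v. pev kc Y.gx (H v)) (G w) = pev kc Y.gx q' * Y.gx w" if "w \<in> C" for w
    unfolding pevH[OF G[OF that]] Gz[OF that] q'ev by (simp add: mult_ac)
  have r4: "pev kc Y.gx q' \<noteq> 0" unfolding q'ev using dY(2) z_dX by simp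
  show ?thesis
    by (rule exI[of _ G], rule exI[of _ "1 + eX"], rule exI[of _ H], rule exI[of _ "1 + eY"],
        rule exI[of _ q'], rule exI[of _ "eY + eX * (1 + eY)"])
       (use G H q' r1 r2 r3 r4 in auto)
qed

end

text \<open>Transfer of independence in both directions makes bases that are maximal over one
  function field maximal over the other. The smaller set of free coordinates is mapped injectively
  into the larger one, and equal dimensions force a bijection.\<close>

theorem birational_polys_exist:
  fixes B :: "'v set" and C :: "'w set" and a :: "'v \<Rightarrow> 'k::field" and b :: "'w \<Rightarrow> 'k"
  assumes XY: "qpair p B a ix b0 C b iy c0" and YX: "qpair p C b iy c0 B a ix b0"
    and card: "card B = card C"
  shows "\<exists>G D H D' q' m. m + 1 = D * D' \<and> (\<forall>w\<in>C. G w \<in> forms B D) \<and> (\<forall>v\<in>B. H v \<in> forms C D') \<and>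
    q' \<in> forms C m \<and> ev (\<lambda>c. kc (c ^ p)) (qform.gx C b iy c0) q' \<noteq> 0 \<and>
    (\<Sum>v\<in>B. kc (a v) * ev (\<lambda>c. kc (c ^ p)) (qform.gx C b iy c0) (H v)) = 0 \<and>
    (\<forall>n. \<forall>f\<in>forms B n. ev (\<lambda>c. kc (c ^ p)) (\<lambda>v. ev (\<lambda>c. kc (c ^ p)) (qform.gx C b iy c0) (H v)) f = 0 \<longrightarrow>
      ev (\<lambda>c. kc (c ^ p)) (qform.gx B a ix b0) f = 0) \<and>
    (\<forall>w\<in>C. ev (\<lambda>c. kc (c ^ p)) (\<lambda>v. ev (\<lambda>c. kc (c ^ p)) (qform.gx C b iy c0) (H v)) (G w)
      = ev (\<lambda>c. kc (c ^ p)) (qform.gx C b iy c0) q' * qform.gx C b iy c0 w)"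
proof -
  interpret XY: qpair p B a ix b0 C b iy c0 by (rule XY)
  interpret YX: qpair p C b iy c0 B a ix b0 by (rule YX)
  let ?LX = XY.X.Lf and ?LY = XY.Y.Lf
  obtain P where P: "P \<subseteq> B" "indp ?LX (\<lambda>v. kc (a v)) P"
    "\<And>i. i \<in> B - P \<Longrightarrow> \<not> indp ?LX (\<lambda>v. kc (a v)) (insert i P)"
    using maximal_indp[OF XY.X.finB] by blast
  obtain Q where Q: "Q \<subseteq> C" "indp ?LX (\<lambda>v. kc (b v)) Q"
    "\<And>i. i \<in> C - Q \<Longrightarrow> \<not> indp ?LX (\<lambda>v. kc (b v)) (insert i Q)"
    using maximal_indp[OF XY.Y.finB] by blast
  have finP: "finite P" using P(1) XY.X.finB by (rule finite_subset)
  have finQ: "finite Q" using Q(1) XY.Y.finB by (rule finite_subset)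
  have PY: "indp ?LY (\<lambda>v. kc (a v)) P" by (rule XY.indp_transfer[OF finP P(2)])
  have QY: "indp ?LY (\<lambda>v. kc (b v)) Q" by (rule XY.indp_transfer[OF finQ Q(2)])
  have P3: "\<not> indp ?LY (\<lambda>v. kc (a v)) (insert i P)" if "i \<in> B - P" for i
    using P(3)[OF that] YX.indp_transfer[of "insert i P" a] finP by blast
  have Q3: "\<not> indp ?LY (\<lambda>v. kc (b v)) (insert i Q)" if "i \<in> C - Q" for i
    using Q(3)[OF that] YX.indp_transfer[of "insert i Q" b] finQ by blast
  have "\<forall>i\<in>B - P. \<exists>m. (\<forall>l\<in>P. m l \<in> ?LX) \<and> kc (a i) = (\<Sum>l\<in>P. kc (a l) * m l)"
    using dependent_combination[OF XY.X.subfld_Lf finP P(2) _ P(3)] by simp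
  then obtain mX where mX: "\<forall>i\<in>B - P. (\<forall>l\<in>P. mX i l \<in> ?LX) \<and> kc (a i) = (\<Sum>l\<in>P. kc (a l) * mX i l)"
    by (rule bchoice[THEN exE])
  have "\<forall>i\<in>B - P. \<exists>m. (\<forall>l\<in>P. m l \<in> ?LY) \<and> kc (a i) = (\<Sum>l\<in>P. kc (a l) * m l)"
    using dependent_combination[OF XY.Y.subfld_Lf finP PY _ P3] by simp
  then obtain mY where mY: "\<forall>i\<in>B - P. (\<forall>l\<in>P. mY i l \<in> ?LY) \<and> kc (a i) = (\<Sum>l\<in>P. kc (a l) * mY i l)"
    by (rule bchoice[THEN exE])
  have "\<forall>i\<in>C - Q. \<exists>m. (\<forall>l\<in>Q. m l \<in> ?LX) \<and> kc (b i) = (\<Sum>l\<in>Q. kc (b l) * m l)"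
    using dependent_combination[OF XY.X.subfld_Lf finQ Q(2) _ Q(3)] by simp
  then obtain nX where nX: "\<forall>i\<in>C - Q. (\<forall>l\<in>Q. nX i l \<in> ?LX) \<and> kc (b i) = (\<Sum>l\<in>Q. kc (b l) * nX i l)"
    by (rule bchoice[THEN exE])
  have "\<forall>i\<in>C - Q. \<exists>m. (\<forall>l\<in>Q. m l \<in> ?LY) \<and> kc (b i) = (\<Sum>l\<in>Q. kc (b l) * m l)"
    using dependent_combination[OF XY.Y.subfld_Lf finQ QY _ Q3] by simp
  then obtain nY where nY: "\<forall>i\<in>C - Q. (\<forall>l\<in>Q. nY i l \<in> ?LY) \<and> kc (b i) = (\<Sum>l\<in>Q. kc (b l) * nY i l)"
    by (rule bchoice[THEN exE])
  have "finite ((C - Q) \<times> Q)" "finite ((B - P) \<times> P)" using finP finQ XY.X.finB XY.Y.finB by auto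
  moreover have "(case i of (j, l) \<Rightarrow> nX j l) \<in> ?LX" if "i \<in> (C - Q) \<times> Q" for i using that nX by auto
  ultimately obtain eX dX nu where dX: "dX \<in> forms B eX" "XY.pev kc XY.X.gx dX \<noteq> 0"
    "\<And>i. i \<in> (C - Q) \<times> Q \<Longrightarrow> nu i \<in> forms B eX"
    "\<And>i. i \<in> (C - Q) \<times> Q \<Longrightarrow> (case i of (j, l) \<Rightarrow> nX j l) * XY.pev kc XY.X.gx dX = XY.pev kc XY.X.gx (nu i)"
    using XY.X.Lf_common_denominator[of "(C - Q) \<times> Q" "\<lambda>i. case i of (j, l) \<Rightarrow> nX j l"] by metis
  have "(case i of (j, l) \<Rightarrow> mY j l) \<in> ?LY" if "i \<in> (B - P) \<times> P" for i using that mY by auto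
  with \<open>finite ((B - P) \<times> P)\<close> obtain eY dY mu where dY: "dY \<in> forms C eY" "XY.pev kc XY.Y.gx dY \<noteq> 0"
    "\<And>i. i \<in> (B - P) \<times> P \<Longrightarrow> mu i \<in> forms C eY"
    "\<And>i. i \<in> (B - P) \<times> P \<Longrightarrow> (case i of (j, l) \<Rightarrow> mY j l) * XY.pev kc XY.Y.gx dY = XY.pev kc XY.Y.gx (mu i)"
    using XY.Y.Lf_common_denominator[of "(B - P) \<times> P" "\<lambda>i. case i of (j, l) \<Rightarrow> mY j l"] by metis
  let ?nu = "\<lambda>j l. nu (j, l)" and ?mu = "\<lambda>j l. mu (j, l)"
  interpret bXY: qbase p B a ix b0 C b iy c0 P Q mX mY nX nY dX eX ?nu dY eY ?mu
  proof
    show "nX j l * XY.pev kc XY.X.gx dX = XY.pev kc XY.X.gx (nu (j, l))" if "j \<in> C - Q" "l \<in> Q" for j l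
      using dX(4)[of "(j, l)"] that by simp
    show "mY i l * XY.pev kc XY.Y.gx dY = XY.pev kc XY.Y.gx (mu (i, l))" if "i \<in> B - P" "l \<in> P" for i l
      using dY(4)[of "(i, l)"] that by simp
  qed (use P Q PY QY mX mY nX nY dX dY in auto)
  interpret bYX: qbase p C b iy c0 B a ix b0 Q P nY nX mY mX dY eY ?mu dX eX ?nu
  proof
    show "mY j l * XY.pev kc XY.Y.gx dY = XY.pev kc XY.Y.gx (mu (j, l))" if "j \<in> B - P" "l \<in> P" for j l
      using dY(4)[of "(j, l)"] that by simp
    show "nX i l * XY.pev kc XY.X.gx dX = XY.pev kc XY.X.gx (nu (i, l))" if "i \<in> C - Q" "l \<in> Q" for i l
      using dX(4)[of "(i, l)"] that by simp
  qed (use P Q PY QY mX mY nX nY dX dY in auto)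
  have fresh: "\<exists>tv::'u \<Rightarrow> nat. inj_on tv U \<and> tv ` U \<inter> J = {}" if "finite U" "finite J" for U :: "'u set" and J
  proof -
    obtain h where h: "bij_betw h U {0..<card U}" using ex_bij_betw_finite_nat[OF \<open>finite U\<close>] by blast
    have "inj_on (\<lambda>i. Suc (Max J) + h i) U" using h by (auto simp: bij_betw_def inj_on_def)
    moreover have "Suc (Max J) + n \<notin> J" for n
    proof
      assume "Suc (Max J) + n \<in> J"
      then have "Suc (Max J) + n \<le> Max J" using Max_ge[OF \<open>finite J\<close>] by blast
      then show False by simp
    qed
    then have "(\<lambda>i. Suc (Max J) + h i) ` U \<inter> J = {}" by blast
    ultimately show ?thesis by (intro exI conjI)
  qed
  have fin: "finite (C - Q)" "finite (B - P)" using XY.X.finB XY.Y.finB by auto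
  show ?thesis
  proof (cases "card (C - Q) \<le> card (B - P)")
    case True
    then obtain \<sigma> where \<sigma>: "\<sigma> ` (C - Q) \<subseteq> B - P" "inj_on \<sigma> (C - Q)" using card_le_inj[OF fin] by blast
    obtain tv where tv: "inj_on tv (B - P - \<sigma> ` (C - Q))" "tv ` (B - P - \<sigma> ` (C - Q)) \<inter> iy ` C = {}"
      using fresh[of "B - P - \<sigma> ` (C - Q)" "iy ` C"] fin XY.Y.finB by auto
    interpret qsub p B a ix b0 C b iy c0 P Q mX mY nX nY dX eX ?nu dY eY ?mu \<sigma> tv
      by unfold_locales (use \<sigma> tv in auto)
    show ?thesis by (rule birational_polys[OF \<sigma>_surj[OF card]])
  next
    \<comment> \<open>With X and Y exchanged, surjectivity contradicts the strict inequality of the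
      two cardinalities.\<close>
    case False
    then obtain \<sigma> where \<sigma>: "\<sigma> ` (B - P) \<subseteq> C - Q" "inj_on \<sigma> (B - P)" using card_le_inj[OF fin(2,1)] by auto
    obtain tv where tv: "inj_on tv (C - Q - \<sigma> ` (B - P))" "tv ` (C - Q - \<sigma> ` (B - P)) \<inter> ix ` B = {}"
      using fresh[of "C - Q - \<sigma> ` (B - P)" "ix ` B"] fin XY.X.finB by auto
    note inj = \<sigma>(2)
    interpret qsub p C b iy c0 B a ix b0 Q P nY nX mY mX dY eY ?mu dX eX ?nu \<sigma> tv
      by unfold_locales (use \<sigma> tv in auto)
    have "card (C - Q) = card (\<sigma> ` (B - P))" using \<sigma>_surj[OF card[symmetric]] by simp
    then show ?thesis using False card_image[OF inj] by simp
  qed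
qed

section \<open>Projective spectra embedded in a field\<close>

text \<open>All stalks become subrings of one field. Injectivity is required degree by degree, which
  is what comparing degree-zero fractions uses.\<close>

locale graded_in_field =
  fixes S :: "'s ring" and D :: "nat \<Rightarrow> 's set" and \<kappa> :: "'k \<Rightarrow> 's" and e :: "'s \<Rightarrow> 'o::field"
  assumes S: "cring S"
    and D_sub: "D n \<subseteq> carrier S"
    and D_add: "a \<in> D n \<Longrightarrow> b \<in> D n \<Longrightarrow> a \<oplus>\<^bsub>S\<^esub> b \<in> D n"
    and D_mult: "a \<in> D n \<Longrightarrow> b \<in> D m \<Longrightarrow> a \<otimes>\<^bsub>S\<^esub> b \<in> D (n + m)"
    and D_one: "\<one>\<^bsub>S\<^esub> \<in> D 0" and D_zero: "\<zero>\<^bsub>S\<^esub> \<in> D n"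
    and D_\<kappa>: "\<kappa> c \<in> D 0"
    and e_add: "a \<in> carrier S \<Longrightarrow> b \<in> carrier S \<Longrightarrow> e (a \<oplus>\<^bsub>S\<^esub> b) = e a + e b"
    and e_mult: "a \<in> carrier S \<Longrightarrow> b \<in> carrier S \<Longrightarrow> e (a \<otimes>\<^bsub>S\<^esub> b) = e a * e b"
    and e_one: "e \<one>\<^bsub>S\<^esub> = 1"
    and e_inj: "a \<in> D n \<Longrightarrow> b \<in> D n \<Longrightarrow> e a = e b \<Longrightarrow> a = b"
begin

sublocale cring S by (rule S)

lemma D_carrier: "a \<in> D n \<Longrightarrow> a \<in> carrier S"
  using D_sub by blast

lemma e_zero: "e \<zero>\<^bsub>S\<^esub> = 0"
proof -
  have "e \<zero>\<^bsub>S\<^esub> = e \<zero>\<^bsub>S\<^esub> + e \<zero>\<^bsub>S\<^esub>" by (metis e_add l_zero zero_closed)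
  then show ?thesis by (metis add_0_right add_left_cancel)
qed

lemma e_minus: assumes "a \<in> carrier S" "b \<in> carrier S" shows "e (a \<ominus>\<^bsub>S\<^esub> b) = e a - e b"
proof -
  have "(a \<ominus>\<^bsub>S\<^esub> b) \<oplus>\<^bsub>S\<^esub> b = a" using assms by algebra
  then show ?thesis using e_add[of "a \<ominus>\<^bsub>S\<^esub> b" b] assms by (simp add: eq_diff_eq)
qed

abbreviation points where "points \<equiv> proj_points S D"

lemma point_prime: "P \<in> points \<Longrightarrow> primeideal P S"
  by (simp add: proj_points_def)

lemma point_zero: "P \<in> points \<Longrightarrow> \<zero>\<^bsub>S\<^esub> \<in> P"
  using point_prime primeideal.axioms(1) ideal.axioms(1) additive_subgroup.zero_closed by metis

lemma point_one: assumes "P \<in> points" shows "\<one>\<^bsub>S\<^esub> \<notin> P"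
  using ideal.one_imp_carrier[OF primeideal.axioms(1)[OF point_prime[OF assms]]]
    primeideal.I_notcarr[OF point_prime[OF assms]] by auto

lemma point_mult:
  assumes "P \<in> points" "f \<in> carrier S" "g \<in> carrier S"
  shows "f \<otimes>\<^bsub>S\<^esub> g \<in> P \<longleftrightarrow> f \<in> P \<or> g \<in> P"
proof -
  note P = point_prime[OF assms(1)]
  note I = primeideal.axioms(1)[OF P]
  show ?thesis
    using primeideal.I_prime[OF P assms(2,3)] ideal.I_l_closed[OF I _ assms(2), of g]
      ideal.I_r_closed[OF I _ assms(3), of f] by argo
qed

lemma e_nz: assumes "P \<in> points" "f \<in> D n" "f \<notin> P" shows "e f \<noteq> 0"
  using e_inj[OF assms(2) D_zero] assms point_zero e_zero by metis

abbreviation pairs where "pairs \<equiv> fraction_pairs D"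

lemma pairsI: "a \<in> D n \<Longrightarrow> f \<in> D n \<Longrightarrow> f \<notin> P \<Longrightarrow> (a, f) \<in> pairs P"
  by (auto simp: fraction_pairs_def)

lemma pairsE:
  assumes "(a, f) \<in> pairs P" obtains n where "a \<in> D n" "f \<in> D n" "f \<notin> P"
  using assms by (auto simp: fraction_pairs_def)

text \<open>The germ at \<open>P\<close> with value \<omega> in the field; \<open>loc P\<close> is
  the set of values that occur, the local ring as a subset of the field.\<close>

definition cl :: "'s set \<Rightarrow> 'o \<Rightarrow> ('s \<times> 's) set" where
  "cl P \<omega> = {(b, g) \<in> pairs P. e b / e g = \<omega>}"

definition loc :: "'s set \<Rightarrow> 'o set" where
  "loc P = {e a / e f | a f. (a, f) \<in> pairs P}"

lemma locI: "a \<in> D n \<Longrightarrow> f \<in> D n \<Longrightarrow> f \<notin> P \<Longrightarrow> e a / e f \<in> loc P"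
  unfolding loc_def using pairsI by blast

lemma locE:
  assumes "\<omega> \<in> loc P" obtains a f n where "a \<in> D n" "f \<in> D n" "f \<notin> P" "\<omega> = e a / e f"
  using assms unfolding loc_def by (auto elim: pairsE)

lemma clE:
  assumes "(a, f) \<in> cl P \<omega>" obtains n where "a \<in> D n" "f \<in> D n" "f \<notin> P" "\<omega> = e a / e f"
  using assms unfolding cl_def by (auto elim: pairsE)

text \<open>The factor \<open>u\<close> in the equivalence of fractions can be cancelled, since
  homogeneous elements outside \<open>P\<close> have nonzero value.\<close>

lemma frac_class_eq:
  assumes P: "P \<in> points" and af: "a \<in> D n" "f \<in> D n" "f \<notin> P"
  shows "frac_class S D P a f = cl P (e a / e f)"
proof -
  have "(\<exists>u\<in>(\<Union>n. D n) - P. u \<otimes>\<^bsub>S\<^esub> (a \<otimes>\<^bsub>S\<^esub> g \<ominus>\<^bsub>S\<^esub> b \<otimes>\<^bsub>S\<^esub> f) = \<zero>\<^bsub>S\<^esub>) \<longleftrightarrow> e b / e g = e a / e f"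
    if bg: "b \<in> D m" "g \<in> D m" "g \<notin> P" for b g m
  proof -
    note c = D_carrier[OF af(1)] D_carrier[OF af(2)] D_carrier[OF bg(1)] D_carrier[OF bg(2)]
    have nz: "e f \<noteq> 0" "e g \<noteq> 0" using e_nz[OF P] af bg by auto
    have "e b / e g = e a / e f \<longleftrightarrow> e (a \<otimes>\<^bsub>S\<^esub> g) = e (b \<otimes>\<^bsub>S\<^esub> f)"
      using nz c by (auto simp: e_mult frac_eq_eq)
    also have "\<dots> \<longleftrightarrow> (\<exists>u\<in>(\<Union>n. D n) - P. u \<otimes>\<^bsub>S\<^esub> (a \<otimes>\<^bsub>S\<^esub> g \<ominus>\<^bsub>S\<^esub> b \<otimes>\<^bsub>S\<^esub> f) = \<zero>\<^bsub>S\<^esub>)"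
    proof
      assume "e (a \<otimes>\<^bsub>S\<^esub> g) = e (b \<otimes>\<^bsub>S\<^esub> f)"
      then have "a \<otimes>\<^bsub>S\<^esub> g = b \<otimes>\<^bsub>S\<^esub> f"
        using e_inj[OF D_mult[OF af(1) bg(2)], of "b \<otimes>\<^bsub>S\<^esub> f"] D_mult[OF bg(1) af(2)] by (simp add: add.commute)
      then have "\<one>\<^bsub>S\<^esub> \<otimes>\<^bsub>S\<^esub> (a \<otimes>\<^bsub>S\<^esub> g \<ominus>\<^bsub>S\<^esub> b \<otimes>\<^bsub>S\<^esub> f) = \<zero>\<^bsub>S\<^esub>" using c by (simp add: minus_eq r_neg)
      then show "\<exists>u\<in>(\<Union>n. D n) - P. u \<otimes>\<^bsub>S\<^esub> (a \<otimes>\<^bsub>S\<^esub> g \<ominus>\<^bsub>S\<^esub> b \<otimes>\<^bsub>S\<^esub> f) = \<zero>\<^bsub>S\<^esub>"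
        using D_one point_one[OF P] by blast
    next
      assume "\<exists>u\<in>(\<Union>n. D n) - P. u \<otimes>\<^bsub>S\<^esub> (a \<otimes>\<^bsub>S\<^esub> g \<ominus>\<^bsub>S\<^esub> b \<otimes>\<^bsub>S\<^esub> f) = \<zero>\<^bsub>S\<^esub>"
      then obtain u k where u: "u \<in> D k" "u \<notin> P" "u \<otimes>\<^bsub>S\<^esub> (a \<otimes>\<^bsub>S\<^esub> g \<ominus>\<^bsub>S\<^esub> b \<otimes>\<^bsub>S\<^esub> f) = \<zero>\<^bsub>S\<^esub>" by blast
      then have "e u * (e (a \<otimes>\<^bsub>S\<^esub> g) - e (b \<otimes>\<^bsub>S\<^esub> f)) = 0"
        using c D_carrier[OF u(1)] e_zero by (metis e_minus e_mult m_closed minus_closed)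
      then show "e (a \<otimes>\<^bsub>S\<^esub> g) = e (b \<otimes>\<^bsub>S\<^esub> f)" using e_nz[OF P u(1,2)] by simp
    qed
    finally show ?thesis by simp
  qed
  then have key: "(\<exists>u\<in>(\<Union>n. D n) - P. u \<otimes>\<^bsub>S\<^esub> (a \<otimes>\<^bsub>S\<^esub> g \<ominus>\<^bsub>S\<^esub> b \<otimes>\<^bsub>S\<^esub> f) = \<zero>\<^bsub>S\<^esub>) \<longleftrightarrow> e b / e g = e a / e f"
    if "(b, g) \<in> pairs P" for b g using that by (elim pairsE)
  show ?thesis unfolding frac_class_def cl_def
  proof (rule Set.set_eqI)
    fix x :: "'s \<times> 's" obtain b g where x: "x = (b, g)" by (cases x)
    show "x \<in> {(b, g) \<in> pairs P. \<exists>u\<in>(\<Union>n. D n) - P. u \<otimes>\<^bsub>S\<^esub> (a \<otimes>\<^bsub>S\<^esub> g \<ominus>\<^bsub>S\<^esub> b \<otimes>\<^bsub>S\<^esub> f) = \<zero>\<^bsub>S\<^esub>} \<longleftrightarrow>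
        x \<in> {(b, g) \<in> pairs P. e b / e g = e a / e f}"
      unfolding x mem_Collect_eq case_prod_conv by (rule conj_cong[OF refl]) (rule key)
  qed
qed

lemma stalk_carrier: "P \<in> points \<Longrightarrow> carrier (stalk S D P) = cl P ` loc P"
proof -
  assume P: "P \<in> points"
  have eq: "frac_class S D P a f = cl P (e a / e f)" if "(a, f) \<in> pairs P" for a f
    using that frac_class_eq[OF P] by (auto elim: pairsE)
  have "{frac_class S D P a f | a f. (a, f) \<in> pairs P} = {cl P (e a / e f) | a f. (a, f) \<in> pairs P}"
    by (intro Collect_cong ex_cong1) (auto simp: eq)
  then show ?thesis by (auto simp: stalk_def loc_def)
qed

lemma cl_nonempty: "\<omega> \<in> loc P \<Longrightarrow> cl P \<omega> \<noteq> {}"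
  unfolding cl_def loc_def by auto

lemma stalk_mult:
  assumes P: "P \<in> points" and \<omega>: "\<omega> \<in> loc P" "\<omega>' \<in> loc P"
  shows "cl P \<omega> \<otimes>\<^bsub>stalk S D P\<^esub> cl P \<omega>' = cl P (\<omega> * \<omega>')"
proof -
  have "frac_class S D P (a \<otimes>\<^bsub>S\<^esub> b) (f \<otimes>\<^bsub>S\<^esub> g) = cl P (\<omega> * \<omega>')"
    if af: "(a, f) \<in> cl P \<omega>" and bg: "(b, g) \<in> cl P \<omega>'" for a b f g
  proof -
    obtain n where n: "a \<in> D n" "f \<in> D n" "f \<notin> P" "\<omega> = e a / e f" using af by (rule clE)
    obtain m where m: "b \<in> D m" "g \<in> D m" "g \<notin> P" "\<omega>' = e b / e g" using bg by (rule clE)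
    note nm = n(1-3) m(1-3) n(4) m(4)
    have "f \<otimes>\<^bsub>S\<^esub> g \<notin> P" using point_mult[OF P] D_carrier nm by blast
    then show ?thesis
      using frac_class_eq[OF P D_mult[OF nm(1,4)] D_mult[OF nm(2,5)]] nm(7,8) D_carrier[OF nm(1)]
        D_carrier[OF nm(2)] D_carrier[OF nm(4)] D_carrier[OF nm(5)] by (simp add: e_mult)
  qed
  then have "(\<Union>(a, f)\<in>cl P \<omega>. \<Union>(b, g)\<in>cl P \<omega>'. frac_class S D P (a \<otimes>\<^bsub>S\<^esub> b) (f \<otimes>\<^bsub>S\<^esub> g))
    = (\<Union>x\<in>cl P \<omega>. \<Union>y\<in>cl P \<omega>'. cl P (\<omega> * \<omega>'))"
    by (intro SUP_cong refl) auto
  then show ?thesis using cl_nonempty[OF \<omega>(1)] cl_nonempty[OF \<omega>(2)] by (simp add: stalk_def)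
qed

lemma stalk_add:
  assumes P: "P \<in> points" and \<omega>: "\<omega> \<in> loc P" "\<omega>' \<in> loc P"
  shows "cl P \<omega> \<oplus>\<^bsub>stalk S D P\<^esub> cl P \<omega>' = cl P (\<omega> + \<omega>')"
proof -
  have "frac_class S D P (a \<otimes>\<^bsub>S\<^esub> g \<oplus>\<^bsub>S\<^esub> b \<otimes>\<^bsub>S\<^esub> f) (f \<otimes>\<^bsub>S\<^esub> g) = cl P (\<omega> + \<omega>')"
    if af: "(a, f) \<in> cl P \<omega>" and bg: "(b, g) \<in> cl P \<omega>'" for a b f g
  proof -
    obtain n where n: "a \<in> D n" "f \<in> D n" "f \<notin> P" "\<omega> = e a / e f" using af by (rule clE)
    obtain m where m: "b \<in> D m" "g \<in> D m" "g \<notin> P" "\<omega>' = e b / e g" using bg by (rule clE)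
    note nm = n(1-3) m(1-3) n(4) m(4)
    have "a \<otimes>\<^bsub>S\<^esub> g \<oplus>\<^bsub>S\<^esub> b \<otimes>\<^bsub>S\<^esub> f \<in> D (n + m)"
      using D_mult[OF nm(4,2)] by (intro D_add[OF D_mult[OF nm(1,5)]]) (simp add: add.commute)
    moreover have "f \<otimes>\<^bsub>S\<^esub> g \<notin> P" using point_mult[OF P] D_carrier nm by blast
    ultimately have "frac_class S D P (a \<otimes>\<^bsub>S\<^esub> g \<oplus>\<^bsub>S\<^esub> b \<otimes>\<^bsub>S\<^esub> f) (f \<otimes>\<^bsub>S\<^esub> g)
      = cl P (e (a \<otimes>\<^bsub>S\<^esub> g \<oplus>\<^bsub>S\<^esub> b \<otimes>\<^bsub>S\<^esub> f) / e (f \<otimes>\<^bsub>S\<^esub> g))"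
      by (intro frac_class_eq[OF P _ D_mult[OF nm(2,5)]])
    also have "e (a \<otimes>\<^bsub>S\<^esub> g \<oplus>\<^bsub>S\<^esub> b \<otimes>\<^bsub>S\<^esub> f) / e (f \<otimes>\<^bsub>S\<^esub> g) = \<omega> + \<omega>'"
      using e_nz[OF P nm(2,3)] e_nz[OF P nm(5,6)] nm(7,8) D_carrier[OF nm(1)] D_carrier[OF nm(2)]
        D_carrier[OF nm(4)] D_carrier[OF nm(5)] by (simp add: e_mult e_add add_frac_eq)
    finally show ?thesis .
  qed
  then have "(\<Union>(a, f)\<in>cl P \<omega>. \<Union>(b, g)\<in>cl P \<omega>'.
      frac_class S D P (a \<otimes>\<^bsub>S\<^esub> g \<oplus>\<^bsub>S\<^esub> b \<otimes>\<^bsub>S\<^esub> f) (f \<otimes>\<^bsub>S\<^esub> g))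
    = (\<Union>x\<in>cl P \<omega>. \<Union>y\<in>cl P \<omega>'. cl P (\<omega> + \<omega>'))"
    by (intro SUP_cong refl) auto
  then show ?thesis using cl_nonempty[OF \<omega>(1)] cl_nonempty[OF \<omega>(2)] by (simp add: stalk_def)
qed

lemma frac_class_const: "P \<in> points \<Longrightarrow> a \<in> D 0 \<Longrightarrow> frac_class S D P a \<one>\<^bsub>S\<^esub> = cl P (e a)"
  using frac_class_eq[OF _ _ D_one point_one, of P a] by (simp add: e_one)

lemma stalk_one: "P \<in> points \<Longrightarrow> \<one>\<^bsub>stalk S D P\<^esub> = cl P 1"
  by (simp add: stalk_def frac_class_const[OF _ D_one] e_one)

definition val :: "('s \<times> 's) set \<Rightarrow> 'o" where
  "val c = (SOME \<omega>. \<exists>a f. (a, f) \<in> c \<and> \<omega> = e a / e f)"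

lemma val_cl: assumes "\<omega> \<in> loc P" shows "val (cl P \<omega>) = \<omega>"
proof -
  have "\<exists>\<omega>' a f. (a, f) \<in> cl P \<omega> \<and> \<omega>' = e a / e f" using cl_nonempty[OF assms] by auto
  then have "\<exists>a f. (a, f) \<in> cl P \<omega> \<and> val (cl P \<omega>) = e a / e f" unfolding val_def by (rule someI_ex)
  then show ?thesis by (auto simp: cl_def)
qed

lemma stalk_val: "P \<in> points \<Longrightarrow> c \<in> carrier (stalk S D P) \<Longrightarrow> val c \<in> loc P \<and> c = cl P (val c)"
  by (auto simp: stalk_carrier val_cl)

lemma cl_carrier: "P \<in> points \<Longrightarrow> \<omega> \<in> loc P \<Longrightarrow> cl P \<omega> \<in> carrier (stalk S D P)"
  by (simp add: stalk_carrier)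

definition dopen :: "'s \<Rightarrow> 's set set" where
  "dopen f = {P \<in> points. f \<notin> P}"

lemma openin_dopen: "f \<in> D n \<Longrightarrow> openin (zariski S D) (dopen f)"
  unfolding zariski_def dopen_def by (rule topology_generated_by_Basis) blast

lemma topspace_zariski: "topspace (zariski S D) = points"
proof -
  have "dopen \<one>\<^bsub>S\<^esub> = points" using point_one by (auto simp: dopen_def)
  then show ?thesis
    unfolding zariski_def topology_generated_by_topspace using D_one by (auto simp: dopen_def)
qed

lemma open_points: "openin (zariski S D) V \<Longrightarrow> V \<subseteq> points"
  using openin_subset topspace_zariski by metis

lemma regular_iff:
  "s \<in> regular_sections S D U \<longleftrightarrow> s \<in> extensional U \<and>
    (\<forall>P\<in>U. \<exists>V a f n. openin (zariski S D) V \<and> P \<in> V \<and> V \<subseteq> U \<and> a \<in> D n \<and> f \<in> D n \<and>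
       (\<forall>Q\<in>V. f \<notin> Q \<and> s Q = cl Q (e a / e f)))" (is "?l \<longleftrightarrow> _ \<and> (\<forall>P\<in>U. ?r P)")
proof -
  have eq: "(\<forall>Q\<in>V. f \<notin> Q \<and> s Q = frac_class S D Q a f) \<longleftrightarrow> (\<forall>Q\<in>V. f \<notin> Q \<and> s Q = cl Q (e a / e f))"
    if "openin (zariski S D) V" "a \<in> D n" "f \<in> D n" for V a f n
    using open_points[OF that(1)] that(2,3) by (auto simp: frac_class_eq)
  have eqP: "(\<exists>V a f n. openin (zariski S D) V \<and> P \<in> V \<and> V \<subseteq> U \<and> a \<in> D n \<and> f \<in> D n \<and>
       (\<forall>Q\<in>V. f \<notin> Q \<and> s Q = frac_class S D Q a f)) \<longleftrightarrow> ?r P" for P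
    by (intro ex_cong1 conj_cong refl eq)
  have car: "s P \<in> carrier (stalk S D P)" if r: "?r P" for P
  proof -
    obtain V a f n where V: "openin (zariski S D) V" "P \<in> V" "a \<in> D n" "f \<in> D n"
      "\<forall>Q\<in>V. f \<notin> Q \<and> s Q = cl Q (e a / e f)" using r by (elim exE conjE)
    then have "e a / e f \<in> loc P" "P \<in> points" using locI open_points[OF V(1)] by auto
    then show ?thesis using V cl_carrier by simp
  qed
  show ?thesis unfolding regular_sections_def PiE_iff mem_Collect_eq eqP
    using car by (intro iffI conjI ballI) simp_all
qed

lemma regular_val:
  assumes "s \<in> regular_sections S D U" "P \<in> U" "U \<subseteq> points"
  shows "val (s P) \<in> loc P" "s P = cl P (val (s P))"
  using assms stalk_val[of P "s P"] by (auto simp: regular_sections_def PiE_iff)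

end

context graded_in_field
begin

lemma Proj_simps:
  "base (Proj S D \<kappa>) = zariski S D"
  "carrier (sec (Proj S D \<kappa>) U) = regular_sections S D U"
  "s \<otimes>\<^bsub>sec (Proj S D \<kappa>) U\<^esub> t = (\<lambda>P\<in>U. s P \<otimes>\<^bsub>stalk S D P\<^esub> t P)"
  "s \<oplus>\<^bsub>sec (Proj S D \<kappa>) U\<^esub> t = (\<lambda>P\<in>U. s P \<oplus>\<^bsub>stalk S D P\<^esub> t P)"
  "\<one>\<^bsub>sec (Proj S D \<kappa>) U\<^esub> = (\<lambda>P\<in>U. \<one>\<^bsub>stalk S D P\<^esub>)"
  "res (Proj S D \<kappa>) U V s = restrict s V"
  "scal (Proj S D \<kappa>) U c = (\<lambda>P\<in>U. frac_class S D P (\<kappa> c) \<one>\<^bsub>S\<^esub>)"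
  by (simp_all add: Proj_def)

lemma scal_eq: "U \<subseteq> points \<Longrightarrow> scal (Proj S D \<kappa>) U c = (\<lambda>P\<in>U. cl P (e (\<kappa> c)))"
  by (auto simp: Proj_simps frac_class_const[OF _ D_\<kappa>] intro!: restrict_ext)

lemma one_eq: "U \<subseteq> points \<Longrightarrow> \<one>\<^bsub>sec (Proj S D \<kappa>) U\<^esub> = (\<lambda>P\<in>U. cl P 1)"
  by (auto simp: Proj_simps stalk_one intro!: restrict_ext)

lemma loc_const: "P \<in> points \<Longrightarrow> a \<in> D 0 \<Longrightarrow> e a \<in> loc P"
  using locI[OF _ D_one point_one, of a] by (simp add: e_one)

lemma loc_mult: assumes "P \<in> points" "\<omega> \<in> loc P" "\<omega>' \<in> loc P" shows "\<omega> * \<omega>' \<in> loc P"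
proof -
  obtain a f n where n: "a \<in> D n" "f \<in> D n" "f \<notin> P" "\<omega> = e a / e f" using assms(2) by (rule locE)
  obtain b g m where m: "b \<in> D m" "g \<in> D m" "g \<notin> P" "\<omega>' = e b / e g" using assms(3) by (rule locE)
  have "f \<otimes>\<^bsub>S\<^esub> g \<notin> P" using point_mult[OF assms(1)] D_carrier n m by blast
  from locI[OF D_mult[OF n(1) m(1)] D_mult[OF n(2) m(2)] this] show ?thesis
    using n(4) m(4) D_carrier[OF n(1)] D_carrier[OF n(2)] D_carrier[OF m(1)] D_carrier[OF m(2)]
    by (simp add: e_mult)
qed

lemma sec_val:
  assumes "U \<subseteq> points" "s \<in> regular_sections S D U" "t \<in> regular_sections S D U" "P \<in> U"
  shows "val ((s \<otimes>\<^bsub>sec (Proj S D \<kappa>) U\<^esub> t) P) = val (s P) * val (t P)"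
    and "val ((s \<oplus>\<^bsub>sec (Proj S D \<kappa>) U\<^esub> t) P) = val (s P) + val (t P)"
proof -
  have P: "P \<in> points" using assms by auto
  note s = regular_val[OF assms(2,4,1)] and t = regular_val[OF assms(3,4,1)]
  have c: "cl P (val (s P)) \<otimes>\<^bsub>stalk S D P\<^esub> cl P (val (t P)) \<in> carrier (stalk S D P)"
    unfolding stalk_mult[OF P s(1) t(1)] by (rule cl_carrier[OF P loc_mult[OF P s(1) t(1)]])
  show "val ((s \<otimes>\<^bsub>sec (Proj S D \<kappa>) U\<^esub> t) P) = val (s P) * val (t P)"
    using assms(4) stalk_mult[OF P s(1) t(1)] val_cl[OF loc_mult[OF P s(1) t(1)]] s(2) t(2)
    by (simp add: Proj_simps)
  obtain a f n where n: "a \<in> D n" "f \<in> D n" "f \<notin> P" "val (s P) = e a / e f" using s(1) by (rule locE)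
  obtain b g m where m: "b \<in> D m" "g \<in> D m" "g \<notin> P" "val (t P) = e b / e g" using t(1) by (rule locE)
  have fg: "f \<otimes>\<^bsub>S\<^esub> g \<notin> P" using point_mult[OF P] D_carrier n m by blast
  have "a \<otimes>\<^bsub>S\<^esub> g \<oplus>\<^bsub>S\<^esub> b \<otimes>\<^bsub>S\<^esub> f \<in> D (n + m)"
    using D_mult[OF m(1) n(2)] by (intro D_add[OF D_mult[OF n(1) m(2)]]) (simp add: add.commute)
  from locI[OF this D_mult[OF n(2) m(2)] fg]
  have "val (s P) + val (t P) \<in> loc P"
    using e_nz[OF P n(2,3)] e_nz[OF P m(2,3)] n(4) m(4) D_carrier[OF n(1)] D_carrier[OF n(2)]
      D_carrier[OF m(1)] D_carrier[OF m(2)] by (simp add: e_mult e_add add_frac_eq)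
  then show "val ((s \<oplus>\<^bsub>sec (Proj S D \<kappa>) U\<^esub> t) P) = val (s P) + val (t P)"
    using assms(4) stalk_add[OF P s(1) t(1)] val_cl s(2) t(2) by (simp add: Proj_simps)
qed

lemma open_dopen_Int:
  assumes "openin (zariski S D) V" "f \<in> D n" shows "openin (zariski S D) (V \<inter> dopen f)"
  using assms openin_dopen by (intro openin_Int)

lemma regularI:
  assumes "openin (zariski S D) W" "a \<in> D n" "f \<in> D n" "s \<in> extensional W"
    and "\<And>Q. Q \<in> W \<Longrightarrow> f \<notin> Q" "\<And>Q. Q \<in> W \<Longrightarrow> s Q = cl Q (e a / e f)"
  shows "s \<in> regular_sections S D W"
  unfolding regular_iff
proof (intro conjI ballI)
  fix P assume "P \<in> W"
  then show "\<exists>V a f n. openin (zariski S D) V \<and> P \<in> V \<and> V \<subseteq> W \<and> a \<in> D n \<and> f \<in> D n \<and>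
      (\<forall>Q\<in>V. f \<notin> Q \<and> s Q = cl Q (e a / e f))"
    using assms by (intro exI[of _ W] exI[of _ a] exI[of _ f] exI[of _ n]) simp
qed (rule assms(4))

text \<open>If a/f has an inverse b/g, then a b = f g lies outside the prime \<open>P\<close>, hence
  so does a. Conversely f/a is an inverse on the part of a neighbourhood where a does not
  vanish.\<close>

lemma unit_at_iff:
  assumes U: "openin (zariski S D) U" and s: "s \<in> regular_sections S D U" and P: "P \<in> U"
    and T: "openin (zariski S D) T" "U \<subseteq> T"
  shows "unit_at (open_subspace (Proj S D \<kappa>) T) U s P \<longleftrightarrow>
    (\<exists>a f n. a \<in> D n \<and> f \<in> D n \<and> a \<notin> P \<and> f \<notin> P \<and> val (s P) = e a / e f)"
proof
  note Pp = subsetD[OF open_points[OF U] P]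
  assume "unit_at (open_subspace (Proj S D \<kappa>) T) U s P"
  then obtain V where V: "openin (zariski S D) V" "P \<in> V" "V \<subseteq> U"
    "restrict s V \<in> Units (sec (Proj S D \<kappa>) V)"
    unfolding unit_at_def open_subspace_def
    by (auto simp: Proj_simps openin_open_subtopology[OF T(1)])
  then obtain t where t: "t \<in> regular_sections S D V" "restrict s V \<in> regular_sections S D V"
    "restrict s V \<otimes>\<^bsub>sec (Proj S D \<kappa>) V\<^esub> t = \<one>\<^bsub>sec (Proj S D \<kappa>) V\<^esub>"
    unfolding Units_def by (auto simp: Proj_simps(2))
  note Vp = open_points[OF V(1)]
  have "1 \<in> loc P" using loc_const[OF Pp D_one] by (simp add: e_one)
  then have "val (restrict s V P) * val (t P) = 1"
    unfolding sec_val(1)[OF Vp t(2,1) V(2), symmetric] t(3) one_eq[OF Vp] using V(2) by (simp add: val_cl)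
  then have 1: "val (s P) * val (t P) = 1" using V(2) by simp
  obtain a f n where n: "a \<in> D n" "f \<in> D n" "f \<notin> P" "val (s P) = e a / e f"
    using regular_val(1)[OF s P open_points[OF U]] by (rule locE)
  obtain b g m where m: "b \<in> D m" "g \<in> D m" "g \<notin> P" "val (t P) = e b / e g"
    using regular_val(1)[OF t(1) V(2) Vp] by (rule locE)
  have "e a * e b = e f * e g"
    using 1 e_nz[OF Pp n(2,3)] e_nz[OF Pp m(2,3)] unfolding n(4) m(4) by (simp add: field_simps)
  then have "a \<otimes>\<^bsub>S\<^esub> b = f \<otimes>\<^bsub>S\<^esub> g"
    using e_inj[OF D_mult[OF n(1) m(1)] D_mult[OF n(2) m(2)]] D_carrier n m by (simp add: e_mult)
  moreover have "f \<otimes>\<^bsub>S\<^esub> g \<notin> P" using point_mult[OF Pp] D_carrier n m by blast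
  ultimately have "a \<notin> P" using point_mult[OF Pp] D_carrier n m by metis
  then show "\<exists>a f n. a \<in> D n \<and> f \<in> D n \<and> a \<notin> P \<and> f \<notin> P \<and> val (s P) = e a / e f" using n by blast
next
  note Pp = subsetD[OF open_points[OF U] P]
  assume "\<exists>a f n. a \<in> D n \<and> f \<in> D n \<and> a \<notin> P \<and> f \<notin> P \<and> val (s P) = e a / e f"
  then obtain a' f' n' where af': "a' \<in> D n'" "f' \<in> D n'" "a' \<notin> P" "f' \<notin> P" "val (s P) = e a' / e f'" by blast
  obtain V a f n where V: "openin (zariski S D) V" "P \<in> V" "V \<subseteq> U" "a \<in> D n" "f \<in> D n"
    "\<forall>Q\<in>V. f \<notin> Q \<and> s Q = cl Q (e a / e f)" using s P unfolding regular_iff by blast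
  have "f \<notin> P" "val (s P) = e a / e f" using V val_cl locI by auto
  then have "e a' * e f = e a * e f'"
    using af' e_nz[OF Pp V(5)] e_nz[OF Pp af'(2,4)] by (simp add: field_simps)
  then have "e (a' \<otimes>\<^bsub>S\<^esub> f) = e (a \<otimes>\<^bsub>S\<^esub> f')" using D_carrier af' V by (simp add: e_mult)
  then have "a' \<otimes>\<^bsub>S\<^esub> f = a \<otimes>\<^bsub>S\<^esub> f'"
    using e_inj[OF D_mult[OF af'(1) V(5)], of "a \<otimes>\<^bsub>S\<^esub> f'"] D_mult[OF V(4) af'(2)] by (simp add: add.commute)
  moreover have "a' \<otimes>\<^bsub>S\<^esub> f \<notin> P" using point_mult[OF Pp] D_carrier af' V \<open>f \<notin> P\<close> by blast
  \<comment> \<open>The local fraction a/f may differ from the given a'/f'; the equation a' f = a f'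
    carries the condition over.\<close>
  ultimately have "a \<notin> P" using point_mult[OF Pp] D_carrier af' V by metis
  define W where "W = V \<inter> dopen a"
  have W: "openin (zariski S D) W" "P \<in> W" "W \<subseteq> U" "W \<subseteq> points"
    using open_dopen_Int[OF V(1,4)] V(2,3) \<open>a \<notin> P\<close> Pp open_points[OF V(1)] by (auto simp: W_def dopen_def)
  have aW: "a \<notin> Q" "f \<notin> Q" "s Q = cl Q (e a / e f)" if "Q \<in> W" for Q
    using that V(6) by (auto simp: W_def dopen_def)
  define t where "t = (\<lambda>Q\<in>W. cl Q (e f / e a))"
  have t: "t \<in> regular_sections S D W"
    by (rule regularI[OF W(1) V(5,4)]) (auto simp: t_def aW)
  have r: "restrict s W \<in> regular_sections S D W"
    by (rule regularI[OF W(1) V(4,5)]) (auto simp: aW)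
  have "cl Q (e a / e f) \<otimes>\<^bsub>stalk S D Q\<^esub> cl Q (e f / e a) = cl Q 1"
    "cl Q (e f / e a) \<otimes>\<^bsub>stalk S D Q\<^esub> cl Q (e a / e f) = cl Q 1" if "Q \<in> W" for Q
  proof -
    have Q: "Q \<in> points" using that W by auto
    note l = locI[OF V(4,5) aW(2)[OF that]] locI[OF V(5,4) aW(1)[OF that]]
    have "e a \<noteq> 0" "e f \<noteq> 0" using e_nz[OF Q V(4)] e_nz[OF Q V(5)] aW[OF that] by auto
    then show "cl Q (e a / e f) \<otimes>\<^bsub>stalk S D Q\<^esub> cl Q (e f / e a) = cl Q 1"
      "cl Q (e f / e a) \<otimes>\<^bsub>stalk S D Q\<^esub> cl Q (e a / e f) = cl Q 1"
      using stalk_mult[OF Q l] stalk_mult[OF Q l(2,1)] by simp_all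
  qed
  then have "t \<otimes>\<^bsub>sec (Proj S D \<kappa>) W\<^esub> restrict s W = \<one>\<^bsub>sec (Proj S D \<kappa>) W\<^esub>"
    "restrict s W \<otimes>\<^bsub>sec (Proj S D \<kappa>) W\<^esub> t = \<one>\<^bsub>sec (Proj S D \<kappa>) W\<^esub>"
    unfolding one_eq[OF W(4)] Proj_simps(3) by (auto simp: t_def aW intro!: restrict_ext)
  then have "restrict s W \<in> Units (sec (Proj S D \<kappa>) W)"
    unfolding Units_def using t r by (auto simp: Proj_simps(2))
  then show "unit_at (open_subspace (Proj S D \<kappa>) T) U s P"
    unfolding unit_at_def open_subspace_def using W T
    by (intro exI[of _ W]) (auto simp: Proj_simps openin_open_subtopology[OF T(1)])
qed

end

section \<open>Morphisms of projective spectra given by forms\<close>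

text \<open>\<open>compat\<close> says that pulling back by \<open>\<gamma>\<close> preserves the
  values of degree-zero fractions: both function fields are read inside the same field.
  \<open>d\<close> is the degree of the forms defining the map.\<close>

locale proj_map = X: graded_in_field S D \<kappa> e + Y: graded_in_field S' D' \<kappa>' e'
  for S :: "'s ring" and D and \<kappa> :: "'k \<Rightarrow> 's" and e :: "'s \<Rightarrow> 'o::field"
    and S' :: "'t ring" and D' and \<kappa>' :: "'k \<Rightarrow> 't" and e' :: "'t \<Rightarrow> 'o" +
  fixes \<gamma> :: "'t \<Rightarrow> 's" and d :: nat and U :: "'s set set" and V :: "'t set set" and h :: "'s set \<Rightarrow> 't set"
  assumes e\<kappa>: "e (\<kappa> c) = e' (\<kappa>' c)"
    and \<gamma>: "f \<in> D' n \<Longrightarrow> \<gamma> f \<in> D (n * d)"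
    and compat: "a \<in> D' n \<Longrightarrow> f \<in> D' n \<Longrightarrow> e (\<gamma> a) * e' f = e (\<gamma> f) * e' a"
    and U: "openin (zariski S D) U" and V: "openin (zariski S' D') V"
    and hV: "P \<in> U \<Longrightarrow> h P \<in> V"
    and h: "P \<in> U \<Longrightarrow> f \<in> D' n \<Longrightarrow> f \<in> h P \<longleftrightarrow> \<gamma> f \<in> P"
begin

abbreviation XU where "XU \<equiv> open_subspace (Proj S D \<kappa>) U"
abbreviation YV where "YV \<equiv> open_subspace (Proj S' D' \<kappa>') V"

text \<open>A germ keeps its value in the field; only the point at which it is taken
  changes.\<close>

definition pull :: "'t set set \<Rightarrow> ('t set \<Rightarrow> ('t \<times> 't) set) \<Rightarrow> ('s set \<Rightarrow> ('s \<times> 's) set)" where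
  "pull W s = (\<lambda>P\<in>preim XU h W. X.cl P (Y.val (s (h P))))"

lemma Up: "U \<subseteq> X.points" and Vp: "V \<subseteq> Y.points"
  using X.open_points[OF U] Y.open_points[OF V] by auto

lemma open_XU: "openin (base XU) W \<longleftrightarrow> openin (zariski S D) W \<and> W \<subseteq> U"
  by (simp add: open_subspace_def X.Proj_simps openin_open_subtopology[OF U])

lemma open_YV: "openin (base YV) W \<longleftrightarrow> openin (zariski S' D') W \<and> W \<subseteq> V"
  by (simp add: open_subspace_def Y.Proj_simps openin_open_subtopology[OF V])

lemma topspace_XU: "topspace (base XU) = U"
  using Up by (auto simp: open_subspace_def X.Proj_simps X.topspace_zariski)

lemma topspace_YV: "topspace (base YV) = V"
  using Vp by (auto simp: open_subspace_def Y.Proj_simps Y.topspace_zariski)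

lemma preim_eq: "preim XU h W = {P \<in> U. h P \<in> W}"
  unfolding preim_def topspace_XU ..

lemma sub_simps:
  "sec XU = sec (Proj S D \<kappa>)" "res XU = res (Proj S D \<kappa>)" "scal XU = scal (Proj S D \<kappa>)"
  "sec YV = sec (Proj S' D' \<kappa>')" "res YV = res (Proj S' D' \<kappa>')" "scal YV = scal (Proj S' D' \<kappa>')"
  by (simp_all add: open_subspace_def)

lemma continuous: "continuous_map (base XU) (base YV) h"
proof -
  have "openin (base XU) (h -` O' \<inter> topspace (base XU))"
    if O': "O' \<in> {{P \<in> Y.points. f \<notin> P} |f. f \<in> (\<Union>n. D' n)}" for O'
  proof -
    obtain f n where f: "f \<in> D' n" "O' = {P \<in> Y.points. f \<notin> P}" using O' by auto
    have "h -` O' \<inter> topspace (base XU) = U \<inter> X.dopen (\<gamma> f)"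
      unfolding topspace_XU f(2) X.dopen_def using h[OF _ f(1)] hV Up Vp by auto
    then show ?thesis using X.open_dopen_Int[OF U \<gamma>[OF f(1)]] by (simp add: open_XU)
  qed
  moreover have "h ` topspace (base XU) \<subseteq> \<Union>{{P \<in> Y.points. f \<notin> P} |f. f \<in> (\<Union>n. D' n)}"
  proof -
    have "\<Union>{{P \<in> Y.points. f \<notin> P} |f. f \<in> (\<Union>n. D' n)} = Y.points"
      using Y.topspace_zariski unfolding zariski_def topology_generated_by_topspace .
    then show ?thesis using hV Vp topspace_XU by auto
  qed
  ultimately have "continuous_map (base XU) (zariski S' D') h"
    unfolding zariski_def by (rule continuous_on_generated_topo)
  then show ?thesis
    using hV topspace_XU by (auto simp: open_subspace_def Y.Proj_simps continuous_map_in_subtopology)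
qed

lemma preim_open: "openin (base YV) W \<Longrightarrow> openin (zariski S D) (preim XU h W)"
  using openin_continuous_map_preimage[OF continuous, of W] open_XU by (simp add: preim_def)

lemma ratio:
  assumes "P \<in> U" "a \<in> D' n" "f \<in> D' n" "f \<notin> h P"
  shows "\<gamma> f \<notin> P" "e (\<gamma> a) / e (\<gamma> f) = e' a / e' f"
proof -
  show nP: "\<gamma> f \<notin> P" using h assms by blast
  have "e (\<gamma> f) \<noteq> 0" using X.e_nz[OF _ \<gamma>[OF assms(3)] nP] assms(1) Up by auto
  moreover have "e' f \<noteq> 0" using Y.e_nz[OF _ assms(3,4)] hV[OF assms(1)] Vp by auto
  ultimately show "e (\<gamma> a) / e (\<gamma> f) = e' a / e' f"
    using compat[OF assms(2,3)] by (simp add: frac_eq_eq mult.commute)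
qed

lemma loc_sub: assumes "P \<in> U" "\<omega> \<in> Y.loc (h P)" shows "\<omega> \<in> X.loc P"
proof -
  obtain a f n where n: "a \<in> D' n" "f \<in> D' n" "f \<notin> h P" "\<omega> = e' a / e' f"
    using assms(2) by (rule Y.locE)
  show ?thesis using X.locI[OF \<gamma>[OF n(1)] \<gamma>[OF n(2)] ratio(1)[OF assms(1) n(1-3)]]
    ratio(2)[OF assms(1) n(1-3)] n(4) by simp
qed

lemma pull_val:
  assumes W: "openin (base YV) W" and s: "s \<in> regular_sections S' D' W" and P: "P \<in> preim XU h W"
  shows "Y.val (s (h P)) \<in> X.loc P" "X.val (pull W s P) = Y.val (s (h P))"
proof -
  have P': "P \<in> U" "h P \<in> W" using P by (auto simp: preim_eq)
  have "W \<subseteq> Y.points" using W Vp by (auto simp: open_YV)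
  then show 1: "Y.val (s (h P)) \<in> X.loc P"
    by (rule loc_sub[OF P'(1) Y.regular_val(1)[OF s P'(2)]])
  then show "X.val (pull W s P) = Y.val (s (h P))" using P by (simp add: pull_def X.val_cl)
qed

lemma pull_regular:
  assumes W: "openin (base YV) W" and s: "s \<in> regular_sections S' D' W"
  shows "pull W s \<in> regular_sections S D (preim XU h W)"
  unfolding X.regular_iff
proof (intro conjI ballI)
  show "pull W s \<in> extensional (preim XU h W)" by (simp add: pull_def)
  fix P assume P: "P \<in> preim XU h W"
  then have P': "P \<in> U" "h P \<in> W" by (auto simp: preim_eq)
  obtain N a f n where N: "openin (zariski S' D') N" "h P \<in> N" "N \<subseteq> W" "a \<in> D' n" "f \<in> D' n"
    "\<forall>Q\<in>N. f \<notin> Q \<and> s Q = Y.cl Q (e' a / e' f)" using s P' unfolding Y.regular_iff by blast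
  have oN: "openin (base YV) N" using N W by (auto simp: open_YV)
  have "\<gamma> f \<notin> Q \<and> pull W s Q = X.cl Q (e (\<gamma> a) / e (\<gamma> f))" if "Q \<in> preim XU h N" for Q
  proof -
    have Q: "Q \<in> U" "h Q \<in> N" using that by (auto simp: preim_eq)
    then have fQ: "f \<notin> h Q" "s (h Q) = Y.cl (h Q) (e' a / e' f)" using N(6) by auto
    then have "Y.val (s (h Q)) = e' a / e' f" using Y.val_cl Y.locI[OF N(4,5)] by auto
    then show ?thesis using ratio[OF Q(1) N(4,5) fQ(1)] Q N(3) by (auto simp: pull_def preim_eq)
  qed
  then show "\<exists>V a f n. openin (zariski S D) V \<and> P \<in> V \<and> V \<subseteq> preim XU h W \<and> a \<in> D n \<and> f \<in> D n \<and>
      (\<forall>Q\<in>V. f \<notin> Q \<and> pull W s Q = X.cl Q (e a / e f))"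
    using preim_open[OF oN] P' N(2,3) \<gamma>[OF N(4)] \<gamma>[OF N(5)]
    by (intro exI[of _ "preim XU h N"] exI[of _ "\<gamma> a"] exI[of _ "\<gamma> f"] exI[of _ "n * d"])
       (auto simp: preim_eq)
qed

lemma pull_hom:
  assumes W: "openin (base YV) W"
  shows "pull W \<in> ring_hom (sec YV W) (sec XU (preim XU h W))"
proof -
  have Wp: "W \<subseteq> Y.points" using W Vp by (auto simp: open_YV)
  have pp: "preim XU h W \<subseteq> X.points" using Up by (auto simp: preim_eq)
  have sec_ext: "f = g"
    if "f \<in> extensional (preim XU h W)" "g \<in> extensional (preim XU h W)"
      "\<And>P. P \<in> preim XU h W \<Longrightarrow> f P = g P" for f g :: "'s set \<Rightarrow> ('s \<times> 's) set"
    using that by (rule extensionalityI)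
  show ?thesis unfolding sub_simps
  proof (rule ring_hom_memI)
    fix s assume s: "s \<in> carrier (sec (Proj S' D' \<kappa>') W)"
    then have s: "s \<in> regular_sections S' D' W" by (simp add: Y.Proj_simps)
    show "pull W s \<in> carrier (sec (Proj S D \<kappa>) (preim XU h W))"
      using pull_regular[OF W s] by (simp add: X.Proj_simps)
    fix t assume t: "t \<in> carrier (sec (Proj S' D' \<kappa>') W)"
    then have t: "t \<in> regular_sections S' D' W" by (simp add: Y.Proj_simps)
    note ps = pull_regular[OF W s] and pt = pull_regular[OF W t]
    have l: "Y.val (s (h P)) \<in> X.loc P" "Y.val (t (h P)) \<in> X.loc P" "h P \<in> W" "P \<in> X.points"
      if "P \<in> preim XU h W" for P
      using that pull_val(1)[OF W] s t pp by (auto simp: preim_eq)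
    show "pull W (s \<otimes>\<^bsub>sec (Proj S' D' \<kappa>') W\<^esub> t) = pull W s \<otimes>\<^bsub>sec (Proj S D \<kappa>) (preim XU h W)\<^esub> pull W t"
    proof (rule sec_ext)
      fix P assume P: "P \<in> preim XU h W"
      show "pull W (s \<otimes>\<^bsub>sec (Proj S' D' \<kappa>') W\<^esub> t) P
        = (pull W s \<otimes>\<^bsub>sec (Proj S D \<kappa>) (preim XU h W)\<^esub> pull W t) P"
        using P l[OF P] Y.sec_val(1)[OF Wp s t, of "h P"] X.stalk_mult[OF l(4)[OF P] l(1)[OF P] l(2)[OF P]]
        by (simp add: pull_def X.Proj_simps(3))
    qed (simp_all add: pull_def X.Proj_simps)
    show "pull W (s \<oplus>\<^bsub>sec (Proj S' D' \<kappa>') W\<^esub> t) = pull W s \<oplus>\<^bsub>sec (Proj S D \<kappa>) (preim XU h W)\<^esub> pull W t"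
    proof (rule sec_ext)
      fix P assume P: "P \<in> preim XU h W"
      show "pull W (s \<oplus>\<^bsub>sec (Proj S' D' \<kappa>') W\<^esub> t) P
        = (pull W s \<oplus>\<^bsub>sec (Proj S D \<kappa>) (preim XU h W)\<^esub> pull W t) P"
        using P l[OF P] Y.sec_val(2)[OF Wp s t, of "h P"] X.stalk_add[OF l(4)[OF P] l(1)[OF P] l(2)[OF P]]
        by (simp add: pull_def X.Proj_simps(4))
    qed (simp_all add: pull_def X.Proj_simps)
  next
    have "Y.val (Y.cl (h P) 1) = 1" if "P \<in> preim XU h W" for P
      using that Y.val_cl[of 1 "h P"] Y.loc_const[OF _ Y.D_one, of "h P"] Wp
      by (auto simp: preim_eq Y.e_one)
    then show "pull W \<one>\<^bsub>sec (Proj S' D' \<kappa>') W\<^esub> = \<one>\<^bsub>sec (Proj S D \<kappa>) (preim XU h W)\<^esub>"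
      unfolding Y.one_eq[OF Wp] X.one_eq[OF pp] pull_def by (intro restrict_ext) (simp add: preim_eq)
  qed
qed

text \<open>For the condition on units, write the section as b/g at \<open>h P\<close>. If its
  pull-back is a unit at P, then \<open>\<gamma> b\<close> is outside P, so b is outside
  \<open>h P\<close>.\<close>

theorem is_morphism: "morphism XU YV h pull"
  unfolding morphism_def
proof (intro conjI allI impI ballI)
  show "continuous_map (base XU) (base YV) h" by (rule continuous)
next
  fix W assume W: "openin (base YV) W"
  show "pull W \<in> ring_hom (sec YV W) (sec XU (preim XU h W))" by (rule pull_hom[OF W])
  fix c
  have Wp: "W \<subseteq> Y.points" using W Vp by (auto simp: open_YV)
  have pp: "preim XU h W \<subseteq> X.points" using Up by (auto simp: preim_eq)
  have "Y.val (Y.cl (h P) (e' (\<kappa>' c))) = e (\<kappa> c)" if "P \<in> preim XU h W" for P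
    using that Y.val_cl[OF Y.loc_const[OF _ Y.D_\<kappa>], of "h P" c] Wp by (auto simp: preim_eq e\<kappa>)
  then show "pull W (scal YV W c) = scal XU (preim XU h W) c"
    unfolding sub_simps Y.scal_eq[OF Wp] X.scal_eq[OF pp] pull_def by (intro restrict_ext) (simp add: preim_eq)
next
  fix W W' s
  assume W: "openin (base YV) W \<and> openin (base YV) W' \<and> W' \<subseteq> W" "s \<in> carrier (sec YV W)"
  show "pull W' (res YV W W' s) = res XU (preim XU h W) (preim XU h W') (pull W s)"
    unfolding sub_simps Y.Proj_simps X.Proj_simps pull_def
    using W by (auto simp: fun_eq_iff preim_eq restrict_def)
next
  fix W s P
  assume W: "openin (base YV) W" and s: "s \<in> carrier (sec YV W)" and P: "P \<in> preim XU h W"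
    and u: "unit_at XU (preim XU h W) (pull W s) P"
  have s: "s \<in> regular_sections S' D' W" using s by (simp add: sub_simps Y.Proj_simps)
  have P': "P \<in> U" "h P \<in> W" "W \<subseteq> V" "W \<subseteq> Y.points" using P W Vp by (auto simp: preim_eq open_YV)
  have Pp: "P \<in> X.points" using P' Up by auto
  have "preim XU h W \<subseteq> U" by (auto simp: preim_eq)
  then obtain a f n where af: "a \<in> D n" "f \<in> D n" "a \<notin> P" "f \<notin> P" "Y.val (s (h P)) = e a / e f"
    using u X.unit_at_iff[OF preim_open[OF W] pull_regular[OF W s] P U] pull_val(2)[OF W s P] by metis
  obtain b g m where bg: "b \<in> D' m" "g \<in> D' m" "g \<notin> h P" "Y.val (s (h P)) = e' b / e' g"
    using Y.regular_val(1)[OF s P'(2,4)] by (rule Y.locE)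
  have "e (\<gamma> b) / e (\<gamma> g) = e a / e f" using ratio(2)[OF P'(1) bg(1-3)] af(5) bg(4) by simp
  moreover have g: "\<gamma> g \<notin> P" "e (\<gamma> g) \<noteq> 0" "e f \<noteq> 0"
    using ratio(1)[OF P'(1) bg(1-3)] X.e_nz[OF Pp \<gamma>[OF bg(2)]] X.e_nz[OF Pp af(2,4)] by auto
  ultimately have "e (\<gamma> b \<otimes>\<^bsub>S\<^esub> f) = e (a \<otimes>\<^bsub>S\<^esub> \<gamma> g)"
    using X.D_carrier[OF \<gamma>[OF bg(1)]] X.D_carrier[OF \<gamma>[OF bg(2)]] X.D_carrier[OF af(1)] X.D_carrier[OF af(2)]
    by (simp add: X.e_mult frac_eq_eq)
  then have "\<gamma> b \<otimes>\<^bsub>S\<^esub> f = a \<otimes>\<^bsub>S\<^esub> \<gamma> g"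
    using X.e_inj[OF X.D_mult[OF \<gamma>[OF bg(1)] af(2)], of "a \<otimes>\<^bsub>S\<^esub> \<gamma> g"] X.D_mult[OF af(1) \<gamma>[OF bg(2)]]
    by (simp add: add.commute)
  moreover have "a \<otimes>\<^bsub>S\<^esub> \<gamma> g \<notin> P"
    using X.point_mult[OF Pp] X.D_carrier[OF af(1)] X.D_carrier[OF \<gamma>[OF bg(2)]] af(3) g(1) by blast
  ultimately have "\<gamma> b \<notin> P"
    using X.point_mult[OF Pp X.D_carrier[OF \<gamma>[OF bg(1)]] X.D_carrier[OF af(2)]] by auto
  then have "b \<notin> h P" using h[OF P'(1) bg(1)] by simp
  moreover have oW: "openin (zariski S' D') W" using W by (simp add: open_YV)
  ultimately show "unit_at YV W s (h P)"
    using Y.unit_at_iff[OF oW s P'(2) V P'(3)] bg by blast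
qed

end

text \<open>Pull-backs preserve values in the common field, so they are mutually inverse as soon as
  the maps on points are.\<close>

theorem isomorphic_by_polys:
  assumes 1: "proj_map S D \<kappa> e S' D' \<kappa>' e' \<gamma> d U V h"
    and 2: "proj_map S' D' \<kappa>' e' S D \<kappa> e \<gamma>' d' V U h'"
    and hh: "\<And>P. P \<in> U \<Longrightarrow> h' (h P) = P" "\<And>Q. Q \<in> V \<Longrightarrow> h (h' Q) = Q"
  shows "isomorphic (open_subspace (Proj S D \<kappa>) U) (open_subspace (Proj S' D' \<kappa>') V)"
proof -
  interpret m1: proj_map S D \<kappa> e S' D' \<kappa>' e' \<gamma> d U V h by (rule 1)
  interpret m2: proj_map S' D' \<kappa>' e' S D \<kappa> e \<gamma>' d' V U h' by (rule 2)
  have a: "m2.pull (preim m1.XU h W) (m1.pull W s) = s"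
    if W: "openin (base m1.YV) W" and s: "s \<in> carrier (sec m1.YV W)" for W s
  proof (rule extensionalityI)
    have WV: "W \<subseteq> V" using W by (simp add: m1.open_YV)
    have s: "s \<in> regular_sections S' D' W" using s by (simp add: m1.sub_simps m1.Y.Proj_simps)
    show "s \<in> extensional W" using s by (auto simp: m1.Y.regular_iff)
    have pW: "preim m1.YV h' (preim m1.XU h W) = W"
      using WV hh m2.hV by (auto simp: m1.preim_eq m2.preim_eq)
    then show "m2.pull (preim m1.XU h W) (m1.pull W s) \<in> extensional W" by (simp add: m2.pull_def)
    fix Q assume Q: "Q \<in> W"
    then have "h' Q \<in> preim m1.XU h W" using WV hh m2.hV by (auto simp: m1.preim_eq)
    from m1.pull_val(2)[OF W s this] have "m1.X.val (m1.pull W s (h' Q)) = m1.Y.val (s Q)"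
      using hh(2)[of Q] Q WV by auto
    then show "m2.pull (preim m1.XU h W) (m1.pull W s) Q = s Q"
      using Q pW m1.Y.regular_val(2)[OF s Q] WV m1.Vp by (simp add: m2.pull_def)
  qed
  have b: "m1.pull (preim m1.YV h' W) (m2.pull W s) = s"
    if W: "openin (base m1.XU) W" and s: "s \<in> carrier (sec m1.XU W)" for W s
  proof (rule extensionalityI)
    have WV: "W \<subseteq> U" using W by (simp add: m1.open_XU)
    have s: "s \<in> regular_sections S D W" using s by (simp add: m1.sub_simps m1.X.Proj_simps)
    show "s \<in> extensional W" using s by (auto simp: m1.X.regular_iff)
    have pW: "preim m1.XU h (preim m1.YV h' W) = W"
      using WV hh m1.hV by (auto simp: m1.preim_eq m2.preim_eq)
    then show "m1.pull (preim m1.YV h' W) (m2.pull W s) \<in> extensional W" by (simp add: m1.pull_def)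
    fix Q assume Q: "Q \<in> W"
    then have "h Q \<in> preim m1.YV h' W" using WV hh m1.hV by (auto simp: m2.preim_eq)
    from m2.pull_val(2)[OF W s this] have "m1.Y.val (m2.pull W s (h Q)) = m1.X.val (s Q)"
      using hh(1)[of Q] Q WV by auto
    then show "m1.pull (preim m1.YV h' W) (m2.pull W s) Q = s Q"
      using Q pW m1.X.regular_val(2)[OF s Q] WV m1.Up by (simp add: m1.pull_def)
  qed
  show ?thesis
    unfolding isomorphic_def
    by (rule exI[of _ h], rule exI[of _ m1.pull], rule exI[of _ h'], rule exI[of _ m2.pull])
       (use m1.is_morphism m2.is_morphism hh a b m1.topspace_XU m1.topspace_YV in auto)
qed

section \<open>Rational morphisms and birational maps between hypersurfaces\<close>

lemma ideal_by_closure: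
  fixes S (structure)
  assumes "ring S" "J \<subseteq> carrier S" "\<zero> \<in> J"
    and add: "\<And>a b. a \<in> J \<Longrightarrow> b \<in> J \<Longrightarrow> a \<oplus> b \<in> J"
    and mult: "\<And>a x. a \<in> J \<Longrightarrow> x \<in> carrier S \<Longrightarrow> x \<otimes> a \<in> J"
      "\<And>a x. a \<in> J \<Longrightarrow> x \<in> carrier S \<Longrightarrow> a \<otimes> x \<in> J"
  shows "ideal J S"
proof -
  interpret ring S by (rule assms(1))
  have "\<ominus> a \<in> J" if "a \<in> J" for a
  proof -
    have "a \<in> carrier S" using that assms(2) by blast
    then have "\<ominus> a = (\<ominus> \<one>) \<otimes> a" by (simp add: l_minus)
    then show ?thesis using mult(1)[OF that, of "\<ominus> \<one>"] by simp
  qed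
  then have "subgroup J (add_monoid S)"
    using assms(2,3) add by (intro add.subgroupI) (auto simp: a_inv_def)
  then show ?thesis using mult by (intro idealI assms(1)) auto
qed

context graded_in_field
begin

text \<open>Nonempty basic open sets contain the zero ideal, and finite intersections and unions
  inherit this.\<close>

lemma open_generic:
  assumes "openin (zariski S D) V" "V \<noteq> {}" "{\<zero>\<^bsub>S\<^esub>} \<in> points"
  shows "{\<zero>\<^bsub>S\<^esub>} \<in> V"
proof -
  have "generate_topology_on {{P \<in> points. f \<notin> P} |f. f \<in> (\<Union>n. D n)} V"
    using assms(1) unfolding zariski_def by (rule openin_topology_generated_by)
  then have "V \<noteq> {} \<longrightarrow> {\<zero>\<^bsub>S\<^esub>} \<in> V"
  proof (induction rule: generate_topology_on.induct)
    case (Basis V)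
    then obtain f where V: "V = {P \<in> points. f \<notin> P}" by auto
    show ?case unfolding V using assms(3) point_zero by auto
  qed auto
  then show ?thesis using assms(2) by blast
qed

lemma dense_openI:
  assumes V: "openin (zariski S D) V" "{\<zero>\<^bsub>S\<^esub>} \<in> V" and P0: "{\<zero>\<^bsub>S\<^esub>} \<in> points"
  shows "dense_open (Proj S D \<kappa>) V"
  unfolding dense_open_def Proj_simps
proof (intro conjI V(1) equalityI)
  show "topspace (zariski S D) \<subseteq> zariski S D closure_of V"
    using V(2) open_generic[OF _ _ P0] by (fastforce simp: in_closure_of)
qed (rule closure_of_subset_topspace)

text \<open>Functions on the basic open set of \<open>g\<close> that are given there by one
  fraction, viewed as elements of the field.\<close>

definition coord_funs :: "'s \<Rightarrow> 'o set" where
  "coord_funs g = {e a / e f | a f n. a \<in> D n \<and> f \<in> D n \<and> (\<forall>P\<in>dopen g. f \<notin> P)}"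

lemma coord_funsI: "a \<in> D n \<Longrightarrow> f \<in> D n \<Longrightarrow> (\<And>P. P \<in> dopen g \<Longrightarrow> f \<notin> P) \<Longrightarrow> e a / e f \<in> coord_funs g"
  unfolding coord_funs_def by blast

lemma coord_funsE:
  assumes "x \<in> coord_funs g"
  obtains a f n where "a \<in> D n" "f \<in> D n" "\<And>P. P \<in> dopen g \<Longrightarrow> f \<notin> P" "x = e a / e f"
  using assms unfolding coord_funs_def by blast

lemma coord_funs_loc: "x \<in> coord_funs g \<Longrightarrow> P \<in> dopen g \<Longrightarrow> x \<in> loc P"
  by (elim coord_funsE) (auto intro: locI)

lemma coord_funs_closed:
  assumes "P0 \<in> dopen g" "x \<in> coord_funs g" "y \<in> coord_funs g"
  shows "x * y \<in> coord_funs g" "x + y \<in> coord_funs g"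
proof -
  obtain a f n where n: "a \<in> D n" "f \<in> D n" "\<And>P. P \<in> dopen g \<Longrightarrow> f \<notin> P" "x = e a / e f"
    using assms(2) by (rule coord_funsE) blast
  obtain b h m where m: "b \<in> D m" "h \<in> D m" "\<And>P. P \<in> dopen g \<Longrightarrow> h \<notin> P" "y = e b / e h"
    using assms(3) by (rule coord_funsE) blast
  have fh: "f \<otimes>\<^bsub>S\<^esub> h \<notin> P" if "P \<in> dopen g" for P
    using that point_mult[of P f h] D_carrier n(2,3) m(2,3) by (auto simp: dopen_def)
  have nz: "e f \<noteq> 0" "e h \<noteq> 0" using e_nz[of P0 f n] e_nz[of P0 h m] assms(1) n m by (auto simp: dopen_def)
  note c = D_carrier[OF n(1)] D_carrier[OF n(2)] D_carrier[OF m(1)] D_carrier[OF m(2)]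
  show "x * y \<in> coord_funs g"
    using coord_funsI[OF D_mult[OF n(1) m(1)] D_mult[OF n(2) m(2)] fh] n(4) m(4) c by (simp add: e_mult)
  have "a \<otimes>\<^bsub>S\<^esub> h \<oplus>\<^bsub>S\<^esub> b \<otimes>\<^bsub>S\<^esub> f \<in> D (n + m)"
    using D_mult[OF m(1) n(2)] by (intro D_add[OF D_mult[OF n(1) m(2)]]) (simp add: add.commute)
  from coord_funsI[OF this D_mult[OF n(2) m(2)] fh]
  show "x + y \<in> coord_funs g" using n(4) m(4) c nz by (simp add: e_mult e_add add_frac_eq)
qed

end

text \<open>Q is the image of the generic point of X. As the morphism need not be dominant, only
  functions regular around Q can be pulled back. They are then evaluated at the generic point, whose
  stalk is the function field of X.\<close>

lemma rational_morphism_values: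
  assumes X: "graded_in_field S D \<kappa> e" and Y: "graded_in_field S' D' \<kappa>' e'"
    and P0: "{\<zero>\<^bsub>S\<^esub>} \<in> proj_points S D"
    and ex: "exists_rational_morphism (Proj S D \<kappa>) (Proj S' D' \<kappa>')"
  shows "\<exists>Q\<in>proj_points S' D'. \<forall>g n. g \<in> D' n \<longrightarrow> g \<notin> Q \<longrightarrow> (\<exists>\<chi>.
    let \<Gamma> = graded_in_field.coord_funs S' D' e' g in
    (\<forall>x\<in>\<Gamma>. \<forall>y\<in>\<Gamma>. \<chi> (x + y) = \<chi> x + \<chi> y \<and> \<chi> (x * y) = \<chi> x * \<chi> y) \<and>
    (\<forall>x\<in>\<Gamma>. \<chi> x \<in> graded_in_field.loc D e {\<zero>\<^bsub>S\<^esub>}) \<and> (\<forall>c. \<chi> (e' (\<kappa>' c)) = e (\<kappa> c)))"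
proof -
  interpret X: graded_in_field S D \<kappa> e by (rule X)
  interpret Y: graded_in_field S' D' \<kappa>' e' by (rule Y)
  let ?X = "Proj S D \<kappa>" and ?Y = "Proj S' D' \<kappa>'" and ?P0 = "{\<zero>\<^bsub>S\<^esub>}"
  obtain U h \<theta> where U: "dense_open ?X U" and m: "morphism (open_subspace ?X U) ?Y h \<theta>"
    using ex by (auto simp: exists_rational_morphism_def)
  have oU: "openin (zariski S D) U" and clU: "zariski S D closure_of U = X.points"
    using U by (auto simp: dense_open_def X.Proj_simps X.topspace_zariski)
  have "U \<noteq> {}" using clU P0 by auto
  then have PU: "?P0 \<in> U" by (rule X.open_generic[OF oU _ P0])
  have Up: "U \<subseteq> X.points" by (rule X.open_points[OF oU])
  let ?XU = "open_subspace ?X U"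
  have tU: "topspace (base ?XU) = U"
    using Up by (auto simp: open_subspace_def X.Proj_simps X.topspace_zariski)
  have sU: "sec ?XU = sec ?X" "scal ?XU = scal ?X" by (simp_all add: open_subspace_def)
  have "continuous_map (base ?XU) (base ?Y) h" using m by (simp add: morphism_def)
  then have Q: "h ?P0 \<in> Y.points"
    using PU tU Y.topspace_zariski by (auto simp: continuous_map_def Y.Proj_simps)
  have "\<exists>\<chi>. let \<Gamma> = Y.coord_funs g in
    (\<forall>x\<in>\<Gamma>. \<forall>y\<in>\<Gamma>. \<chi> (x + y) = \<chi> x + \<chi> y \<and> \<chi> (x * y) = \<chi> x * \<chi> y) \<and>
    (\<forall>x\<in>\<Gamma>. \<chi> x \<in> X.loc ?P0) \<and> (\<forall>c. \<chi> (e' (\<kappa>' c)) = e (\<kappa> c))"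
    if g: "g \<in> D' n" "g \<notin> h ?P0" for g n
  proof -
    define W where "W = Y.dopen g"
    have oW: "openin (base ?Y) W" using Y.openin_dopen[OF g(1)] by (simp add: W_def Y.Proj_simps)
    have Wp: "W \<subseteq> Y.points" by (auto simp: W_def Y.dopen_def)
    have QW: "h ?P0 \<in> W" using Q g(2) by (auto simp: W_def Y.dopen_def)
    let ?p = "preim ?XU h W"
    have pP: "?P0 \<in> ?p" and pp: "?p \<subseteq> X.points"
      using PU QW tU Up by (auto simp: preim_def)
    have hom: "\<theta> W \<in> ring_hom (sec ?Y W) (sec ?X ?p)" and sc: "\<theta> W (scal ?Y W c) = scal ?X ?p c" for c
      using m oW by (auto simp: morphism_def sU)
    define \<sigma> where "\<sigma> x = (\<lambda>P\<in>W. Y.cl P x)" for x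
    have \<sigma>: "\<sigma> x \<in> carrier (sec ?Y W)" if x: "x \<in> Y.coord_funs g" for x
    proof -
      obtain a f k where "a \<in> D' k" "f \<in> D' k" "\<And>P. P \<in> Y.dopen g \<Longrightarrow> f \<notin> P" "x = e' a / e' f"
        using x by (rule Y.coord_funsE) blast
      then show ?thesis unfolding Y.Proj_simps
        using oW by (intro Y.regularI[of W a k f]) (auto simp: \<sigma>_def W_def Y.Proj_simps)
    qed
    define \<chi> where "\<chi> x = X.val (\<theta> W (\<sigma> x) ?P0)" for x
    have reg: "\<theta> W (\<sigma> x) \<in> regular_sections S D ?p" if "x \<in> Y.coord_funs g" for x
      using ring_hom_closed[OF hom \<sigma>[OF that]] by (simp add: X.Proj_simps)
    have "\<chi> (x + y) = \<chi> x + \<chi> y \<and> \<chi> (x * y) = \<chi> x * \<chi> y"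
      if x: "x \<in> Y.coord_funs g" and y: "y \<in> Y.coord_funs g" for x y
    proof -
      have l: "x \<in> Y.loc P" "y \<in> Y.loc P" "P \<in> Y.points" if "P \<in> W" for P
        using Y.coord_funs_loc x y that Wp by (auto simp: W_def)
      have "\<sigma> (x + y) = \<sigma> x \<oplus>\<^bsub>sec ?Y W\<^esub> \<sigma> y" "\<sigma> (x * y) = \<sigma> x \<otimes>\<^bsub>sec ?Y W\<^esub> \<sigma> y"
        unfolding Y.Proj_simps(3,4) using Y.stalk_add Y.stalk_mult l
        by (auto simp: \<sigma>_def intro!: restrict_ext)
      then have "\<theta> W (\<sigma> (x + y)) = \<theta> W (\<sigma> x) \<oplus>\<^bsub>sec ?X ?p\<^esub> \<theta> W (\<sigma> y)"
        "\<theta> W (\<sigma> (x * y)) = \<theta> W (\<sigma> x) \<otimes>\<^bsub>sec ?X ?p\<^esub> \<theta> W (\<sigma> y)"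
        using ring_hom_add[OF hom \<sigma>[OF x] \<sigma>[OF y]] ring_hom_mult[OF hom \<sigma>[OF x] \<sigma>[OF y]] by simp_all
      then show ?thesis
        unfolding \<chi>_def using X.sec_val[OF pp reg[OF x] reg[OF y] pP] by simp
    qed
    moreover have "\<chi> x \<in> X.loc ?P0" if "x \<in> Y.coord_funs g" for x
      unfolding \<chi>_def by (rule X.regular_val(1)[OF reg[OF that] pP pp])
    moreover have "\<chi> (e' (\<kappa>' c)) = e (\<kappa> c)" for c
    proof -
      have "\<sigma> (e' (\<kappa>' c)) = scal ?Y W c" unfolding \<sigma>_def Y.scal_eq[OF Wp] ..
      then show ?thesis
        using X.val_cl[OF X.loc_const[OF P0 X.D_\<kappa>]] pP by (simp add: \<chi>_def sc X.scal_eq[OF pp])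
    qed
    ultimately show ?thesis unfolding Let_def by (intro exI[of _ \<chi>]) blast
  qed
  then show ?thesis using Q by blast
qed

section \<open>The homogeneous coordinate ring of a hypersurface and its points\<close>

context qform
begin

abbreviation Sr :: "('v, 'k) mpoly set ring" where "Sr \<equiv> R Quot I"

definition qt :: "('v, 'k) mpoly \<Rightarrow> ('v, 'k) mpoly set" where
  "qt f = I +>\<^bsub>R\<^esub> f"

definition Dn :: "nat \<Rightarrow> ('v, 'k) mpoly set set" where
  "Dn n = qt ` forms B n"

definition kap :: "'k \<Rightarrow> ('v, 'k) mpoly set" where
  "kap c = qt (Poly_Mapping.single 0 c)"

text \<open>The value at \<open>x\<close> of a representative; the choice is harmless when
  \<open>x\<close> satisfies the linear equation (\<open>es_qt\<close>).\<close>

definition es :: "('v \<Rightarrow> 'k gfield) \<Rightarrow> ('v, 'k) mpoly set \<Rightarrow> 'k gfield" where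
  "es x s = pev kc x (SOME f. f \<in> carrier R \<and> qt f = s)"

lemma hypersurface_eq: "hypersurface p B a = Proj Sr Dn kap"
  by (simp add: hypersurface_def Let_def Dn_def[abs_def] kap_def[abs_def] qt_def[abs_def])

lemma cring_Sr: "cring Sr"
  using ideal_I by (rule ideal.quotient_is_cring) (rule cring_coord_ring)

lemma ring_Sr: "ring Sr"
  using cring_Sr by (rule cring.axioms(1))

lemma qt_hom: "qt \<in> ring_hom R Sr"
  using ideal.rcos_ring_hom[OF ideal_I] by (simp add: qt_def[abs_def])

lemma carrier_Sr: "carrier Sr = qt ` carrier R"
  by (auto simp: FactRing_def A_RCOSETS_def' qt_def)

lemma qt_carrier: "f \<in> carrier R \<Longrightarrow> qt f \<in> carrier Sr"
  by (simp add: carrier_Sr)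

lemma qt_mult: "f \<in> carrier R \<Longrightarrow> g \<in> carrier R \<Longrightarrow> qt f \<otimes>\<^bsub>Sr\<^esub> qt g = qt (f * g)"
  using ring_hom_mult[OF qt_hom] by (simp add: coord_ring_simps)

lemma qt_add: "f \<in> carrier R \<Longrightarrow> g \<in> carrier R \<Longrightarrow> qt f \<oplus>\<^bsub>Sr\<^esub> qt g = qt (f + g)"
  using ring_hom_add[OF qt_hom] by (simp add: coord_ring_simps)

lemma qt_one: "\<one>\<^bsub>Sr\<^esub> = qt 1"
  using ring_hom_one[OF qt_hom] by (simp add: coord_ring_simps)

lemma qt_zero: "\<zero>\<^bsub>Sr\<^esub> = qt 0"
  using ring_hom_zero[OF qt_hom ring_R ring_Sr] by (simp add: coord_ring_simps)

lemma minus_R: "f \<in> carrier R \<Longrightarrow> g \<in> carrier R \<Longrightarrow> f \<ominus>\<^bsub>R\<^esub> g = f - g"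
proof -
  assume f: "f \<in> carrier R" and g: "g \<in> carrier R"
  have "\<ominus>\<^bsub>R\<^esub> g = - g"
    using g by (intro abelian_group.minus_equality[OF ring.is_abelian_group[OF ring_R]])
      (auto simp: coord_ring_simps CR_uminus)
  then show ?thesis using f g by (simp add: a_minus_def coord_ring_simps)
qed

lemma qt_eq_iff: "f \<in> carrier R \<Longrightarrow> g \<in> carrier R \<Longrightarrow> qt f = qt g \<longleftrightarrow> f - g \<in> I"
  using ring.quotient_eq_iff_same_a_r_cos[OF ring_R ideal_I, of f g] by (simp add: qt_def minus_R)

lemma qt_eq_0_iff: "f \<in> carrier R \<Longrightarrow> qt f = \<zero>\<^bsub>Sr\<^esub> \<longleftrightarrow> f \<in> I"
  using qt_eq_iff[OF _ CR_0, of f] by (simp add: qt_zero)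

lemma es_qt:
  assumes x: "(\<Sum>v\<in>B. kc (a v) * x v) = 0" and f: "f \<in> carrier R"
  shows "es x (qt f) = pev kc x f"
proof -
  let ?g = "SOME g. g \<in> carrier R \<and> qt g = qt f"
  have "?g \<in> carrier R \<and> qt ?g = qt f" by (rule someI[of _ f]) (use f in simp)
  then have "?g - f \<in> I" using f qt_eq_iff by blast
  then have "pev kc x (?g - f) = 0" by (rule I_pev_0[OF rhom_kc x])
  then show ?thesis by (simp add: es_def rhom_diff[OF rhom_pev[OF rhom_kc]])
qed

text \<open>\<open>x\<close> may be any point as generic as \<open>gx\<close>, in particular one
  built from the generic point of another hypersurface. This lets two coordinate rings be compared
  inside one field.\<close>

lemma graded:
  assumes x: "(\<Sum>v\<in>B. kc (a v) * x v) = 0"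
    and gen: "\<And>f n. f \<in> forms B n \<Longrightarrow> pev kc x f = 0 \<Longrightarrow> pev kc gx f = 0"
  shows "graded_in_field Sr Dn kap (es x)"
proof (rule graded_in_field.intro)
  note h = rhom_pev[OF rhom_kc, of x]
  show "cring Sr" by (rule cring_Sr)
  show "Dn n \<subseteq> carrier Sr" for n by (auto simp: Dn_def carrier_Sr forms_CR)
  show "s \<oplus>\<^bsub>Sr\<^esub> t \<in> Dn n" if "s \<in> Dn n" "t \<in> Dn n" for s t n
    using that by (auto simp: Dn_def qt_add forms_CR forms_add)
  show "s \<otimes>\<^bsub>Sr\<^esub> t \<in> Dn (n + k)" if "s \<in> Dn n" "t \<in> Dn k" for s t n k
    using that by (auto simp: Dn_def qt_mult forms_CR forms_mult)
  show "\<one>\<^bsub>Sr\<^esub> \<in> Dn 0" by (simp add: qt_one Dn_def forms_1)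
  show "\<zero>\<^bsub>Sr\<^esub> \<in> Dn n" for n by (simp add: qt_zero Dn_def forms_0)
  show "kap c \<in> Dn 0" for c by (simp add: kap_def Dn_def forms_const)
  show "es x (s \<oplus>\<^bsub>Sr\<^esub> t) = es x s + es x t" "es x (s \<otimes>\<^bsub>Sr\<^esub> t) = es x s * es x t"
    if "s \<in> carrier Sr" "t \<in> carrier Sr" for s t
    using that by (auto simp: carrier_Sr qt_add qt_mult es_qt[OF x] CR_add CR_mult rhom_simps[OF h])
  show "es x \<one>\<^bsub>Sr\<^esub> = 1" by (simp add: qt_one es_qt[OF x] CR_1 rhom_1[OF h])
  fix s t n assume st: "s \<in> Dn n" "t \<in> Dn n" "es x s = es x t"
  then obtain f g where fg: "s = qt f" "t = qt g" "f \<in> forms B n" "g \<in> forms B n" by (auto simp: Dn_def)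
  then have "pev kc x (f - g) = 0" using st(3) by (simp add: es_qt[OF x] forms_CR rhom_diff[OF h])
  then have "f - g \<in> I" unfolding I_iff using gen[OF forms_diff[OF fg(3,4)]] fg CR_diff forms_CR by blast
  then show "s = t" using fg qt_eq_iff forms_CR by blast
qed

lemma es_kap: "(\<Sum>v\<in>B. kc (a v) * x v) = 0 \<Longrightarrow> es x (kap c) = kc (c ^ p)"
  by (simp add: kap_def es_qt CR_single ev_const[OF rhom_fp[OF rhom_kc]])

abbreviation pts :: "('v, 'k) mpoly set set set" where "pts \<equiv> proj_points Sr Dn"

abbreviation vr :: "'v \<Rightarrow> ('v, 'k) mpoly" where
  "vr v \<equiv> Poly_Mapping.single (Poly_Mapping.single v (Suc 0)) 1"

lemma zero_point: "{\<zero>\<^bsub>Sr\<^esub>} \<in> pts"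
  unfolding proj_points_def
proof (intro CollectI conjI)
  note h = rhom_pev[OF rhom_kc, of gx]
  show "primeideal {\<zero>\<^bsub>Sr\<^esub>} Sr"
  proof (rule primeidealI)
    show "ideal {\<zero>\<^bsub>Sr\<^esub>} Sr" by (rule ring.zeroideal[OF ring_Sr])
    show "cring Sr" by (rule cring_Sr)
    have "qt 1 \<noteq> \<zero>\<^bsub>Sr\<^esub>" using qt_eq_0_iff[OF CR_1] I_iff[of 1] by (simp add: rhom_1[OF h])
    then show "carrier Sr \<noteq> {\<zero>\<^bsub>Sr\<^esub>}" using qt_carrier[OF CR_1] by auto
    fix s t assume "s \<in> carrier Sr" "t \<in> carrier Sr" and st: "s \<otimes>\<^bsub>Sr\<^esub> t \<in> {\<zero>\<^bsub>Sr\<^esub>}"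
    then obtain f g where fg: "s = qt f" "t = qt g" "f \<in> carrier R" "g \<in> carrier R" by (auto simp: carrier_Sr)
    then have "f * g \<in> I" using st qt_eq_0_iff[OF CR_mult] by (simp add: qt_mult)
    then have "f \<in> I \<or> g \<in> I" using fg by (auto simp: I_iff rhom_mult[OF h])
    then show "s \<in> {\<zero>\<^bsub>Sr\<^esub>} \<or> t \<in> {\<zero>\<^bsub>Sr\<^esub>}" using fg qt_eq_0_iff by auto
  qed
  have "{\<zero>\<^bsub>Sr\<^esub>} \<inter> (\<Union>n. Dn n) = {\<zero>\<^bsub>Sr\<^esub>}" using forms_0 by (auto simp: Dn_def qt_zero)
  then show "{\<zero>\<^bsub>Sr\<^esub>} = genideal Sr ({\<zero>\<^bsub>Sr\<^esub>} \<inter> (\<Union>n. Dn n))"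
    using ring.genideal_zero[OF ring_Sr] by simp
  have "qt (vr b0) \<in> Dn 1" using forms_var[OF b0] by (auto simp: Dn_def)
  moreover have "qt (vr b0) \<noteq> \<zero>\<^bsub>Sr\<^esub>"
    using qt_eq_0_iff[OF forms_CR[OF forms_var[OF b0]]] I_iff gx_nz[OF b0] ev_var[OF rhom_fp[OF rhom_kc], of gx b0] by auto
  ultimately show "\<not> (\<Union>n\<in>{0<..}. Dn n) \<subseteq> {\<zero>\<^bsub>Sr\<^esub>}" by force
qed

lemma pt_ideal: "P \<in> pts \<Longrightarrow> ideal P Sr"
  using primeideal.axioms(1) by (auto simp: proj_points_def)

lemma pt_add: "P \<in> pts \<Longrightarrow> s \<in> P \<Longrightarrow> t \<in> P \<Longrightarrow> s \<oplus>\<^bsub>Sr\<^esub> t \<in> P"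
  using additive_subgroup.a_closed[OF ideal.axioms(1)[OF pt_ideal]] by blast

lemma pt_zero: "P \<in> pts \<Longrightarrow> \<zero>\<^bsub>Sr\<^esub> \<in> P"
  using additive_subgroup.zero_closed[OF ideal.axioms(1)[OF pt_ideal]] by blast

lemma pt_mult: "P \<in> pts \<Longrightarrow> s \<in> P \<Longrightarrow> t \<in> carrier Sr \<Longrightarrow> t \<otimes>\<^bsub>Sr\<^esub> s \<in> P"
  using ideal.I_l_closed[OF pt_ideal] by blast

lemma qt_sum_ideal:
  assumes J: "ideal J Sr" and f: "\<And>i. i \<in> A \<Longrightarrow> f i \<in> carrier R \<and> qt (f i) \<in> J"
  shows "qt (sum f A) \<in> J"
proof -
  note J = ideal.axioms(1)[OF J]
  have "sum f A \<in> carrier R \<and> qt (sum f A) \<in> J"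
    using f
  proof (induction A rule: infinite_finite_induct)
    case (insert i A)
    then show ?case using additive_subgroup.a_closed[OF J, of "qt (f i)" "qt (sum f A)"]
      by (simp add: qt_add CR_add)
  qed (use additive_subgroup.zero_closed[OF J] CR_0 in \<open>auto simp: qt_zero\<close>)
  then show ?thesis by simp
qed

lemmas pt_sum = qt_sum_ideal[OF pt_ideal]

lemma pt_prime: "P \<in> pts \<Longrightarrow> f \<in> carrier R \<Longrightarrow> g \<in> carrier R \<Longrightarrow> qt (f * g) \<in> P \<longleftrightarrow> qt f \<in> P \<or> qt g \<in> P"
  using graded_in_field.point_mult[OF graded[OF gx_rel], of P "qt f" "qt g"]
  by (simp add: qt_carrier qt_mult)

lemma pt_one: "P \<in> pts \<Longrightarrow> qt 1 \<notin> P"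
  using graded_in_field.point_one[OF graded[OF gx_rel], of P] by (simp add: qt_one)

lemma pt_power: "P \<in> pts \<Longrightarrow> f \<in> carrier R \<Longrightarrow> qt (f ^ n) \<in> P \<longleftrightarrow> n > 0 \<and> qt f \<in> P"
  by (induction n) (auto simp: pt_one pt_prime CR_power)

lemma pt_I_cong: "f \<in> carrier R \<Longrightarrow> g \<in> carrier R \<Longrightarrow> f - g \<in> I \<Longrightarrow> qt f \<in> P \<longleftrightarrow> qt g \<in> P"
  using qt_eq_iff by metis

lemma I_hcomp: "f \<in> I \<Longrightarrow> hcomp n f \<in> I"
proof -
  have "I \<subseteq> {f \<in> carrier R. \<forall>n. hcomp n f \<in> I}"
  proof (rule I_least)
    have "hcomp n (form_poly p B a) = (if n = p then form_poly p B a else 0)" for n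
      by (rule hcomp_of_form[OF forms_form_poly])
    then show "form_poly p B a \<in> {f \<in> carrier R. \<forall>n. hcomp n f \<in> I}"
      using form_poly_in form_poly_in_I I_0 by simp
    show "g * f \<in> {f \<in> carrier R. \<forall>n. hcomp n f \<in> I}"
      if "f \<in> {f \<in> carrier R. \<forall>n. hcomp n f \<in> I}" "g \<in> carrier R" for f g
      using that by (auto simp: CR_mult hcomp_mult I_0 intro!: I_sum I_mult forms_CR[OF hcomp_forms])
  qed (auto simp: CR_0 CR_add hcomp_0 hcomp_add I_0 I_add)
  then show "f \<in> I \<Longrightarrow> hcomp n f \<in> I" by blast
qed

text \<open>The elements with a representative all of whose components lie in \<open>P\<close> form
  an ideal. It contains the homogeneous elements of \<open>P\<close>, and these generate
  \<open>P\<close>.\<close>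

lemma pt_hcomp:
  assumes P: "P \<in> pts" and f: "f \<in> carrier R" "qt f \<in> P"
  shows "qt (hcomp n f) \<in> P"
proof -
  define T where "T = {qt g | g. g \<in> carrier R \<and> (\<forall>n. qt (hcomp n g) \<in> P)}"
  have hc: "hcomp n g \<in> carrier R" if "g \<in> carrier R" for g n
    by (rule forms_CR[OF hcomp_forms[OF that]])
  have "ideal T Sr"
  proof (rule ideal_by_closure)
    show "ring Sr" by (rule ring_Sr)
    show "T \<subseteq> carrier Sr" by (auto simp: T_def qt_carrier)
    show "\<zero>\<^bsub>Sr\<^esub> \<in> T" using pt_zero[OF P] CR_0[of B]
      by (auto simp: T_def qt_zero hcomp_0 intro!: exI[of _ 0])
    fix s assume "s \<in> T"
    then obtain g where g: "s = qt g" "g \<in> carrier R" "\<And>n. qt (hcomp n g) \<in> P" by (auto simp: T_def)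
    show "s \<oplus>\<^bsub>Sr\<^esub> t \<in> T" if t: "t \<in> T" for t
    proof -
      obtain h where h: "t = qt h" "h \<in> carrier R" "\<And>n. qt (hcomp n h) \<in> P" using t by (auto simp: T_def)
      have "qt (hcomp n (g + h)) \<in> P" for n
        using pt_add[OF P g(3) h(3), of n n] by (simp add: qt_add hc g(2) h(2) hcomp_add)
      then show ?thesis using g h CR_add[of g B h] by (auto simp: T_def qt_add intro!: exI[of _ "g + h"])
    qed
    fix t assume "t \<in> carrier Sr"
    then obtain h where h: "t = qt h" "h \<in> carrier R" by (auto simp: carrier_Sr)
    have "qt (hcomp n (h * g)) \<in> P" for n
      unfolding hcomp_mult[OF h(2) g(2)]
    proof (rule pt_sum[OF P])
      fix i
      have c: "(if n = i + j then hcomp i h * hcomp j g else 0) \<in> carrier R" for j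
        using hc h(2) g(2) by (simp add: CR_mult CR_0)
      moreover have "qt (if n = i + j then hcomp i h * hcomp j g else 0) \<in> P" for j
        using pt_mult[OF P g(3)[of j] qt_carrier[OF hc[OF h(2), of i]]] pt_zero[OF P]
        by (simp add: qt_mult hc h(2) g(2) qt_zero)
      ultimately have s: "qt (\<Sum>j\<in>hdegs g. if n = i + j then hcomp i h * hcomp j g else 0) \<in> P"
        by (intro pt_sum[OF P]) blast
      show "(\<Sum>j\<in>hdegs g. if n = i + j then hcomp i h * hcomp j g else 0) \<in> carrier R \<and>
        qt (\<Sum>j\<in>hdegs g. if n = i + j then hcomp i h * hcomp j g else 0) \<in> P"
        by (intro conjI CR_sum c s)
    qed
    then have "qt (h * g) \<in> T" using CR_mult[OF h(2) g(2)] by (auto simp: T_def)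
    then show "t \<otimes>\<^bsub>Sr\<^esub> s \<in> T" "s \<otimes>\<^bsub>Sr\<^esub> t \<in> T" using g h by (simp_all add: qt_mult mult.commute)
  qed
  moreover have "P \<inter> (\<Union>n. Dn n) \<subseteq> T"
  proof
    fix s assume "s \<in> P \<inter> (\<Union>n. Dn n)"
    then obtain g k where g: "s = qt g" "g \<in> forms B k" "qt g \<in> P" by (auto simp: Dn_def)
    have "qt (hcomp n g) \<in> P" for n
      using g(3) pt_zero[OF P] by (simp add: hcomp_of_form[OF g(2)] qt_zero)
    then show "s \<in> T" unfolding T_def g(1) using forms_CR[OF g(2)] by blast
  qed
  ultimately have "genideal Sr (P \<inter> (\<Union>n. Dn n)) \<subseteq> T" by (rule ring.genideal_minimal[OF ring_Sr])
  then have "qt f \<in> T" using P f(2) by (auto simp: proj_points_def)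
  then obtain g where g: "qt f = qt g" "g \<in> carrier R" "\<And>n. qt (hcomp n g) \<in> P" by (auto simp: T_def)
  have "hcomp n f - hcomp n g \<in> I"
    using I_hcomp[of "f - g" n] qt_eq_iff[OF f(1) g(2)] g(1) by (simp add: hcomp_diff)
  then show ?thesis using pt_I_cong[OF hc[OF f(1)] hc[OF g(2)]] g(3) by blast
qed

text \<open>Every monomial of positive degree contains a variable, so a point with all variables
  would contain all forms of positive degree.\<close>

lemma pt_var:
  assumes P: "P \<in> pts" shows "\<exists>v\<in>B. qt (vr v) \<notin> P"
proof (rule ccontr)
  assume *: "\<not> ?thesis"
  have "qt f \<in> P" if f: "f \<in> forms B n" "n > 0" for f n
  proof -
    have "Poly_Mapping.single m (Poly_Mapping.lookup f m) \<in> carrier R \<and> qt (Poly_Mapping.single m (Poly_Mapping.lookup f m)) \<in> P"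
      if m: "m \<in> Poly_Mapping.keys f" for m
    proof -
      have mB: "Poly_Mapping.keys m \<subseteq> B" "mdeg m = n" using f m by (auto simp: forms_iff CR_iff)
      have "Poly_Mapping.keys m \<noteq> {}" using mB(2) f(2) by (auto simp: mdeg_def)
      then obtain v where v: "v \<in> Poly_Mapping.keys m" by blast
      define m' where "m' = m - Poly_Mapping.single v (Suc 0)"
      have mm: "m = m' + Poly_Mapping.single v (Suc 0)"
        by (rule poly_mapping_eqI) (use v in \<open>auto simp: m'_def lookup_add lookup_minus lookup_single when_def in_keys_iff\<close>)
      have "Poly_Mapping.keys m' \<subseteq> B" using mB unfolding mm by (auto simp: in_keys_iff lookup_add)
      then have c: "Poly_Mapping.single m' (Poly_Mapping.lookup f m) \<in> carrier R" by (rule CR_single)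
      have vB: "v \<in> B" using v mB by auto
      have e: "Poly_Mapping.single m' (Poly_Mapping.lookup f m) * vr v = Poly_Mapping.single m (Poly_Mapping.lookup f m)"
        unfolding mult_single mm[symmetric] by simp
      have "qt (Poly_Mapping.single m' (Poly_Mapping.lookup f m) * vr v) \<in> P"
        using pt_prime[OF P c forms_CR[OF forms_var[OF vB]]] * vB by blast
      then show ?thesis using CR_single[OF mB(1)] unfolding e by blast
    qed
    then have "qt (\<Sum>m\<in>Poly_Mapping.keys f. Poly_Mapping.single m (Poly_Mapping.lookup f m)) \<in> P"
      by (rule pt_sum[OF P])
    then show ?thesis by (simp flip: mpoly_expand)
  qed
  then have "(\<Union>n\<in>{0<..}. Dn n) \<subseteq> P" by (auto simp: Dn_def)
  then show False using P by (auto simp: proj_points_def)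
qed

lemma pt_eqI:
  assumes "P \<in> pts" "Q \<in> pts" "\<And>n f. f \<in> forms B n \<Longrightarrow> qt f \<in> P \<longleftrightarrow> qt f \<in> Q"
  shows "P = Q"
proof -
  have "P \<inter> (\<Union>n. Dn n) = Q \<inter> (\<Union>n. Dn n)" using assms(3) by (auto simp: Dn_def)
  moreover have "P = genideal Sr (P \<inter> (\<Union>n. Dn n))" "Q = genideal Sr (Q \<inter> (\<Union>n. Dn n))"
    using assms(1,2) unfolding proj_points_def by blast+
  ultimately show ?thesis by argo
qed

end

text \<open>Around the image Q of the generic point, the ratios \<open>Y.gx w / Y.gx w0\<close> are
  regular functions. Their pull-backs are the coordinates of a point of Y over the function field of
  X.\<close>

lemma qpair_of_rational_morphism:
  fixes B :: "'v set" and C :: "'w set" and a :: "'v \<Rightarrow> 'k::field" and b :: "'w \<Rightarrow> 'k"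
  assumes X: "qform p B a ix b0" and Y: "qform p C b iy c0"
    and ex: "exists_rational_morphism (hypersurface p B a) (hypersurface p C b)"
  shows "qpair p B a ix b0 C b iy c0"
proof -
  interpret X: qform p B a ix b0 by (rule X)
  interpret Y: qform p C b iy c0 by (rule Y)
  interpret GX: graded_in_field X.Sr X.Dn X.kap "X.es X.gx" by (rule X.graded[OF X.gx_rel])
  interpret GY: graded_in_field Y.Sr Y.Dn Y.kap "Y.es Y.gx" by (rule Y.graded[OF Y.gx_rel])
  obtain Q where Q: "Q \<in> Y.pts" "\<forall>g n. g \<in> Y.Dn n \<longrightarrow> g \<notin> Q \<longrightarrow> (\<exists>\<chi>.
    let \<Gamma> = GY.coord_funs g in
    (\<forall>x\<in>\<Gamma>. \<forall>y\<in>\<Gamma>. \<chi> (x + y) = \<chi> x + \<chi> y \<and> \<chi> (x * y) = \<chi> x * \<chi> y) \<and>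
    (\<forall>x\<in>\<Gamma>. \<chi> x \<in> GX.loc {\<zero>\<^bsub>X.Sr\<^esub>}) \<and> (\<forall>c. \<chi> (Y.es Y.gx (Y.kap c)) = X.es X.gx (X.kap c)))"
    using rational_morphism_values[OF GX.graded_in_field_axioms GY.graded_in_field_axioms X.zero_point
        ex[unfolded X.hypersurface_eq Y.hypersurface_eq]]
    by (elim bexE)
  obtain w0 where w0: "w0 \<in> C" "Y.qt (Y.vr w0) \<notin> Q" using Y.pt_var[OF Q(1)] by (elim bexE)
  define g where "g = Y.qt (Y.vr w0)"
  have var: "Y.qt (Y.vr w) \<in> Y.Dn 1" if "w \<in> C" for w using forms_var[OF that] by (auto simp: Y.Dn_def)
  have es_var: "Y.es Y.gx (Y.qt (Y.vr w)) = Y.gx w" if "w \<in> C" for w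
    using Y.es_qt[OF Y.gx_rel forms_CR[OF forms_var[OF that]]] by (simp add: ev_var[OF X.rhom_fp[OF rhom_kc]])
  define \<Gamma> where "\<Gamma> = GY.coord_funs g"
  obtain \<chi> where \<chi>0: "let \<Gamma> = GY.coord_funs g in
    (\<forall>x\<in>\<Gamma>. \<forall>y\<in>\<Gamma>. \<chi> (x + y) = \<chi> x + \<chi> y \<and> \<chi> (x * y) = \<chi> x * \<chi> y) \<and>
    (\<forall>x\<in>\<Gamma>. \<chi> x \<in> GX.loc {\<zero>\<^bsub>X.Sr\<^esub>}) \<and> (\<forall>c. \<chi> (Y.es Y.gx (Y.kap c)) = X.es X.gx (X.kap c))"
    using Q(2)[rule_format, OF var[OF w0(1)] w0(2)] unfolding g_def by (elim exE)
  then have \<chi>: "\<chi> (x + y) = \<chi> x + \<chi> y" "\<chi> (x * y) = \<chi> x * \<chi> y" if "x \<in> \<Gamma>" "y \<in> \<Gamma>" for x y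
    using that by (auto simp: \<Gamma>_def Let_def)
  have \<chi>L: "\<chi> x \<in> GX.loc {\<zero>\<^bsub>X.Sr\<^esub>}" if "x \<in> \<Gamma>" for x
    using \<chi>0 that by (auto simp: \<Gamma>_def Let_def)
  have \<chi>c: "\<chi> (kc (c ^ p)) = kc (c ^ p)" for c
    using \<chi>0 by (simp add: Let_def X.es_kap[OF X.gx_rel] Y.es_kap[OF Y.gx_rel])
  have Qg: "Q \<in> GY.dopen g" using Q(1) w0(2) by (simp add: g_def GY.dopen_def)
  have \<Gamma>: "x * y \<in> \<Gamma>" "x + y \<in> \<Gamma>" if "x \<in> \<Gamma>" "y \<in> \<Gamma>" for x y
    using GY.coord_funs_closed[OF Qg] that by (simp_all add: \<Gamma>_def)
  have \<Gamma>c: "kc (c ^ p) \<in> \<Gamma>" for c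
    using GY.coord_funsI[OF GY.D_\<kappa>[of c] GY.D_one, of g] GY.point_one GY.e_one
    by (simp add: \<Gamma>_def GY.dopen_def Y.es_kap[OF Y.gx_rel])
  have \<Gamma>1: "1 \<in> \<Gamma>" "\<chi> 1 = 1" using \<Gamma>c[of 1] \<chi>c[of 1] by (simp_all add: rhom_1[OF rhom_kc])
  have \<Gamma>0: "0 \<in> \<Gamma>" "\<chi> 0 = 0"
    using \<Gamma>c[of 0] \<chi>c[of 0] by (simp_all add: zero_power[OF X.p_pos] rhom_0[OF rhom_kc])
  have \<chi>_power: "x ^ n \<in> \<Gamma> \<and> \<chi> (x ^ n) = \<chi> x ^ n" if "x \<in> \<Gamma>" for x n
    by (induction n) (use that \<Gamma> \<Gamma>1 \<chi> in auto)
  have \<chi>_sum: "sum f A \<in> \<Gamma> \<and> \<chi> (sum f A) = (\<Sum>i\<in>A. \<chi> (f i))" if "\<And>i. i \<in> A \<Longrightarrow> f i \<in> \<Gamma>" for f and A :: "'w set"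
    using that by (induction A rule: infinite_finite_induct) (auto simp: \<Gamma>0 \<Gamma> \<chi>)
  define u where "u w = Y.gx w / Y.gx w0" for w
  have u: "u w \<in> \<Gamma>" if "w \<in> C" for w
    using GY.coord_funsI[OF var[OF that] var[OF w0(1)], of g]
    by (simp add: \<Gamma>_def u_def g_def es_var that w0(1) GY.dopen_def)
  have "(\<Sum>w\<in>C. kc (b w) * u w) = (\<Sum>w\<in>C. kc (b w) * Y.gx w) / Y.gx w0"
    by (simp add: u_def sum_divide_distrib)
  \<comment> \<open>\<open>\<chi>\<close> is known to fix F^p, while the \<open>b w\<close>
    themselves need not be in its domain. The linear equation is therefore raised to the p-th power
    before it is transported.\<close>
  then have "0 = (\<Sum>w\<in>C. kc (b w) * u w) ^ p" using Y.gx_rel X.p_pos by simp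
  also have "\<dots> = (\<Sum>w\<in>C. kc (b w ^ p) * u w ^ p)"
    by (simp add: rhom_sum[OF X.frob_gfield] power_mult_distrib rhom_power[OF rhom_kc])
  finally have "0 = (\<Sum>w\<in>C. kc (b w ^ p) * u w ^ p)" .
  then have "0 = \<chi> (\<Sum>w\<in>C. kc (b w ^ p) * u w ^ p)" using \<Gamma>0 by simp
  also have "\<dots> = (\<Sum>w\<in>C. kc (b w ^ p) * \<chi> (u w) ^ p)"
    using \<chi>_sum[of C "\<lambda>w. kc (b w ^ p) * u w ^ p"] u \<Gamma>c \<chi>_power \<chi>c by (simp add: \<Gamma> \<chi>)
  also have "\<dots> = (\<Sum>w\<in>C. kc (b w) * \<chi> (u w)) ^ p"
    by (simp add: rhom_sum[OF X.frob_gfield] power_mult_distrib rhom_power[OF rhom_kc])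
  finally have rel: "(\<Sum>w\<in>C. kc (b w) * \<chi> (u w)) = 0" by simp
  have "\<chi> (u w0) = 1" using \<Gamma>1 Y.gx_nz[OF w0(1)] by (simp add: u_def)
  moreover have "x \<in> X.Lf" if loc: "x \<in> GX.loc {\<zero>\<^bsub>X.Sr\<^esub>}" for x
  proof -
    obtain s t n where st: "s \<in> X.Dn n" "t \<in> X.Dn n" "t \<notin> {\<zero>\<^bsub>X.Sr\<^esub>}" "x = X.es X.gx s / X.es X.gx t"
      using loc by (rule GX.locE)
    have nz: "X.es X.gx t \<noteq> 0" by (rule GX.e_nz[OF X.zero_point st(2,3)])
    obtain f h where fh: "s = X.qt f" "t = X.qt h" "f \<in> forms B n" "h \<in> forms B n"
      using st(1,2) by (auto simp: X.Dn_def)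
    have "X.es X.gx s = X.pev kc X.gx f" "X.es X.gx t = X.pev kc X.gx h"
      unfolding fh(1,2) by (intro X.es_qt X.gx_rel forms_CR[OF fh(3)] forms_CR[OF fh(4)])+
    then show ?thesis using X.LfI[OF fh(3,4)] nz st(4) by simp
  qed
  ultimately have "(\<forall>w\<in>C. \<chi> (u w) \<in> X.Lf) \<and> (\<exists>w\<in>C. \<chi> (u w) \<noteq> 0) \<and> (\<Sum>w\<in>C. kc (b w) * \<chi> (u w)) = 0"
    using rel \<chi>L[OF u] w0(1) by force
  then have "\<exists>y. (\<forall>w\<in>C. y w \<in> X.Lf) \<and> (\<exists>w\<in>C. y w \<noteq> 0) \<and> (\<Sum>w\<in>C. kc (b w) * y w) = 0"
    by (intro exI[of _ "\<lambda>w. \<chi> (u w)"])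
  then show ?thesis by (intro qpair.intro qpair_axioms.intro X Y)
qed

section \<open>Maps of hypersurfaces given by forms\<close>

locale qmap = X: qform p B a ix b0 + Y: qform p C b iy c0
  for p :: nat and B :: "'v set" and a :: "'v \<Rightarrow> 'k::field" and ix b0
    and C :: "'w set" and b :: "'w \<Rightarrow> 'k" and iy c0 +
  fixes G :: "'w \<Rightarrow> ('v, 'k) mpoly" and D :: nat
  assumes G: "w \<in> C \<Longrightarrow> G w \<in> forms B D" and D: "D > 0"
    and GI: "f \<in> Y.I \<Longrightarrow> psubst G f \<in> X.I"
begin

definition gam :: "('w, 'k) mpoly set \<Rightarrow> ('v, 'k) mpoly set" where
  "gam s = X.qt (psubst G (SOME f. f \<in> carrier Y.R \<and> Y.qt f = s))"

definition pre :: "('v, 'k) mpoly set set \<Rightarrow> ('w, 'k) mpoly set set" where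
  "pre P = {s \<in> carrier Y.Sr. gam s \<in> P}"

lemma subst_CR: "f \<in> carrier Y.R \<Longrightarrow> psubst G f \<in> carrier X.R"
  by (rule psubst_CR[of C G B D]) (rule G)

lemma subst_forms: "f \<in> forms C n \<Longrightarrow> psubst G f \<in> forms B (n * D)"
  by (rule psubst_forms[of C G B D]) (rule G)

lemma gam_qt: assumes "f \<in> carrier Y.R" shows "gam (Y.qt f) = X.qt (psubst G f)"
proof -
  let ?g = "SOME g. g \<in> carrier Y.R \<and> Y.qt g = Y.qt f"
  have g: "?g \<in> carrier Y.R \<and> Y.qt ?g = Y.qt f" by (rule someI[of _ f]) (use assms in simp)
  then have "?g - f \<in> Y.I" using assms Y.qt_eq_iff by blast
  then have "psubst G ?g - psubst G f \<in> X.I" using GI[of "?g - f"] by (simp add: rhom_diff[OF rhom_psubst])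
  then show ?thesis unfolding gam_def using X.qt_eq_iff[OF subst_CR subst_CR] g assms by blast
qed

lemma gam_hom: "gam \<in> ring_hom Y.Sr X.Sr"
proof (rule ring_hom_memI)
  fix s t assume "s \<in> carrier Y.Sr" "t \<in> carrier Y.Sr"
  then obtain f g where [simp]: "s = Y.qt f" "t = Y.qt g" "f \<in> carrier Y.R" "g \<in> carrier Y.R"
    by (auto simp: Y.carrier_Sr)
  note [simp] = gam_qt subst_CR rhom_simps[OF rhom_psubst]
  show "gam s \<in> carrier X.Sr" by (simp add: X.qt_carrier)
  show "gam (s \<otimes>\<^bsub>Y.Sr\<^esub> t) = gam s \<otimes>\<^bsub>X.Sr\<^esub> gam t" by (simp add: Y.qt_mult X.qt_mult CR_mult)
  show "gam (s \<oplus>\<^bsub>Y.Sr\<^esub> t) = gam s \<oplus>\<^bsub>X.Sr\<^esub> gam t" by (simp add: Y.qt_add X.qt_add CR_add)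
next
  show "gam \<one>\<^bsub>Y.Sr\<^esub> = \<one>\<^bsub>X.Sr\<^esub>"
    by (simp add: Y.qt_one X.qt_one gam_qt CR_1 rhom_1[OF rhom_psubst])
qed

lemma pre_qt: "f \<in> carrier Y.R \<Longrightarrow> Y.qt f \<in> pre P \<longleftrightarrow> X.qt (psubst G f) \<in> P"
  by (simp add: pre_def Y.qt_carrier gam_qt)

text \<open>Substitution multiplies degrees by \<open>D\<close>, so the components of a member of
  the preimage are sent to components of a member of \<open>P\<close>, which again lie in
  \<open>P\<close>. The form \<open>g\<close> certifies that \<open>P\<close> is not in the base
  locus.\<close>

lemma pre_point:
  assumes P: "P \<in> X.pts" and g: "g \<in> forms C n" "n > 0" "X.qt (psubst G g) \<notin> P"
  shows "pre P \<in> Y.pts"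
  unfolding proj_points_def
proof (intro CollectI conjI)
  have prm: "primeideal P X.Sr" using P by (simp add: proj_points_def)
  have "ring_hom_ring Y.Sr X.Sr gam"
    using Y.ring_Sr X.ring_Sr gam_hom by (intro ring_hom_ringI2)
  from ring_hom_ring.primeideal_vimage[OF this Y.cring_Sr prm]
  show pr: "primeideal (pre P) Y.Sr" unfolding pre_def .
  have idl: "ideal (pre P) Y.Sr" by (rule primeideal.axioms(1)[OF pr])
  let ?J = "genideal Y.Sr (pre P \<inter> (\<Union>n. Y.Dn n))"
  have sub: "pre P \<inter> (\<Union>n. Y.Dn n) \<subseteq> carrier Y.Sr" by (auto simp: pre_def)
  have J: "ideal ?J Y.Sr" by (rule ring.genideal_ideal[OF Y.ring_Sr sub])
  show "pre P = ?J"
  proof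
    show "?J \<subseteq> pre P" by (rule ring.genideal_minimal[OF Y.ring_Sr idl]) blast
    show "pre P \<subseteq> ?J"
    proof
      fix s assume s: "s \<in> pre P"
      then obtain f where f: "s = Y.qt f" "f \<in> carrier Y.R" by (auto simp: pre_def Y.carrier_Sr)
      have "Y.qt (hcomp n f) \<in> ?J" for n
      proof -
        have h: "hcomp n f \<in> forms C n" by (rule hcomp_forms[OF f(2)])
        have "X.qt (psubst G f) \<in> P" using s f pre_qt by blast
        then have "X.qt (psubst G (hcomp n f)) \<in> P"
          using X.pt_hcomp[OF P subst_CR[OF f(2)], of "n * D"] hcomp_psubst[of C G B D, OF G D f(2), of n] by simp
        then have "Y.qt (hcomp n f) \<in> pre P \<inter> (\<Union>n. Y.Dn n)"
          using pre_qt[OF forms_CR[OF h]] h by (auto simp: Y.Dn_def)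
        then show ?thesis using ring.genideal_self[OF Y.ring_Sr sub] by blast
      qed
      then have "Y.qt (\<Sum>n\<in>hdegs f. hcomp n f) \<in> ?J"
        by (intro Y.qt_sum_ideal[OF J] conjI forms_CR[OF hcomp_forms[OF f(2)]])
      then show "s \<in> ?J" unfolding f(1) by (simp flip: hcomp_expand)
    qed
  qed
  show "\<not> (\<Union>n\<in>{0<..}. Y.Dn n) \<subseteq> pre P"
  proof
    assume "(\<Union>n\<in>{0<..}. Y.Dn n) \<subseteq> pre P"
    moreover have "Y.qt g \<in> (\<Union>n\<in>{0<..}. Y.Dn n)" using g(1,2) by (auto simp: Y.Dn_def)
    ultimately show False using pre_qt[OF forms_CR[OF g(1)], of P] g(3) by blast
  qed
qed

end

text \<open>\<open>H\<close> takes the generic point of Y to a generic point of X, and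
  \<open>G\<close> takes this back to a multiple of the former. The multiplier has degree
  \<open>m\<close>, whence \<open>m + 1 = D * D'\<close>.\<close>

locale qbir = X: qform p B a ix b0 + Y: qform p C b iy c0
  for p :: nat and B :: "'v set" and a :: "'v \<Rightarrow> 'k::field" and ix b0
    and C :: "'w set" and b :: "'w \<Rightarrow> 'k" and iy c0 +
  fixes G :: "'w \<Rightarrow> ('v, 'k) mpoly" and D :: nat and H :: "'v \<Rightarrow> ('w, 'k) mpoly" and D' :: nat
    and q' :: "('w, 'k) mpoly" and m :: nat
  assumes deg: "m + 1 = D * D'"
    and G: "w \<in> C \<Longrightarrow> G w \<in> forms B D" and H: "v \<in> B \<Longrightarrow> H v \<in> forms C D'"
    and q': "q' \<in> forms C m" and q'_nz: "ev (\<lambda>c. kc (c ^ p)) Y.gx q' \<noteq> 0"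
    and z_rel: "(\<Sum>v\<in>B. kc (a v) * ev (\<lambda>c. kc (c ^ p)) Y.gx (H v)) = 0"
    and z_gen: "f \<in> forms B n \<Longrightarrow> ev (\<lambda>c. kc (c ^ p)) (\<lambda>v. ev (\<lambda>c. kc (c ^ p)) Y.gx (H v)) f = 0 \<Longrightarrow>
      ev (\<lambda>c. kc (c ^ p)) X.gx f = 0"
    and G_H: "w \<in> C \<Longrightarrow> ev (\<lambda>c. kc (c ^ p)) (\<lambda>v. ev (\<lambda>c. kc (c ^ p)) Y.gx (H v)) (G w)
      = ev (\<lambda>c. kc (c ^ p)) Y.gx q' * Y.gx w"
begin

abbreviation val :: "('u \<Rightarrow> 'k gfield) \<Rightarrow> ('u, 'k) mpoly \<Rightarrow> 'k gfield" where
  "val \<equiv> ev (\<lambda>c. kc (c ^ p))"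

abbreviation z :: "'v \<Rightarrow> 'k gfield" where
  "z v \<equiv> val Y.gx (H v)"

abbreviation r :: "'k gfield" where
  "r \<equiv> val Y.gx q'"

lemmas rhom_fp = X.rhom_fp[OF rhom_kc]
lemmas hval = rhom_ev[OF rhom_fp]

lemma D_pos: "D > 0" "D' > 0"
  using deg by (auto intro: gr0I)

lemma val_H: "val Y.gx (psubst H f) = val z f"
  by (rule ev_psubst[OF rhom_fp])

lemma val_G: assumes "f \<in> forms C n" shows "val z (psubst G f) = r ^ n * val Y.gx f"
proof -
  have "val z (psubst G f) = val (\<lambda>w. r * Y.gx w) f"
    unfolding ev_psubst[OF rhom_fp] by (rule ev_form_cong[OF assms G_H])
  then show ?thesis by (simp add: ev_forms_scale[OF assms])
qed

lemma X_I: "f \<in> forms B n \<Longrightarrow> val z f = 0 \<Longrightarrow> f \<in> X.I"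
  unfolding X.I_iff using forms_CR z_gen by blast

lemma G_CR: "f \<in> carrier Y.R \<Longrightarrow> psubst G f \<in> carrier X.R"
  by (rule psubst_CR[of C G B D]) (rule G)

lemma G_forms: "f \<in> forms C n \<Longrightarrow> psubst G f \<in> forms B (n * D)"
  by (rule psubst_forms[of C G B D]) (rule G)

sublocale G: qmap p B a ix b0 C b iy c0 G D
proof unfold_locales
  show "w \<in> C \<Longrightarrow> G w \<in> forms B D" for w by (rule G)
  show "D > 0" by (rule D_pos)
  let ?J = "{f \<in> carrier Y.R. psubst G f \<in> X.I}"
  note h = rhom_psubst[of G]
  have "Y.I \<subseteq> ?J"
  proof (rule Y.I_least)
    have "psubst G (form_poly p C b) \<in> X.I"
      using G_forms[OF forms_form_poly] val_G[OF forms_form_poly] Y.I_pev_0[OF rhom_kc Y.gx_rel Y.form_poly_in_I]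
      by (intro X_I) simp_all
    then show "form_poly p C b \<in> ?J" using Y.form_poly_in by simp
  qed (auto simp: CR_0 CR_add CR_mult rhom_simps[OF h] X.I_0 X.I_add intro!: X.I_mult G_CR)
  then show "f \<in> Y.I \<Longrightarrow> psubst G f \<in> X.I" for f by blast
qed

sublocale H: qmap p C b iy c0 B a ix b0 H D'
proof unfold_locales
  show "v \<in> B \<Longrightarrow> H v \<in> forms C D'" for v by (rule H)
  show "D' > 0" by (rule D_pos)
  fix f assume f: "f \<in> X.I"
  have "psubst H f \<in> carrier Y.R" using H X.I_CR[OF f] by (rule psubst_CR)
  then show "psubst H f \<in> Y.I"
    unfolding Y.I_iff val_H using X.I_pev_0[OF rhom_kc z_rel f] by simp
qed

text \<open>The two maps will be mutually inverse between the open sets where \<open>q\<close> and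
  \<open>q'\<close> do not vanish.\<close>

definition q :: "('v, 'k) mpoly" where
  "q = psubst G q'"

lemma q: "q \<in> forms B (m * D)"
  unfolding q_def by (rule G_forms[OF q'])

lemma val_q: "val z q = r ^ (D * D')"
  unfolding q_def val_G[OF q'] by (simp flip: deg)

text \<open>The map \<open>G \<circ> H\<close> is multiplication by a \<open>D\<close>-th root of \<open>q\<close> in the function field; \<open>D\<close>-th powers
  turn this into a relation between polynomials.\<close>

lemma GH: assumes f: "f \<in> forms B n" shows "psubst G (psubst H f) ^ D - q ^ n * f ^ D \<in> X.I"
proof (rule X_I)
  note Hf = H.subst_forms[OF f]
  have "psubst G (psubst H f) ^ D \<in> forms B (n * D' * D * D)"
    using forms_power[OF G_forms[OF Hf], of D] by (simp add: mult_ac)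
  moreover have "n * D' * D * D = m * D * n + n * D"
    using arg_cong[OF deg, of "\<lambda>i. n * D * i"] by (simp add: algebra_simps)
  then have "q ^ n * f ^ D \<in> forms B (n * D' * D * D)"
    using forms_mult[OF forms_power[OF q, of n] forms_power[OF f, of D]] by (simp add: mult_ac)
  ultimately show "psubst G (psubst H f) ^ D - q ^ n * f ^ D \<in> forms B (n * D' * D * D)"
    by (rule forms_diff)
  show "val z (psubst G (psubst H f) ^ D - q ^ n * f ^ D) = 0"
    by (simp add: rhom_simps[OF hval] val_G[OF Hf] val_H val_q power_mult_distrib mult_ac flip: power_mult)
qed

text \<open>In this order the composite multiplies the coordinates by \<open>q'\<close> itself, so
  no root is involved.\<close>

lemma HG: assumes f: "f \<in> forms C n" shows "psubst H (psubst G f) - q' ^ n * f \<in> Y.I"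
  unfolding Y.I_iff
  using H.subst_CR[OF G_CR[OF forms_CR[OF f]]] CR_mult[OF CR_power[OF forms_CR[OF q']] forms_CR[OF f]]
  by (simp add: CR_diff rhom_simps[OF hval] val_G[OF f] val_H)

lemma GH_pt:
  assumes P: "P \<in> X.pts" "X.qt q \<notin> P" and f: "f \<in> forms B n"
  shows "X.qt (psubst G (psubst H f)) \<in> P \<longleftrightarrow> X.qt f \<in> P"
proof -
  note c = forms_CR[OF q] forms_CR[OF f] G_CR[OF H.subst_CR[OF forms_CR[OF f]]]
  have "X.qt (psubst G (psubst H f) ^ D) \<in> P \<longleftrightarrow> X.qt (q ^ n * f ^ D) \<in> P"
    by (rule X.pt_I_cong[OF _ _ GH[OF f]]) (simp_all add: c CR_power CR_mult)
  then show ?thesis using P D_pos by (simp add: c CR_power X.pt_power X.pt_prime)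
qed

lemma HG_pt:
  assumes Q: "Q \<in> Y.pts" "Y.qt q' \<notin> Q" and f: "f \<in> forms C n"
  shows "Y.qt (psubst H (psubst G f)) \<in> Q \<longleftrightarrow> Y.qt f \<in> Q"
proof -
  note c = forms_CR[OF q'] forms_CR[OF f] H.subst_CR[OF G_CR[OF forms_CR[OF f]]]
  have "Y.qt (psubst H (psubst G f)) \<in> Q \<longleftrightarrow> Y.qt (q' ^ n * f) \<in> Q"
    by (rule Y.pt_I_cong[OF _ _ HG[OF f]]) (simp_all add: c CR_power CR_mult)
  then show ?thesis using Q by (simp add: c CR_power Y.pt_power Y.pt_prime)
qed

text \<open>A variable outside \<open>P\<close> stays outside after the double substitution, by
  \<open>GH_pt\<close>. Its image under \<open>H\<close> is then a form of positive degree showing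
  that \<open>P\<close> is not in the base locus of \<open>G\<close>.\<close>

lemma G_pre:
  assumes P: "P \<in> X.pts" "X.qt q \<notin> P" shows "G.pre P \<in> Y.pts" "Y.qt q' \<notin> G.pre P"
proof -
  obtain v where v: "v \<in> B" "X.qt (X.vr v) \<notin> P" using X.pt_var[OF P(1)] by (elim bexE)
  have "X.qt (psubst G (psubst H (X.vr v))) \<notin> P" using GH_pt[OF P forms_var[OF v(1)]] v(2) by simp
  then show "G.pre P \<in> Y.pts"
    using H.subst_forms[OF forms_var[OF v(1)]] D_pos by (intro G.pre_point[OF P(1), where n = D' and g = "psubst H (X.vr v)"]) simp_all
  show "Y.qt q' \<notin> G.pre P" using P(2) by (simp add: G.pre_qt[OF forms_CR[OF q']] q_def)
qed

lemma H_pre: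
  assumes Q: "Q \<in> Y.pts" "Y.qt q' \<notin> Q" shows "H.pre Q \<in> X.pts" "X.qt q \<notin> H.pre Q"
proof -
  obtain w where w: "w \<in> C" "Y.qt (Y.vr w) \<notin> Q" using Y.pt_var[OF Q(1)] by (elim bexE)
  have "Y.qt (psubst H (psubst G (Y.vr w))) \<notin> Q" using HG_pt[OF Q forms_var[OF w(1)]] w(2) by simp
  then show "H.pre Q \<in> X.pts"
    using G_forms[OF forms_var[OF w(1)]] D_pos by (intro H.pre_point[OF Q(1), where n = D and g = "psubst G (Y.vr w)"]) simp_all
  show "X.qt q \<notin> H.pre Q"
    using Q(2) HG_pt[OF Q q'] by (simp add: H.pre_qt[OF forms_CR[OF q]]) (simp add: q_def)
qed

lemma H_G_pre: assumes P: "P \<in> X.pts" "X.qt q \<notin> P" shows "H.pre (G.pre P) = P"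
  using GH_pt[OF P]
  by (intro X.pt_eqI H_pre G_pre P) (simp add: H.pre_qt G.pre_qt forms_CR H.subst_CR)

lemma G_H_pre: assumes Q: "Q \<in> Y.pts" "Y.qt q' \<notin> Q" shows "G.pre (H.pre Q) = Q"
  using HG_pt[OF Q]
  by (intro Y.pt_eqI H_pre G_pre Q) (simp add: H.pre_qt G.pre_qt forms_CR G_CR)

text \<open>X is read through \<open>z\<close> rather than through \<open>X.gx\<close>. Both
  coordinate rings then take values in the field of the generic point of Y, and the compatibility of
  fractions reduces to \<open>val_G\<close> and \<open>val_H\<close>.\<close>

theorem birational: "birational (hypersurface p B a) (hypersurface p C b)"
proof -
  interpret GX: graded_in_field X.Sr X.Dn X.kap "X.es z" by (rule X.graded[OF z_rel z_gen])
  interpret GY: graded_in_field Y.Sr Y.Dn Y.kap "Y.es Y.gx" by (rule Y.graded[OF Y.gx_rel])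
  let ?U = "GX.dopen (X.qt q)" and ?V = "GY.dopen (Y.qt q')"
  have qD: "X.qt q \<in> X.Dn (m * D)" using q by (auto simp: X.Dn_def)
  have q'D: "Y.qt q' \<in> Y.Dn m" using q' by (auto simp: Y.Dn_def)
  note oU = GX.openin_dopen[OF qD] and oV = GY.openin_dopen[OF q'D]
  have mem: "P \<in> ?U \<longleftrightarrow> P \<in> X.pts \<and> X.qt q \<notin> P" "Q \<in> ?V \<longleftrightarrow> Q \<in> Y.pts \<and> Y.qt q' \<notin> Q" for P Q
    by (simp_all add: GX.dopen_def GY.dopen_def)
  have es: "X.es z (X.qt f) = val z f" if "f \<in> forms B n" for f n
    by (rule X.es_qt[OF z_rel forms_CR[OF that]])
  have es': "Y.es Y.gx (Y.qt f) = val Y.gx f" if "f \<in> forms C n" for f n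
    by (rule Y.es_qt[OF Y.gx_rel forms_CR[OF that]])
  have kap: "X.es z (X.kap c) = Y.es Y.gx (Y.kap c)" for c
    by (simp add: X.es_kap[OF z_rel] Y.es_kap[OF Y.gx_rel])
  have 1: "proj_map X.Sr X.Dn X.kap (X.es z) Y.Sr Y.Dn Y.kap (Y.es Y.gx) G.gam D ?U ?V G.pre"
  proof (intro proj_map.intro proj_map_axioms.intro GX.graded_in_field_axioms GY.graded_in_field_axioms kap oU oV)
    show "G.gam s \<in> X.Dn (n * D)" if "s \<in> Y.Dn n" for s n
      using that G_forms by (auto simp: Y.Dn_def X.Dn_def G.gam_qt forms_CR)
    show "X.es z (G.gam s) * Y.es Y.gx t = X.es z (G.gam t) * Y.es Y.gx s"
      if "s \<in> Y.Dn n" "t \<in> Y.Dn n" for s t n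
      using that by (auto simp: Y.Dn_def G.gam_qt forms_CR es[OF G_forms] es' val_G)
    show "G.pre P \<in> ?V" if "P \<in> ?U" for P using that G_pre by (simp add: mem)
    show "s \<in> G.pre P \<longleftrightarrow> G.gam s \<in> P" if "s \<in> Y.Dn n" for s P n
      using that by (auto simp: G.pre_def Y.Dn_def Y.qt_carrier forms_CR)
  qed
  have 2: "proj_map Y.Sr Y.Dn Y.kap (Y.es Y.gx) X.Sr X.Dn X.kap (X.es z) H.gam D' ?V ?U H.pre"
  proof (intro proj_map.intro proj_map_axioms.intro GX.graded_in_field_axioms GY.graded_in_field_axioms
      kap[symmetric] oU oV)
    show "H.gam s \<in> Y.Dn (n * D')" if "s \<in> X.Dn n" for s n
      using that H.subst_forms by (auto simp: Y.Dn_def X.Dn_def H.gam_qt forms_CR)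
    show "Y.es Y.gx (H.gam s) * X.es z t = Y.es Y.gx (H.gam t) * X.es z s"
      if "s \<in> X.Dn n" "t \<in> X.Dn n" for s t n
      using that by (auto simp: X.Dn_def H.gam_qt forms_CR es es'[OF H.subst_forms] val_H)
    show "H.pre Q \<in> ?U" if "Q \<in> ?V" for Q using that H_pre by (simp add: mem)
    show "s \<in> H.pre Q \<longleftrightarrow> H.gam s \<in> Q" if "s \<in> X.Dn n" for s Q n
      using that by (auto simp: H.pre_def X.Dn_def X.qt_carrier forms_CR)
  qed
  have "val z q \<noteq> 0" using q'_nz by (simp add: val_q)
  then have "X.qt q \<noteq> \<zero>\<^bsub>X.Sr\<^esub>" using es[OF q] GX.e_zero by auto
  then have "{\<zero>\<^bsub>X.Sr\<^esub>} \<in> ?U" using X.zero_point by (simp add: mem)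
  then have dU: "dense_open (hypersurface p B a) ?U"
    unfolding X.hypersurface_eq by (rule GX.dense_openI[OF oU _ X.zero_point])
  have "Y.qt q' \<noteq> \<zero>\<^bsub>Y.Sr\<^esub>" using es'[OF q'] GY.e_zero q'_nz by auto
  then have "{\<zero>\<^bsub>Y.Sr\<^esub>} \<in> ?V" using Y.zero_point by (simp add: mem)
  then have dV: "dense_open (hypersurface p C b) ?V"
    unfolding Y.hypersurface_eq by (rule GY.dense_openI[OF oV _ Y.zero_point])
  have "isomorphic (open_subspace (hypersurface p B a) ?U) (open_subspace (hypersurface p C b) ?V)"
    unfolding X.hypersurface_eq Y.hypersurface_eq
    by (rule isomorphic_by_polys[OF 1 2]) (simp_all add: mem H_G_pre G_H_pre)
  then show ?thesis unfolding birational_def using dU dV by blast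
qed

end

section \<open>From quasilinear forms on vector spaces to coordinates\<close>

text \<open>The value of the form at a combination of basis vectors is the sum of the
  \<open>\<phi> v * e v ^ p\<close>, so anisotropy is independence over F^p of the values on the
  basis.\<close>

lemma qform_of_quasilinear:
  fixes scale :: "'k::field \<Rightarrow> 'v::ab_group_add \<Rightarrow> 'v"
  assumes p: "prime p" "CHAR('k) = p" and V: "finite_dimensional_vector_space scale B"
    and dim: "vector_space.dim scale (UNIV :: 'v set) = d + 2"
    and \<phi>: "quasilinear_form p scale \<phi>" "\<not> isotropic \<phi>"
  shows "card B = d + 2 \<and> (\<exists>ix b0. qform p B \<phi> ix b0)"
proof -
  interpret V: finite_dimensional_vector_space scale B by (rule V)
  have card: "card B = d + 2" using dim by simp
  have lin: "\<phi> (scale c v) = c ^ p * \<phi> v" "\<phi> (v + w) = \<phi> v + \<phi> w" for c v w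
    using \<phi>(1) by (simp_all add: quasilinear_form_def)
  have "\<phi> 0 = 0" using lin(1)[of 0 0] prime_gt_0_nat[OF p(1)] by (simp add: zero_power)
  then have \<phi>_sum: "\<phi> (\<Sum>v\<in>S. scale (e v) v) = (\<Sum>v\<in>S. \<phi> v * e v ^ p)" for S e
    by (induction S rule: infinite_finite_induct) (auto simp: lin mult.commute)
  have "e v = 0" if "(\<Sum>v\<in>B. \<phi> v * e v ^ p) = 0" "v \<in> B" for e v
  proof -
    have "(\<Sum>v\<in>B. scale (e v) v) = 0" using \<phi>(2) \<phi>_sum[of e B] that(1) by (auto simp: isotropic_def)
    from V.independentD[OF V.independent_Basis V.finite_Basis subset_refl this that(2)] show ?thesis .
  qed
  then have kind: "\<forall>e. (\<Sum>v\<in>B. \<phi> v * e v ^ p) = 0 \<longrightarrow> (\<forall>v\<in>B. e v = 0)" by blast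
  have "B \<noteq> {}" using card by auto
  then obtain b0 where b0: "b0 \<in> B" by blast
  obtain ix :: "'v \<Rightarrow> nat" where "inj_on ix B" using finite_imp_inj_to_nat_seg[OF V.finite_Basis] by blast
  then have ix: "inj_on ix (B - {b0})" by (rule inj_on_subset) blast
  interpret charp p "TYPE('k)" using p by unfold_locales
  have "qform p B \<phi> ix b0"
    using V.finite_Basis b0 ix card kind by unfold_locales (auto simp: kindp_def)
  then show ?thesis using card by blast
qed

theorem proposition7p11:
  fixes p d n :: nat
    and scaleV :: "'k::field \<Rightarrow> 'v::ab_group_add \<Rightarrow> 'v" and BV :: "'v set" and \<phi> :: "'v \<Rightarrow> 'k"
    and scaleW :: "'k \<Rightarrow> 'w::ab_group_add \<Rightarrow> 'w" and BW :: "'w set" and \<psi> :: "'w \<Rightarrow> 'k"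
  assumes "prime p" and "CHAR('k) = p"
    and not_perfect: "\<not> surj (\<lambda>x::'k. x ^ p)"
    and V: "finite_dimensional_vector_space scaleV BV"
    and W: "finite_dimensional_vector_space scaleW BW"
    and dimV: "vector_space.dim scaleV (UNIV :: 'v set) = d + 2"
    and dimW: "vector_space.dim scaleW (UNIV :: 'w set) = d + 2"
    and "quasilinear_form p scaleV \<phi>" and "\<not> isotropic \<phi>"
    and "quasilinear_form p scaleW \<psi>" and "\<not> isotropic \<psi>"
    and XY: "exists_rational_morphism (hypersurface p BV \<phi>) (hypersurface p BW \<psi>)"
    and YX: "exists_rational_morphism (hypersurface p BW \<psi>) (hypersurface p BV \<phi>)"
    and "p ^ n < d + 2" and "d + 2 \<le> p ^ (n + 1)"
    and "d \<le> p ^ n + n"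
  shows "birational (hypersurface p BV \<phi>) (hypersurface p BW \<psi>)"
proof -
  obtain ix b0 where X: "card BV = d + 2" "qform p BV \<phi> ix b0"
    using qform_of_quasilinear[OF assms(1,2) V dimV assms(8,9)] by (elim conjE exE)
  obtain iy c0 where Y: "card BW = d + 2" "qform p BW \<psi> iy c0"
    using qform_of_quasilinear[OF assms(1,2) W dimW assms(10,11)] by (elim conjE exE)
  have card: "card BV = card BW" using X(1) Y(1) by simp
  have "\<exists>G D H D' q' m. qbir_axioms p BV \<phi> ix b0 BW \<psi> iy c0 G D H D' q' m"
    using birational_polys_exist[OF qpair_of_rational_morphism[OF X(2) Y(2) XY]
      qpair_of_rational_morphism[OF Y(2) X(2) YX] card]
    unfolding qbir_axioms_def by blast
  then obtain G D H D' q' m where "qbir_axioms p BV \<phi> ix b0 BW \<psi> iy c0 G D H D' q' m"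
    by (elim exE)
  then have "qbir p BV \<phi> ix b0 BW \<psi> iy c0 G D H D' q' m"
    by (intro qbir.intro X Y)
  then show ?thesis by (rule qbir.birational)
qed

end
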